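(* Suppose Assumptions A1–A6 below hold. Suppose also that for every $i$ with $H_i=0$, conditionally on $x_i$, $p_i$ has a density $f_0$ on $[0,1]$ (not depending on $i$) satisfying $$\int_0^a f_0(u)\,du\le\int_{1-a}^1 f_0(u)\,du\quad\text{for all }a\in[0,1].$$ Then $$\limsup_{m\to\infty}\mathrm{FDR}(\hat t,\hat\Pi,\hat K)\le\alpha.$$
   Context: Setting: $(x_i,p_i)_{i\ge1}$ is a sequence of random vectors with covariates $x_i\in\mathbb{R}^q$ and p-values $p_i\in(0,1]$. The $H_i\in\{0,1\}$ are non-random indicators, with $H_i=0$ iff the $i$th null hypothesis is true. For each $m$, hypotheses $i=1,\dots,m$ are tested, and $\alpha\in(0,1)$ is the target level. Models: for $\theta=(\theta_0,\theta_1)$ and $\beta=(\beta_0,\beta_1)$ in $\mathbb{R}^{q+1}$, let $$\pi_\theta(x)=\frac{1}{1+e^{-\theta_0-\theta_1'x}},\qquad k_\beta(x)=\frac{1}{1+e^{-\beta_0-\beta_1'x}}.$$ Parameter sets are $\Theta,\mathcal B\subseteq\mathbb{R}^{q+1}$. Estimator: $(\hat\theta,\hat\beta)$ maximizes $\sum_{i=1}^m\log\{\pi_\theta(x_i)+(1-\pi_\theta(x_i))(1-k_\beta(x_i))p_i^{-k_\beta(x_i)}\}$ over $\Theta\times\mathcal B$. Winsorization: fix $\epsilon_1,\epsilon_2>0$ with $\epsilon_1<1-\epsilon_2$, and let $W(u)=\min\{\max\{u,\epsilon_1\},1-\epsilon_2\}$. Define $\hat\pi_i=W(\pi_{\hat\theta}(x_i))$,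 $\hat k_i=k_{\hat\beta}(x_i)$, $\pi_i^*=W(\pi_{\theta^*}(x_i))$, $k_i^*=k_{\beta^*}(x_i)$, with $(\theta^*,\beta^* )$ as in A2. Write $\hat\Pi=(\hat\pi_1,\dots,\hat\pi_m)$ and $\hat K=(\hat k_1,\dots,\hat k_m)$. Threshold: for $t\in(0,1)$, $\pi,k\in(0,1)$, let $$c(t,\pi,k)=1\wedge\Big\{\frac{t(1-k)(1-\pi)}{(1-t)\pi}\Big\}^{1/k}.$$ Let $\hat w_i(t)=\frac{(1-t)\hat\pi_i}{t(1-\hat\pi_i)}$ and $$\hat t=\max\Big\{t\in[0,1]:\frac{1+\sum_{i=1}^m\mathbf 1\{(1-\hat k_i)(1-p_i)^{-\hat k_i}>\hat w_i(t)\}}{1\vee\sum_{i=1}^m\mathbf 1\{(1-\hat k_i)p_i^{-\hat k_i}\ge\hat w_i(t)\}}\le\alpha\Big\}.$$ The procedure rejects $H_i$ iff $p_i\le c(\hat t,\hat\pi_i,\hat k_i)$. FDR: for vectors $\Pi=(\pi_i)$, $K=(k_i)$, $$\mathrm{FDR}(t,\Pi,K)=E\Big[\frac{\sum_{i=1}^m(1-H_i)\mathbf 1\{p_i\le c(t,\pi_i,k_i)\}}{\sum_{i=1}^m\mathbf 1\{p_i\le c(t,\pi_i,k_i)\}}\Big],$$ with $0/0=0$. A1: $\Theta$ and $\mathcal B$ are compact. A2: $\frac1m\sum_{i=1}^m E\log\{\pi_\theta(x_i)+(1-\pi_\theta(x_i))(1-k_\beta(x_i))p_i^{-k_\beta(x_i)}\}$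 converges uniformly over $\Theta\times\mathcal B$ to a function $R(\theta,\beta)$ with unique maximizer $(\theta^*,\beta^* )$ in $\Theta\times\mathcal B$. A3: Let $\mathcal F_a^b=\sigma((x_i,p_i):a\le i\le b)$. Define $$\alpha(v)=\sup_b\sup_{A\in\mathcal F_{1}^b,B\in\mathcal F_{b+v}^{\infty}}|P(AB)-P(A)P(B)|,\qquad \phi(v)=\sup_b\sup_{A\in\mathcal F_{1}^b,B\in\mathcal F_{b+v}^{\infty},P(B)>0}|P(A|B)-P(A)|.$$ Either $\alpha(v)=O(v^{-\xi})$ for some $r>1$ and $\xi>r/(r-1)$, or $\phi(v)=O(v^{-\xi})$ for some $r\ge1$ and $\xi>r/(2r-1)$. Moreover, $\sup_iE|\log p_i|^{r+\delta}<\infty$ for some $\delta>0$, and $\max_i\|x_i\|_\infty<C$. A4: For every sufficiently small $\epsilon>0$ there is $c_0=c_0(\epsilon)$ such that, for all large $m$ and all sequences $a_i,b_i\in[\epsilon,1]$, $$\Big|\frac1m\sum_{i=1}^m\{P(p_i\le a_i|x_i)-P(p_i\le b_i|x_i)\}\Big|\le c_0\max_i|a_i-b_i|.$$ A5: There is $t_0\in(0,1)$ such that for all $t\ge t_0$, as $m\to\infty$, $$\frac1m\sum_{i=1}^mP(p_i\le c(t,\pi_i^*,k_i^* ))\to G_0(t),\quad \frac1m\sum_{i=1}^mP(1-p_i<c(t,\pi_i^*,k_i^* ))\to G_1(t),\quad \frac1m\sum_{i:H_i=0}P(p_i\le c(t,\pi_i^*,k_i^* ))\to\tilde G_1(t),$$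 where $G_0,G_1,\tilde G_1$ are continuous. Probabilities are taken over the joint law of $(p_i,x_i)$. A6: With $U(t)=G_1(t)/G_0(t)$, there exists $t'>t_0$ with $U(t')<\alpha$. *)

theory Defs
  imports "HOL-Probability.Probability" "HOL-Library.Landau_Symbols"
begin

(* Parameters theta = (theta_0, theta_1) in R^{q+1}, represented as real * real^'q *)

definition logistic :: "real \<times> (real^'q::finite) \<Rightarrow> real^'q \<Rightarrow> real" where
  "logistic \<theta> x = 1 / (1 + exp (- fst \<theta> - snd \<theta> \<bullet> x))"

definition winsor :: "real \<Rightarrow> real \<Rightarrow> real \<Rightarrow> real" where
  "winsor e1 e2 u = min (max u e1) (1 - e2)"

definition lik_term :: "real \<Rightarrow> real \<Rightarrow> real \<Rightarrow> real" where
  "lik_term \<pi> k p = ln (\<pi> + (1 - \<pi>) * (1 - k) * p powr (- k))"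

definition loglik :: "nat \<Rightarrow> (nat \<Rightarrow> real^'q::finite) \<Rightarrow> (nat \<Rightarrow> real)
                      \<Rightarrow> real \<times> (real^'q) \<Rightarrow> real \<times> (real^'q) \<Rightarrow> real" where
  "loglik m x p \<theta> \<beta> = (\<Sum>i\<in>{1..m}. lik_term (logistic \<theta> (x i)) (logistic \<beta> (x i)) (p i))"

(* threshold c(t,pi,k); for t in (0,1) it is the paper's formula.
   At t = 1 we use the limiting value 1; at t = 0 the formula gives 0. *)
definition thr :: "real \<Rightarrow> real \<Rightarrow> real \<Rightarrow> real" where
  "thr t \<pi> k = (if 1 \<le> t then 1
               else min 1 ((t * (1 - k) * (1 - \<pi>) / ((1 - t) * \<pi>)) powr (1 / k)))"

definition wt :: "real \<Rightarrow> real \<Rightarrow> real" where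
  "wt t \<pi> = (1 - t) * \<pi> / (t * (1 - \<pi>))"

(* the data-driven threshold t-hat; P = p-values, PiV = winsorized pi-hats, K = k-hats.
   (1-p)^(-k) is +infinity when p = 1, hence the disjunct "P i = 1".
   "max" is rendered as Sup (the maximum is attained when the set is nonempty);
   if the set is empty we use t-hat = 0 (no rejections). *)
definition that :: "real \<Rightarrow> nat \<Rightarrow> (nat \<Rightarrow> real) \<Rightarrow> (nat \<Rightarrow> real) \<Rightarrow> (nat \<Rightarrow> real) \<Rightarrow> real" where
  "that \<alpha> m P PiV K =
    (let S = {t \<in> {0..1}.
               real (1 + card {i \<in> {1..m}. P i = 1 \<or> wt t (PiV i) < (1 - K i) * (1 - P i) powr (- K i)})
               / real (max 1 (card {i \<in> {1..m}. wt t (PiV i) \<le> (1 - K i) * P i powr (- K i)}))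
               \<le> \<alpha>}
     in if S = {} then 0 else Sup S)"

(* false discovery proportion (0/0 = 0 as in the paper) *)
definition fdp :: "nat \<Rightarrow> (nat \<Rightarrow> nat) \<Rightarrow> (nat \<Rightarrow> real) \<Rightarrow> real \<Rightarrow> (nat \<Rightarrow> real) \<Rightarrow> (nat \<Rightarrow> real) \<Rightarrow> real" where
  "fdp m H P t PiV K =
     (\<Sum>i\<in>{1..m}. real (1 - H i) * (if P i \<le> thr t (PiV i) (K i) then 1 else 0))
     / (\<Sum>i\<in>{1..m}. (if P i \<le> thr t (PiV i) (K i) then 1 else 0))"

definition FDR :: "'a measure \<Rightarrow> nat \<Rightarrow> (nat \<Rightarrow> nat) \<Rightarrow> (nat \<Rightarrow> 'a \<Rightarrow> real)
                   \<Rightarrow> ('a \<Rightarrow> real) \<Rightarrow> ('a \<Rightarrow> nat \<Rightarrow> real) \<Rightarrow> ('a \<Rightarrow> nat \<Rightarrow> real) \<Rightarrow> real" where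
  "FDR M m H p t PiV K = (\<integral>\<omega>. fdp m H (\<lambda>i. p i \<omega>) (t \<omega>) (PiV \<omega>) (K \<omega>) \<partial>M)"

definition genF :: "'a measure \<Rightarrow> (nat \<Rightarrow> 'a \<Rightarrow> 'b::topological_space) \<Rightarrow> nat set \<Rightarrow> 'a set set" where
  "genF M X I = sigma_sets (space M) (\<Union>i\<in>I. {X i -` A \<inter> space M | A. A \<in> sets borel})"

definition alpha_mix :: "'a measure \<Rightarrow> (nat \<Rightarrow> 'a \<Rightarrow> 'b::topological_space) \<Rightarrow> nat \<Rightarrow> real" where
  "alpha_mix M X v = Sup {\<bar>measure M (A \<inter> B) - measure M A * measure M B\<bar> | A B.
      \<exists>b. A \<in> genF M X {1..b} \<and> B \<in> genF M X {b + v..}}"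

definition phi_mix :: "'a measure \<Rightarrow> (nat \<Rightarrow> 'a \<Rightarrow> 'b::topological_space) \<Rightarrow> nat \<Rightarrow> real" where
  "phi_mix M X v = Sup {\<bar>measure M (A \<inter> B) / measure M B - measure M A\<bar> | A B.
      \<exists>b. A \<in> genF M X {1..b} \<and> B \<in> genF M X {b + v..} \<and> 0 < measure M B}"

definition condP :: "'a measure \<Rightarrow> ('a \<Rightarrow> 'b::topological_space) \<Rightarrow> 'a set \<Rightarrow> 'a \<Rightarrow> real" where
  "condP M Y A = real_cond_exp M (vimage_algebra (space M) Y borel) (indicator A)"

end

theory Submission
  imports Defs
begin

text \<open>
  Mixing gives a weak law of large numbers for bounded functions of \<open>(x\<^sub>i, p\<^sub>i)\<close>, and truncating the
  p-values away from 0 extends it to the log-likelihood, uniformly in the parameters; hence the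
  estimator is consistent. With high probability the estimated cutoffs are then uniformly close to the
  limiting ones, so the counts at \<open>t\<close> of rejections, of null rejections and of mirrored p-values
  \<open>1 - p\<^sub>i\<close> below the cutoff lie, for \<open>t\<close> near a point of a finite grid, between counts for
  deterministic cutoffs, and A4 makes the gap negligible. Assumption A6 makes some \<open>t' > t\<^sub>0\<close> feasible,
  so \<open>t'\<close> bounds the data-driven threshold from below and the rejection count is of order \<open>m\<close>.
  The tail condition on \<open>f\<^sub>0\<close> bounds the expected null rejections by the expected mirrored count,
  which at the data-driven threshold is at most \<open>\<alpha>\<close> times the number of rejections.
\<close>

section \<open>Convergence in probability as a filter\<close>

definition whp :: "'a measure \<Rightarrow> (nat \<times> 'a) filter" where
  "whp M = Abs_filter (\<lambda>P. \<forall>e>0. \<forall>\<^sub>F m in sequentially.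
     \<exists>A\<in>sets M. 1 - e \<le> measure M A \<and> (\<forall>\<omega>\<in>A. P (m, \<omega>)))"

context prob_space
begin

lemma eventually_whp:
  "eventually P (whp M) \<longleftrightarrow> (\<forall>e>0. \<forall>\<^sub>F m in sequentially.
     \<exists>A\<in>sets M. 1 - e \<le> prob A \<and> (\<forall>\<omega>\<in>A. P (m, \<omega>)))"
  unfolding whp_def
proof (rule eventually_Abs_filter, rule is_filter.intro)
  show "\<forall>e>0. \<forall>\<^sub>F m in sequentially. \<exists>A\<in>events. 1 - e \<le> prob A \<and> (\<forall>\<omega>\<in>A. True)"
    by (intro allI impI always_eventually bexI[of _ "space M"]) (auto simp: prob_space)
next
  fix P Q :: "nat \<times> 'a \<Rightarrow> bool"
  assume P: "\<forall>e>0. \<forall>\<^sub>F m in sequentially. \<exists>A\<in>events. 1 - e \<le> prob A \<and> (\<forall>\<omega>\<in>A. P (m, \<omega>))"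
    and Q: "\<forall>e>0. \<forall>\<^sub>F m in sequentially. \<exists>A\<in>events. 1 - e \<le> prob A \<and> (\<forall>\<omega>\<in>A. Q (m, \<omega>))"
  show "\<forall>e>0. \<forall>\<^sub>F m in sequentially. \<exists>A\<in>events. 1 - e \<le> prob A \<and> (\<forall>\<omega>\<in>A. P (m, \<omega>) \<and> Q (m, \<omega>))"
  proof (intro allI impI)
    fix e :: real assume "e > 0"
    then have "e / 2 > 0" by simp
    then have "\<forall>\<^sub>F m in sequentially. \<exists>A\<in>events. 1 - e / 2 \<le> prob A \<and> (\<forall>\<omega>\<in>A. P (m, \<omega>))"
      "\<forall>\<^sub>F m in sequentially. \<exists>A\<in>events. 1 - e / 2 \<le> prob A \<and> (\<forall>\<omega>\<in>A. Q (m, \<omega>))"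
      using P Q by blast+
    then show "\<forall>\<^sub>F m in sequentially. \<exists>A\<in>events. 1 - e \<le> prob A \<and> (\<forall>\<omega>\<in>A. P (m, \<omega>) \<and> Q (m, \<omega>))"
    proof eventually_elim
      case (elim m)
      then obtain A B where AB: "A \<in> events" "1 - e / 2 \<le> prob A" "\<forall>\<omega>\<in>A. P (m, \<omega>)"
        "B \<in> events" "1 - e / 2 \<le> prob B" "\<forall>\<omega>\<in>B. Q (m, \<omega>)" by blast
      have "prob (A \<union> B) = prob A + prob (B - A)"
        using AB by (intro finite_measure_Union') auto
      moreover have "prob (B - A) = prob B - prob (A \<inter> B)"
        using AB by (subst finite_measure_Diff'[OF AB(4,1)]) (simp add: Int_commute)
      moreover have "prob (A \<union> B) \<le> 1" by simp
      ultimately have "1 - e \<le> prob (A \<inter> B)" using AB(2,5) by linarith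
      with AB show ?case by (intro bexI[of _ "A \<inter> B"]) auto
    qed
  qed
next
  fix P Q :: "nat \<times> 'a \<Rightarrow> bool"
  assume PQ: "\<forall>x. P x \<longrightarrow> Q x"
  assume P: "\<forall>e>0. \<forall>\<^sub>F m in sequentially. \<exists>A\<in>events. 1 - e \<le> prob A \<and> (\<forall>\<omega>\<in>A. P (m, \<omega>))"
  show "\<forall>e>0. \<forall>\<^sub>F m in sequentially. \<exists>A\<in>events. 1 - e \<le> prob A \<and> (\<forall>\<omega>\<in>A. Q (m, \<omega>))"
    using P PQ by (smt (verit) eventually_mono)
qed

lemma eventually_whpI:
  assumes "\<And>e. e > 0 \<Longrightarrow> \<forall>\<^sub>F m in sequentially.
     \<exists>A\<in>sets M. 1 - e \<le> prob A \<and> (\<forall>\<omega>\<in>A. P (m, \<omega>))"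
  shows "eventually P (whp M)"
  using assms by (simp add: eventually_whp)

lemma eventually_whp_sequentially:
  assumes "eventually P sequentially"
  shows "\<forall>\<^sub>F (m, \<omega>) in whp M. P m \<and> \<omega> \<in> space M"
proof (rule eventually_whpI)
  fix e :: real assume "e > 0"
  show "\<forall>\<^sub>F m in sequentially. \<exists>A\<in>events. 1 - e \<le> prob A \<and>
      (\<forall>\<omega>\<in>A. case (m, \<omega>) of (m, \<omega>) \<Rightarrow> P m \<and> \<omega> \<in> space M)"
    using assms
    by eventually_elim (use \<open>e > 0\<close> in \<open>intro bexI[of _ "space M"], auto simp: prob_space\<close>)
qed

text \<open>If \<open>f m\<close> is not integrable, its integral is the junk value 0 and the bound holds trivially.\<close>

lemma limsup_integral_le:
  fixes f :: "nat \<Rightarrow> 'a \<Rightarrow> real"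
  assumes c: "0 \<le> c"
    and f: "\<And>m \<omega>. \<omega> \<in> space M \<Longrightarrow> f m \<omega> \<le> 1"
    and ev: "\<And>g. g > 0 \<Longrightarrow> \<forall>\<^sub>F (m, \<omega>) in whp M. f m \<omega> \<le> c + g"
  shows "limsup (\<lambda>m. ereal (\<integral>\<omega>. f m \<omega> \<partial>M)) \<le> ereal c"
proof (rule ereal_le_epsilon2)
  fix e :: real assume e: "e > 0"
  have "\<forall>\<^sub>F m in sequentially. \<exists>A\<in>sets M. 1 - e / 2 \<le> prob A \<and> (\<forall>\<omega>\<in>A. f m \<omega> \<le> c + e / 2)"
    using ev[of "e / 2"] e unfolding eventually_whp by (auto dest!: spec[of _ "e / 2"])
  then have "\<forall>\<^sub>F m in sequentially. ereal (\<integral>\<omega>. f m \<omega> \<partial>M) \<le> ereal c + ereal e"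
  proof eventually_elim
    case (elim m)
    then obtain A where A: "A \<in> sets M" "1 - e / 2 \<le> prob A" "\<And>\<omega>. \<omega> \<in> A \<Longrightarrow> f m \<omega> \<le> c + e / 2"
      by blast
    have "(\<integral>\<omega>. f m \<omega> \<partial>M) \<le> c + e"
    proof (cases "integrable M (f m)")
      case True
      have "(\<integral>\<omega>. f m \<omega> \<partial>M) \<le> (\<integral>\<omega>. (c + e / 2) + indicator (space M - A) \<omega> \<partial>M)"
      proof (rule integral_mono[OF True])
        show "integrable M (\<lambda>\<omega>. (c + e / 2) + indicator (space M - A) \<omega>)"
          using A(1) by (auto intro!: Bochner_Integration.integrable_add integrable_real_indicator
              simp: less_top[symmetric])
        show "f m \<omega> \<le> (c + e / 2) + indicator (space M - A) \<omega>" if "\<omega> \<in> space M" for \<omega>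
          using A(3)[of \<omega>] f[OF that, of m] c e that by (auto simp: indicator_def)
      qed
      also have "\<dots> = (c + e / 2) + prob (space M - A)"
        using A(1) by (subst Bochner_Integration.integral_add)
          (auto simp: prob_space intro!: integrable_real_indicator simp: less_top[symmetric])
      also have "\<dots> \<le> c + e" using A prob_compl[OF A(1)] by simp
      finally show ?thesis .
    next
      case False
      then show ?thesis using c e by (simp add: not_integrable_integral_eq)
    qed
    then show ?case by simp
  qed
  then show "limsup (\<lambda>m. ereal (\<integral>\<omega>. f m \<omega> \<partial>M)) \<le> ereal c + ereal e"
    by (rule Limsup_bounded)
qed

end

section \<open>Weak laws under mixing\<close>

lemma vimage_in_genF:
  assumes "i \<in> I" "A \<in> sets borel"
  shows "X i -` A \<inter> space M \<in> genF M X I"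
  unfolding genF_def using assms by (intro sigma_sets.Basic) blast

lemma genF_events:
  assumes "\<And>i. i \<in> I \<Longrightarrow> X i \<in> borel_measurable M"
  shows "genF M X I \<subseteq> sets M"
  unfolding genF_def using assms by (intro sets.sigma_sets_subset) (auto intro: measurable_sets)

context prob_space
begin

lemma alpha_mix_ge:
  assumes "A \<in> genF M X {1..b}" "B \<in> genF M X {b + v..}"
  shows "\<bar>prob (A \<inter> B) - prob A * prob B\<bar> \<le> alpha_mix M X v"
  unfolding alpha_mix_def
proof (rule cSup_upper)
  have "\<bar>prob (A \<inter> B) - prob A * prob B\<bar> \<le> 1" for A B
    using mult_le_one[OF prob_le_1 measure_nonneg prob_le_1, of A B]
      prob_le_1[of "A \<inter> B"] measure_nonneg[of M "A \<inter> B"]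
      mult_nonneg_nonneg[OF measure_nonneg measure_nonneg, of M A M B] by linarith
  then show "bdd_above {\<bar>prob (A \<inter> B) - prob A * prob B\<bar> |A B.
      \<exists>b. A \<in> genF M X {1..b} \<and> B \<in> genF M X {b + v..}}"
    by (intro bdd_aboveI[of _ 1]) auto
qed (use assms in blast)

lemma phi_mix_ge:
  assumes "A \<in> genF M X {1..b}" "B \<in> genF M X {b + v..}" "0 < prob B"
  shows "\<bar>prob (A \<inter> B) / prob B - prob A\<bar> \<le> phi_mix M X v"
  unfolding phi_mix_def
proof (rule cSup_upper)
  have "\<bar>prob (A \<inter> B) / prob B - prob A\<bar> \<le> 1" if "0 < prob B" for A B
  proof -
    have "B \<in> sets M" using that by (metis less_irrefl measure_notin_sets)
    then have "prob (A \<inter> B) \<le> prob B"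
      by (intro finite_measure_mono) auto
    then have "prob (A \<inter> B) / prob B \<le> 1" "0 \<le> prob (A \<inter> B) / prob B"
      using that by auto
    with prob_le_1[of A] measure_nonneg[of M A] show ?thesis by linarith
  qed
  then show "bdd_above {\<bar>prob (A \<inter> B) / prob B - prob A\<bar> |A B.
      \<exists>b. A \<in> genF M X {1..b} \<and> B \<in> genF M X {b + v..} \<and> 0 < prob B}"
    by (intro bdd_aboveI[of _ 1]) auto
qed (use assms in blast)

lemma alpha_mix_le_phi_mix:
  assumes X: "\<And>i. i \<ge> 1 \<Longrightarrow> X i \<in> borel_measurable M" and v: "v \<ge> 1"
  shows "alpha_mix M X v \<le> phi_mix M X v"
  unfolding alpha_mix_def
proof (rule cSup_least)
  have E: "space M \<in> genF M X I" for I
    unfolding genF_def by (rule sigma_sets_top)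
  then show "{\<bar>prob (A \<inter> B) - prob A * prob B\<bar> |A B.
      \<exists>b. A \<in> genF M X {1..b} \<and> B \<in> genF M X {b + v..}} \<noteq> {}"
    by blast
  have "0 < prob (space M)" by (simp add: prob_space)
  from order_trans[OF abs_ge_zero phi_mix_ge[OF E E this]]
  have phi0: "0 \<le> phi_mix M X v" .
  fix y assume "y \<in> {\<bar>prob (A \<inter> B) - prob A * prob B\<bar> |A B.
      \<exists>b. A \<in> genF M X {1..b} \<and> B \<in> genF M X {b + v..}}"
  then obtain A B b where AB: "A \<in> genF M X {1..b}" "B \<in> genF M X {b + v..}"
    and y: "y = \<bar>prob (A \<inter> B) - prob A * prob B\<bar>" by blast
  show "y \<le> phi_mix M X v"
  proof (cases "prob B = 0")
    case True
    have "B \<in> sets M"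
      using AB(2) genF_events[of "{b + v..}" X M] X v by force
    then have "prob (A \<inter> B) \<le> prob B" by (intro finite_measure_mono) auto
    with True have "prob (A \<inter> B) = 0" by (simp add: measure_le_0_iff)
    then show ?thesis using True phi0 y by simp
  next
    case False
    then have B: "0 < prob B" by (simp add: zero_less_measure_iff)
    have "prob (A \<inter> B) - prob A * prob B = prob B * (prob (A \<inter> B) / prob B - prob A)"
      using B by (simp add: field_simps)
    then have "y = prob B * \<bar>prob (A \<inter> B) / prob B - prob A\<bar>"
      using y by (simp add: abs_mult)
    also have "\<dots> \<le> 1 * phi_mix M X v"
      by (intro mult_mono phi_mix_ge[OF AB B]) auto
    finally show ?thesis by simp
  qed
qed

end

lemma bigo_powr_tendsto_0:
  fixes f :: "nat \<Rightarrow> real"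
  assumes f: "f \<in> O(\<lambda>v. real v powr (- \<xi>))" and \<xi>: "0 < \<xi>"
  shows "f \<longlonglongrightarrow> 0"
proof -
  obtain c where "\<forall>\<^sub>F v in sequentially. norm (f v) \<le> c * norm (real v powr (- \<xi>))"
    using f by (elim landau_o.bigE)
  then show ?thesis
  proof (rule Lim_null_comparison)
    have "(\<lambda>v. real v powr (- \<xi>)) \<longlonglongrightarrow> 0"
      using \<xi> by (intro tendsto_neg_powr filterlim_real_sequentially) auto
    then show "(\<lambda>v. c * norm (real v powr (- \<xi>))) \<longlonglongrightarrow> 0"
      by (intro tendsto_mult_right_zero tendsto_norm_zero)
  qed
qed

lemma (in prob_space) phi_mixing_imp_alpha_mixing:
  assumes X: "\<And>i. i \<ge> 1 \<Longrightarrow> X i \<in> borel_measurable M" and phi: "phi_mix M X \<longlonglongrightarrow> 0"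
  shows "alpha_mix M X \<longlonglongrightarrow> 0"
proof (rule tendsto_sandwich[OF _ _ tendsto_const phi])
  have E: "space M \<in> genF M X I" for I unfolding genF_def by (rule sigma_sets_top)
  show "\<forall>\<^sub>F v in sequentially. 0 \<le> alpha_mix M X v"
    using order_trans[OF abs_ge_zero alpha_mix_ge[OF E E]] by simp
  show "\<forall>\<^sub>F v in sequentially. alpha_mix M X v \<le> phi_mix M X v"
    using eventually_ge_at_top[of 1] by eventually_elim (rule alpha_mix_le_phi_mix[OF X])
qed

locale alpha_mixing = prob_space M for M :: "'a measure" +
  fixes X :: "nat \<Rightarrow> 'a \<Rightarrow> 'b::topological_space"
  assumes X_measurable: "\<And>i. i \<ge> 1 \<Longrightarrow> X i \<in> borel_measurable M"
    and alpha_mix_null: "alpha_mix M X \<longlonglongrightarrow> 0"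
begin

lemma weak_law_indicator:
  assumes C: "\<And>i. C i \<in> sets borel"
  defines "E \<equiv> \<lambda>i. X i -` C i \<inter> space M"
  shows "((\<lambda>(m, \<omega>). (\<Sum>i\<in>{1..m}. indicator (E i) \<omega> - prob (E i)) / real m) \<longlongrightarrow> 0) (whp M)"
  unfolding tendsto_iff
proof (intro allI impI eventually_whpI)
  fix e \<eta> :: real assume e: "e > 0" and \<eta>: "\<eta> > 0"
  have meas: "E i \<in> sets M" if "i \<ge> 1" for i
    unfolding E_def using X_measurable[OF that] C by (rule measurable_sets)
  define cov where "cov = (\<lambda>i j. prob (E i \<inter> E j) - prob (E i) * prob (E j))"
  have cov_comm: "cov i j = cov j i" for i j
    by (simp add: cov_def Int_commute mult.commute)
  have cov_le: "\<bar>cov i j\<bar> \<le> alpha_mix M X (j - i)" if "1 \<le> i" "i \<le> j" for i j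
    unfolding cov_def using that C
    by (intro alpha_mix_ge[of _ _ i]) (auto simp: E_def intro!: vimage_in_genF)
  have cov_1: "cov i j \<le> 1" for i j
    unfolding cov_def using prob_le_1[of "E i \<inter> E j"] 
    by (smt (verit) measure_nonneg mult_nonneg_nonneg)
  define g where "g = e\<^sup>2 * \<eta> / 2"
  have g: "g > 0" using e \<eta> by (simp add: g_def)
  obtain V where V: "\<And>v. v \<ge> V \<Longrightarrow> \<bar>alpha_mix M X v\<bar> < g"
    using alpha_mix_null g by (auto simp: LIMSEQ_iff)
  have row: "(\<Sum>j\<in>{1..m}. cov i j) \<le> 2 * real V + g * real m" if i: "i \<in> {1..m}" for i m
  proof -
    let ?N = "{j\<in>{1..m}. i < j + V \<and> j < i + V}"
    have "(\<Sum>j\<in>{1..m}. cov i j) \<le> (\<Sum>j\<in>{1..m}. (if j \<in> ?N then 1 else 0) + g)"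
    proof (rule sum_mono)
      fix j assume j: "j \<in> {1..m}"
      show "cov i j \<le> (if j \<in> ?N then 1 else 0) + g"
      proof (cases "j \<in> ?N")
        case True then show ?thesis using cov_1[of i j] g by simp
      next
        case False
        then have "V \<le> j - i \<and> i \<le> j \<or> V \<le> i - j \<and> j \<le> i" using j by auto
        then have "\<bar>cov i j\<bar> \<le> g"
          using cov_le[of i j] cov_le[of j i] V[of "j - i"] V[of "i - j"] cov_comm[of i j] i j by auto
        then show ?thesis using False by auto
      qed
    qed
    also have "\<dots> = real (card ?N) + g * real m"
      by (simp add: sum.distrib sum.If_cases Int_def conj_commute mult.commute)
    also have "card ?N \<le> card {i - V..<i + V}" by (intro card_mono) auto
    also have "\<dots> \<le> 2 * V" by simp
    finally show ?thesis by simp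
  qed
  define S where "S = (\<lambda>m \<omega>. \<Sum>i\<in>{1..m}. indicator (E i) \<omega> - prob (E i))"
  have int: "integrable M (\<lambda>\<omega>. indicator (E i) \<omega> :: real)" if "i \<ge> 1" for i
    using meas[OF that] by (intro integrable_real_indicator) (auto simp: less_top[symmetric])
  have int2: "integrable M (\<lambda>\<omega>. indicator (E i \<inter> E j) \<omega> :: real)" if "i \<ge> 1" "j \<ge> 1" for i j
    using meas[OF that(1)] meas[OF that(2)] by (intro integrable_real_indicator) (auto simp: less_top[symmetric])
  have sq: "(S m \<omega>)\<^sup>2 = (\<Sum>i\<in>{1..m}. \<Sum>j\<in>{1..m}. indicator (E i \<inter> E j) \<omega>
      - prob (E i) * indicator (E j) \<omega> - prob (E j) * indicator (E i) \<omega> + prob (E i) * prob (E j))" for m \<omega>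
    unfolding S_def power2_eq_square sum_product
    by (intro sum.cong refl) (simp add: indicator_inter_arith algebra_simps)
  have Sint: "integrable M (\<lambda>\<omega>. (S m \<omega>)\<^sup>2)" for m
    unfolding sq by (intro Bochner_Integration.integrable_sum Bochner_Integration.integrable_add Bochner_Integration.integrable_diff
        integrable_mult_right int int2 integrable_const) auto
  have "(\<integral>\<omega>. (S m \<omega>)\<^sup>2 \<partial>M) = (\<Sum>i\<in>{1..m}. \<Sum>j\<in>{1..m}. cov i j)" for m
  proof -
    have "(\<integral>\<omega>. (S m \<omega>)\<^sup>2 \<partial>M) = (\<Sum>i\<in>{1..m}. \<Sum>j\<in>{1..m}. \<integral>\<omega>. indicator (E i \<inter> E j) \<omega>
      - prob (E i) * indicator (E j) \<omega> - prob (E j) * indicator (E i) \<omega> + prob (E i) * prob (E j) \<partial>M)"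
      unfolding sq
      by (subst Bochner_Integration.integral_sum, (intro Bochner_Integration.integrable_sum Bochner_Integration.integrable_add Bochner_Integration.integrable_diff
        integrable_mult_right int int2 integrable_const; simp),
        intro sum.cong refl, subst Bochner_Integration.integral_sum)
       (auto intro!: Bochner_Integration.integrable_add Bochner_Integration.integrable_diff
        integrable_mult_right int int2 integrable_const)
    also have "\<dots> = (\<Sum>i\<in>{1..m}. \<Sum>j\<in>{1..m}. cov i j)"
    proof (intro sum.cong refl)
      fix i j assume ij: "i \<in> {1..m}" "j \<in> {1..m}"
      then have "E i \<in> sets M" "E j \<in> sets M" using meas by auto
      then show "(\<integral>\<omega>. indicator (E i \<inter> E j) \<omega>
      - prob (E i) * indicator (E j) \<omega> - prob (E j) * indicator (E i) \<omega> + prob (E i) * prob (E j) \<partial>M) = cov i j"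
        using int[of i] int[of j] int2[of i j] ij 
        by (simp add: cov_def prob_space sets.Int_space_eq2 algebra_simps)
    qed
    finally show ?thesis .
  qed
  then have ES: "(\<integral>\<omega>. (S m \<omega>)\<^sup>2 \<partial>M) \<le> real m * (2 * real V + g * real m)" for m
    using sum_bounded_above[of "{1..m}" "\<lambda>i. \<Sum>j\<in>{1..m}. cov i j", OF row] by simp
  have "\<forall>\<^sub>F m in sequentially. 4 * real V / (e\<^sup>2 * \<eta>) \<le> real m"
    by (rule eventually_sequentiallyI[of "nat \<lceil>4 * real V / (e\<^sup>2 * \<eta>)\<rceil>"]) linarith
  moreover have "\<forall>\<^sub>F m in sequentially. m \<ge> (1::nat)" by (rule eventually_ge_at_top)
  ultimately show "\<forall>\<^sub>F m in sequentially. \<exists>A\<in>events. 1 - \<eta> \<le> prob A \<and> (\<forall>\<omega>\<in>A.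
      dist (case (m, \<omega>) of (m, \<omega>) \<Rightarrow> (\<Sum>i\<in>{1..m}. indicator (E i) \<omega> - prob (E i)) / real m) 0 < e)"
  proof eventually_elim
    case (elim m)
    have Smeas: "S m \<in> borel_measurable M"
      unfolding S_def using meas by (intro borel_measurable_sum borel_measurable_diff borel_measurable_indicator) auto
    let ?B = "{\<omega>\<in>space M. (S m \<omega>)\<^sup>2 \<ge> (e * real m)\<^sup>2}"
    have "prob ?B \<le> (\<integral>\<omega>. (S m \<omega>)\<^sup>2 \<partial>M) / (e * real m)\<^sup>2"
      using e elim by (intro integral_Markov_inequality_measure[where A="space M", OF Sint]) auto
    also have "\<dots> \<le> real m * (2 * real V + g * real m) / (e * real m)\<^sup>2"
      by (intro divide_right_mono ES) auto
    also have "\<dots> \<le> \<eta>"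
      using elim e \<eta> by (simp add: g_def field_simps power2_eq_square)
    finally have "1 - \<eta> \<le> prob (space M - ?B)"
      using Smeas by (subst prob_compl) auto
    moreover have "space M - ?B \<in> events" using Smeas by measurable
    moreover have "\<bar>S m \<omega>\<bar> / real m < e" if "\<omega> \<in> space M - ?B" for \<omega>
    proof -
      have "(S m \<omega>)\<^sup>2 < (e * real m)\<^sup>2" using that by auto
      then have "\<bar>S m \<omega>\<bar> < e * real m"
        using e by (metis abs_of_nonneg less_imp_le mult_nonneg_nonneg of_nat_0_le_iff abs_le_square_iff not_le)
      then show ?thesis using elim by (simp add: field_simps)
    qed
    ultimately show ?case
    proof (intro bexI[of _ "space M - ?B"] conjI ballI)
      fix \<omega> assume "\<omega> \<in> space M - ?B" and "\<And>\<omega>. \<omega> \<in> space M - ?B \<Longrightarrow> \<bar>S m \<omega>\<bar> / real m < e"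
      then have "\<bar>S m \<omega> / real m\<bar> < e" by simp
      then show "dist (case (m, \<omega>) of (m, \<omega>) \<Rightarrow> (\<Sum>i\<in>{1..m}. indicator (E i) \<omega> - prob (E i)) / real m) 0 < e"
        by (simp only: S_def dist_real_def diff_zero prod.case)
    qed
  qed
qed

end

lemma fst_borel_measurable [measurable]:
  "fst \<in> borel_measurable (borel :: ('a::topological_space \<times> 'b::topological_space) measure)"
  by (intro borel_measurable_continuous_onI continuous_intros)

lemma snd_borel_measurable [measurable]:
  "snd \<in> borel_measurable (borel :: ('a::topological_space \<times> 'b::topological_space) measure)"
  by (intro borel_measurable_continuous_onI continuous_intros)

lemma layer_cake_error:
  fixes u :: real and n :: nat
  assumes u: "0 \<le> u" "u \<le> 1" and n: "n \<ge> 1"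
  shows "\<bar>u - (\<Sum>j\<in>{1..n}. if real j / real n \<le> u then 1 else 0) / real n\<bar> \<le> 1 / real n"
proof -
  define N where "N = nat \<lfloor>real n * u\<rfloor>"
  have "real n * u \<le> real n" using u by (simp add: mult_left_le)
  then have "N \<le> n" unfolding N_def by linarith
  have iff: "real j / real n \<le> u \<longleftrightarrow> j \<le> N" for j
  proof -
    have "real j / real n \<le> u \<longleftrightarrow> real j \<le> real n * u"
      using n by (simp add: divide_le_eq mult.commute)
    also have "\<dots> \<longleftrightarrow> j \<le> N"
      unfolding N_def using u by (simp add: le_nat_iff le_floor_iff)
    finally show ?thesis .
  qed
  have "(\<Sum>j\<in>{1..n}. if real j / real n \<le> u then 1 else 0) = (\<Sum>j\<in>{j\<in>{1..n}. j \<le> N}. 1 :: real)"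
    unfolding iff by (rule sum.inter_filter[symmetric]) simp
  also have "{j\<in>{1..n}. j \<le> N} = {1..N}" using \<open>N \<le> n\<close> by auto
  finally have sum: "(\<Sum>j\<in>{1..n}. if real j / real n \<le> u then 1 else 0) = real N" by simp
  have "real N = of_int \<lfloor>real n * u\<rfloor>" using u by (simp add: N_def)
  then have "\<bar>real n * u - real N\<bar> \<le> 1" by linarith
  moreover have "u - real N / real n = (real n * u - real N) / real n"
    using n by (simp add: diff_divide_distrib)
  ultimately show ?thesis unfolding sum using n
    by (simp add: divide_right_mono)
qed

context alpha_mixing
begin

lemma weak_law_unit_interval:
  fixes h :: "nat \<Rightarrow> 'b \<Rightarrow> real"
  assumes h: "\<And>i. h i \<in> borel_measurable borel"
    and hr: "\<And>i \<omega>. i \<ge> 1 \<Longrightarrow> \<omega> \<in> space M \<Longrightarrow> 0 \<le> h i (X i \<omega>) \<and> h i (X i \<omega>) \<le> 1"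
  shows "((\<lambda>(m, \<omega>). (\<Sum>i\<in>{1..m}. h i (X i \<omega>) - (\<integral>\<omega>. h i (X i \<omega>) \<partial>M)) / real m) \<longlongrightarrow> 0) (whp M)"
  unfolding tendsto_iff
proof (intro allI impI)
  fix e :: real assume e: "e > 0"
  obtain n :: nat where n: "real n > 4 / e" using reals_Archimedean2 by blast
  have n1: "n \<ge> 1" using n e by (cases n) (auto simp: not_less[symmetric])
  define C where "C = (\<lambda>j i. {z. real j / real n \<le> h i z})"
  have C: "C j i \<in> sets borel" for j i
    unfolding C_def using h[of i] by measurable
  define E where "E = (\<lambda>j i. X i -` C j i \<inter> space M)"
  define q where "q = (\<lambda>i \<omega>. (\<Sum>j\<in>{1..n}. indicator (E j i) \<omega>) / real n)"
  have E: "E j i \<in> sets M" if "i \<ge> 1" for i j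
    unfolding E_def using X_measurable[OF that] C by (rule measurable_sets)
  have intE: "integrable M (\<lambda>\<omega>. indicator (E j i) \<omega> :: real)" if "i \<ge> 1" for i j
    using E[OF that] by (intro integrable_real_indicator) (auto simp: less_top[symmetric])
  have intq: "integrable M (q i)" if "i \<ge> 1" for i
    unfolding q_def using that
    by (intro integrable_divide Bochner_Integration.integrable_sum intE) 
  have Eq: "(\<integral>\<omega>. q i \<omega> \<partial>M) = (\<Sum>j\<in>{1..n}. prob (E j i)) / real n" if "i \<ge> 1" for i
    unfolding q_def using that E[OF that] by (simp add: intE Bochner_Integration.integral_sum sets.Int_space_eq2)
  have hq: "\<bar>h i (X i \<omega>) - q i \<omega>\<bar> \<le> 1 / real n" if "i \<ge> 1" "\<omega> \<in> space M" for i \<omega>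
  proof -
    have "q i \<omega> = (\<Sum>j\<in>{1..n}. if real j / real n \<le> h i (X i \<omega>) then 1 else 0) / real n"
      unfolding q_def using that
      by (intro arg_cong2[where f="(/)"] sum.cong refl) (auto simp: E_def C_def indicator_def)
    then show ?thesis using layer_cake_error[OF _ _ n1] hr[OF that] by simp
  qed
  have inth: "integrable M (\<lambda>\<omega>. h i (X i \<omega>))" if "i \<ge> 1" for i
    using hr[OF that] measurable_compose[OF X_measurable[OF that] h[of i]]
    by (intro integrable_const_bound[where B=1]) auto
  have Ehq: "\<bar>(\<integral>\<omega>. h i (X i \<omega>) \<partial>M) - (\<integral>\<omega>. q i \<omega> \<partial>M)\<bar> \<le> 1 / real n" if "i \<ge> 1" for i
  proof -
    have "(\<integral>\<omega>. h i (X i \<omega>) \<partial>M) - (\<integral>\<omega>. q i \<omega> \<partial>M) = (\<integral>\<omega>. h i (X i \<omega>) - q i \<omega> \<partial>M)"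
      using inth[OF that] intq[OF that] by simp
    also have "\<bar>\<dots>\<bar> \<le> (\<integral>\<omega>. \<bar>h i (X i \<omega>) - q i \<omega>\<bar> \<partial>M)" by (rule integral_abs_bound)
    also have "\<dots> \<le> (\<integral>\<omega>. 1 / real n \<partial>M)"
      using inth[OF that] intq[OF that] hq[OF that] by (intro integral_mono) auto
    finally show ?thesis by (simp add: prob_space)
  qed
  have "((\<lambda>z. (\<Sum>j\<in>{1..n}. (case z of (m, \<omega>) \<Rightarrow> (\<Sum>i\<in>{1..m}. indicator (E j i) \<omega> - prob (E j i)) / real m)) / real n) \<longlongrightarrow> (\<Sum>j\<in>{1..n}. 0) / real n) (whp M)"
    unfolding E_def using n1 by (intro tendsto_intros weak_law_indicator C) auto
  from tendstoD[OF this, of "e / 2"] e have "\<forall>\<^sub>F z in whp M. dist ((\<Sum>j\<in>{1..n}. (case z of (m, \<omega>) \<Rightarrow> (\<Sum>i\<in>{1..m}. indicator (E j i) \<omega> - prob (E j i)) / real m)) / real n) 0 < e / 2"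
    by (simp only: sum.neutral_const div_0 half_gt_zero simp_thms)
  then show "\<forall>\<^sub>F z in whp M. dist (case z of (m, \<omega>) \<Rightarrow> (\<Sum>i\<in>{1..m}. h i (X i \<omega>) - (\<integral>\<omega>. h i (X i \<omega>) \<partial>M)) / real m) 0 < e"
    using eventually_whp_sequentially[of "\<lambda>_. True", simplified]
  proof eventually_elim
    case (elim z)
    obtain m \<omega> where z: "z = (m, \<omega>)" by (cases z)
    have \<omega>: "\<omega> \<in> space M" using elim(2) z by simp
    let ?A = "(\<Sum>i\<in>{1..m}. h i (X i \<omega>) - (\<integral>\<omega>. h i (X i \<omega>) \<partial>M)) / real m"
    let ?Q = "(\<Sum>i\<in>{1..m}. q i \<omega> - (\<integral>\<omega>. q i \<omega> \<partial>M)) / real m"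
    have "(\<Sum>j\<in>{1..n}. (\<Sum>i\<in>{1..m}. indicator (E j i) \<omega> - prob (E j i)) / real m) / real n
      = (\<Sum>i\<in>{1..m}. \<Sum>j\<in>{1..n}. indicator (E j i) \<omega> - prob (E j i)) / real m / real n"
      by (subst sum.swap) (simp only: sum_divide_distrib)
    also have "\<dots> = ?Q"
    proof -
      have "q i \<omega> - (\<integral>\<omega>. q i \<omega> \<partial>M) = (\<Sum>j\<in>{1..n}. indicator (E j i) \<omega> - prob (E j i)) / real n"
        if "i \<in> {1..m}" for i
        using Eq[of i] that by (simp add: q_def sum_subtractf diff_divide_distrib)
      then have "?Q = (\<Sum>i\<in>{1..m}. (\<Sum>j\<in>{1..n}. indicator (E j i) \<omega> - prob (E j i)) / real n) / real m"
        by (intro arg_cong2[where f="(/)"] sum.cong refl) auto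
      then show ?thesis by (simp only: sum_divide_distrib[symmetric] divide_divide_eq_left mult.commute)
    qed
    finally have Q: "\<bar>?Q\<bar> < e / 2" using elim(1) z by simp
    have "\<bar>?A - ?Q\<bar> = \<bar>\<Sum>i\<in>{1..m}. (h i (X i \<omega>) - q i \<omega>) - ((\<integral>\<omega>. h i (X i \<omega>) \<partial>M) - (\<integral>\<omega>. q i \<omega> \<partial>M))\<bar> / real m"
    proof -
      have "?A - ?Q = (\<Sum>i\<in>{1..m}. (h i (X i \<omega>) - q i \<omega>) - ((\<integral>\<omega>. h i (X i \<omega>) \<partial>M) - (\<integral>\<omega>. q i \<omega> \<partial>M))) / real m"
        by (simp add: sum_subtractf diff_divide_distrib)
      then show ?thesis by simp
    qed
    also have "\<dots> \<le> (\<Sum>i\<in>{1..m}. 2 / real n) / real m"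
    proof (intro divide_right_mono order_trans[OF sum_abs] sum_mono)
      fix i assume "i \<in> {1..m}"
      then show "\<bar>h i (X i \<omega>) - q i \<omega> - ((\<integral>\<omega>. h i (X i \<omega>) \<partial>M) - (\<integral>\<omega>. q i \<omega> \<partial>M))\<bar> \<le> 2 / real n"
        using hq[of i \<omega>] Ehq[of i] \<omega> by auto
    qed simp
    also have "\<dots> \<le> 2 / real n" by simp
    also have "\<dots> < e / 2" using n n1 e by (simp add: field_simps)
    finally have "\<bar>?A\<bar> < e" using Q by linarith
    then show ?case using z by simp
  qed
qed

lemma weak_law_bounded:
  fixes h :: "nat \<Rightarrow> 'b \<Rightarrow> real"
  assumes h: "\<And>i. h i \<in> borel_measurable borel" and B: "B > 0"
    and hr: "\<And>i \<omega>. i \<ge> 1 \<Longrightarrow> \<omega> \<in> space M \<Longrightarrow> \<bar>h i (X i \<omega>)\<bar> \<le> B"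
  shows "((\<lambda>(m, \<omega>). (\<Sum>i\<in>{1..m}. h i (X i \<omega>) - (\<integral>\<omega>. h i (X i \<omega>) \<partial>M)) / real m) \<longlongrightarrow> 0) (whp M)"
proof -
  let ?h = "\<lambda>i z. (h i z + B) / (2 * B)"
  have inth: "integrable M (\<lambda>\<omega>. h i (X i \<omega>))" if "i \<ge> 1" for i
    using hr[OF that] measurable_compose[OF X_measurable[OF that] h[of i]]
    by (intro integrable_const_bound[where B=B]) auto
  have "((\<lambda>(m, \<omega>). (\<Sum>i\<in>{1..m}. ?h i (X i \<omega>) - (\<integral>\<omega>. ?h i (X i \<omega>) \<partial>M)) / real m) \<longlongrightarrow> 0) (whp M)"
  proof (rule weak_law_unit_interval)
    show "?h i \<in> borel_measurable borel" for i using h[of i] by measurable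
    show "0 \<le> ?h i (X i \<omega>) \<and> ?h i (X i \<omega>) \<le> 1" if "i \<ge> 1" "\<omega> \<in> space M" for i \<omega>
      using hr[OF that] B by (auto simp: abs_le_iff)
  qed
  from tendsto_mult_left[OF this, of "2 * B"]
  have "((\<lambda>z. 2 * B * (case z of (m, \<omega>) \<Rightarrow> (\<Sum>i\<in>{1..m}. ?h i (X i \<omega>) - (\<integral>\<omega>. ?h i (X i \<omega>) \<partial>M)) / real m)) \<longlongrightarrow> 0) (whp M)"
    by simp
  moreover have "2 * B * (case z of (m, \<omega>) \<Rightarrow> (\<Sum>i\<in>{1..m}. ?h i (X i \<omega>) - (\<integral>\<omega>. ?h i (X i \<omega>) \<partial>M)) / real m)
    = (case z of (m, \<omega>) \<Rightarrow> (\<Sum>i\<in>{1..m}. h i (X i \<omega>) - (\<integral>\<omega>. h i (X i \<omega>) \<partial>M)) / real m)" for z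
  proof -
    obtain m \<omega> where z: "z = (m, \<omega>)" by (cases z)
    have "2 * B * (?h i (X i \<omega>) - (\<integral>\<omega>. ?h i (X i \<omega>) \<partial>M)) = h i (X i \<omega>) - (\<integral>\<omega>. h i (X i \<omega>) \<partial>M)" if "i \<ge> 1" for i
      using inth[OF that] B by (simp add: prob_space field_simps)
    then show ?thesis by (simp add: z sum_distrib_left)
  qed
  ultimately show ?thesis by simp
qed

end

section \<open>Consistency of the maximum likelihood estimator\<close>

lemma logistic_bounds:
  assumes "\<bar>fst \<theta> + snd \<theta> \<bullet> x\<bar> \<le> L"
  shows "1 / (1 + exp L) \<le> logistic \<theta> x" "logistic \<theta> x \<le> 1 - 1 / (1 + exp L)"
proof -
  define s where "s = fst \<theta> + snd \<theta> \<bullet> x"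
  have l: "logistic \<theta> x = 1 / (1 + exp (- s))" by (simp add: logistic_def s_def)
  have s: "- s \<le> L" "s \<le> L" using assms by (auto simp: s_def)
  show "1 / (1 + exp L) \<le> logistic \<theta> x"
    unfolding l using s by (intro divide_left_mono) (auto intro!: mult_pos_pos add_pos_pos)
  have "logistic \<theta> x = 1 - 1 / (1 + exp s)"
    unfolding l by (simp add: exp_minus field_simps add_pos_pos less_imp_neq[symmetric])
  moreover have "1 / (1 + exp L) \<le> 1 / (1 + exp s)"
    using s by (intro divide_left_mono) (auto intro!: mult_pos_pos add_pos_pos)
  ultimately show "logistic \<theta> x \<le> 1 - 1 / (1 + exp L)" by linarith
qed

lemma logistic_bounds_compact:
  fixes \<Theta> :: "(real \<times> (real^'q::finite)) set"
  assumes "bounded \<Theta>"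
  obtains \<kappa> where "0 < \<kappa>" "\<kappa> < 1"
    "\<And>\<theta> x. \<theta> \<in> \<Theta> \<Longrightarrow> norm x \<le> \<rho> \<Longrightarrow> \<kappa> \<le> logistic \<theta> x \<and> logistic \<theta> x \<le> 1 - \<kappa>"
proof -
  obtain K where K: "\<And>\<theta>. \<theta> \<in> \<Theta> \<Longrightarrow> norm \<theta> \<le> K" "K > 0" using assms by (auto simp: bounded_pos)
  show ?thesis
  proof (rule that[of "1 / (1 + exp (K + K * \<rho>))"])
    fix \<theta> :: "real \<times> (real^'q)" and x :: "real^'q" assume t: "\<theta> \<in> \<Theta>" and x: "norm x \<le> \<rho>"
    have "\<bar>fst \<theta>\<bar> \<le> K" "norm (snd \<theta>) \<le> K"
      using K(1)[OF t] norm_fst_le[of "fst \<theta>" "snd \<theta>"] norm_snd_le[of "snd \<theta>" "fst \<theta>"] by auto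
    moreover have "\<bar>snd \<theta> \<bullet> x\<bar> \<le> norm (snd \<theta>) * norm x" by (rule Cauchy_Schwarz_ineq2)
    moreover have "norm (snd \<theta>) * norm x \<le> K * \<rho>" using calculation(2) x K(2) by (intro mult_mono) auto
    ultimately have "\<bar>fst \<theta> + snd \<theta> \<bullet> x\<bar> \<le> K + K * \<rho>" by linarith
    from logistic_bounds[OF this]
    show "1 / (1 + exp (K + K * \<rho>)) \<le> logistic \<theta> x \<and> logistic \<theta> x \<le> 1 - 1 / (1 + exp (K + K * \<rho>))" by blast
  next
    show "1 / (1 + exp (K + K * \<rho>)) < 1" "0 < 1 / (1 + exp (K + K * \<rho>))"
      by (smt (verit) divide_less_eq_1_pos divide_pos_pos exp_gt_zero)+
  qed
qed

lemma logistic_pos: "0 < logistic \<theta> x" and logistic_less_1: "logistic \<theta> x < 1"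
  by (auto simp: logistic_def add_pos_pos)

lemma continuous_on_logistic [continuous_intros]:
  fixes f :: "'c::topological_space \<Rightarrow> real \<times> (real^'q::finite)"
  assumes "continuous_on S f" "continuous_on S g"
  shows "continuous_on S (\<lambda>z. logistic (f z) (g z))"
  unfolding logistic_def using assms
  by (intro continuous_intros) (auto simp: add_pos_pos less_imp_neq[symmetric] add_nonneg_eq_0_iff)

lemma borel_measurable_logistic [measurable]:
  assumes "f \<in> borel_measurable N" "g \<in> borel_measurable N"
  shows "(\<lambda>z. logistic (f z) (g z)) \<in> borel_measurable N"
proof -
  have "continuous_on UNIV (\<lambda>z. logistic (fst z) (snd z) :: real)"
    by (intro continuous_intros)
  from borel_measurable_continuous_on[OF this borel_measurable_Pair[OF assms]]
  show ?thesis by simp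
qed

lemma lik_term_arg_ge:
  fixes \<pi> k p :: real
  assumes "0 < \<pi>" "\<pi> < 1" "0 < k" "k < 1"
  shows "\<pi> \<le> \<pi> + (1 - \<pi>) * (1 - k) * p powr (- k)"
proof -
  have "0 \<le> (1 - \<pi>) * (1 - k) * p powr (- k)" using assms by (intro mult_nonneg_nonneg) auto
  then show ?thesis by simp
qed

lemma abs_lik_term_le:
  assumes "0 < \<kappa>" "\<kappa> \<le> \<pi>" "\<pi> < 1" "0 < k" "k < 1" "0 < p" "p \<le> 1"
  shows "\<bar>lik_term \<pi> k p\<bar> \<le> - ln \<kappa> + \<bar>ln p\<bar>"
proof -
  let ?a = "\<pi> + (1 - \<pi>) * (1 - k) * p powr (- k)"
  have ge: "\<kappa> \<le> ?a" using lik_term_arg_ge[of \<pi> k p] assms by linarith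
  have p1: "1 \<le> p powr (- k)" using assms by (simp add: powr_minus powr_le1 field_simps)
  have "(1 - \<pi>) * (1 - k) * p powr (- k) \<le> (1 - \<pi>) * 1 * p powr (- k)"
    using assms by (intro mult_mono) auto
  moreover have "\<pi> * 1 \<le> \<pi> * p powr (- k)" using assms p1 by (intro mult_left_mono) auto
  ultimately have le: "?a \<le> p powr (- k)" by (simp add: algebra_simps)
  have "ln ?a \<le> ln (p powr (- k))" using ge le assms by (intro ln_mono) auto
  also have "\<dots> = k * \<bar>ln p\<bar>" using assms by (simp add: ln_powr)
  also have "\<dots> \<le> \<bar>ln p\<bar>" using assms by (intro mult_left_le_one_le) auto
  finally have up: "ln ?a \<le> \<bar>ln p\<bar>" .
  have "ln \<kappa> \<le> ln ?a" using ge assms by (intro ln_mono) auto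
  moreover have "ln \<kappa> \<le> 0" using assms by simp
  ultimately show ?thesis using up unfolding lik_term_def by linarith
qed

definition lik :: "(real \<times> (real^'q::finite)) \<times> (real \<times> (real^'q)) \<Rightarrow> (real^'q) \<times> real \<Rightarrow> real" where
  "lik tb z = lik_term (logistic (fst tb) (fst z)) (logistic (snd tb) (fst z)) (snd z)"

lemma borel_measurable_lik [measurable]: "lik tb \<in> borel_measurable borel"
proof -
  have [measurable]: "(\<lambda>z. logistic \<theta> (fst z)) \<in> borel_measurable (borel :: ((real^'a) \<times> real) measure)" for \<theta>
    by (intro borel_measurable_logistic measurable_const) (rule fst_borel_measurable | simp)+
  show ?thesis unfolding lik_def lik_term_def
    by (intro borel_measurable_ln borel_measurable_add borel_measurable_times borel_measurable_diff
      powr_real_measurable borel_measurable_uminus borel_measurable_const snd_borel_measurable) measurable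
qed

lemma continuous_on_lik:
  assumes "continuous_on S f" "continuous_on S g" "\<And>z. z \<in> S \<Longrightarrow> 0 < snd (g z)"
  shows "continuous_on S (\<lambda>z. lik (f z) (g z))"
proof -
  have "logistic (fst (f z)) (fst (g z)) + (1 - logistic (fst (f z)) (fst (g z))) *
      (1 - logistic (snd (f z)) (fst (g z))) * snd (g z) powr - logistic (snd (f z)) (fst (g z)) \<noteq> 0" for z
    using lik_term_arg_ge[OF logistic_pos logistic_less_1 logistic_pos logistic_less_1, 
        of "fst (f z)" "fst (g z)" "snd (f z)" "fst (g z)" "snd (g z)"] logistic_pos[of "fst (f z)" "fst (g z)"] by linarith
  then show ?thesis
    unfolding lik_def lik_term_def using assms by (intro continuous_intros) (force dest: less_imp_neq)+
qed

lemma averaged_diff_le: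
  fixes f h :: "nat \<Rightarrow> real"
  assumes "\<And>i. i \<in> {1..m} \<Longrightarrow> \<bar>f i - h i\<bar> \<le> c i"
  shows "\<bar>(\<Sum>i\<in>{1..m}. f i) / real m - (\<Sum>i\<in>{1..m}. h i) / real m\<bar> \<le> (\<Sum>i\<in>{1..m}. c i) / real m"
proof -
  have "\<bar>(\<Sum>i\<in>{1..m}. f i) / real m - (\<Sum>i\<in>{1..m}. h i) / real m\<bar> = \<bar>\<Sum>i\<in>{1..m}. f i - h i\<bar> / real m"
    by (simp add: sum_subtractf diff_divide_distrib[symmetric])
  also have "\<dots> \<le> (\<Sum>i\<in>{1..m}. c i) / real m"
    using assms by (intro divide_right_mono order_trans[OF sum_abs] sum_mono) auto
  finally show ?thesis .
qed

lemma average_const_le: "(0::real) \<le> c \<Longrightarrow> (\<Sum>i\<in>{1..m}. c) / real m \<le> c"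
  by (cases "m = 0") auto

lemma integral_diff_le:
  fixes f g h :: "'a \<Rightarrow> real" and M :: "'a measure"
  assumes "integrable M f" "integrable M g" "integrable M h" "\<And>\<omega>. \<omega> \<in> space M \<Longrightarrow> \<bar>f \<omega> - g \<omega>\<bar> \<le> h \<omega>"
  shows "\<bar>(\<integral>\<omega>. f \<omega> \<partial>M) - (\<integral>\<omega>. g \<omega> \<partial>M)\<bar> \<le> (\<integral>\<omega>. h \<omega> \<partial>M)"
proof -
  have "\<bar>(\<integral>\<omega>. f \<omega> \<partial>M) - (\<integral>\<omega>. g \<omega> \<partial>M)\<bar> = \<bar>\<integral>\<omega>. f \<omega> - g \<omega> \<partial>M\<bar>" using assms by simp
  also have "\<dots> \<le> (\<integral>\<omega>. \<bar>f \<omega> - g \<omega>\<bar> \<partial>M)" by (rule integral_abs_bound)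
  also have "\<dots> \<le> (\<integral>\<omega>. h \<omega> \<partial>M)" using assms by (intro integral_mono) auto
  finally show ?thesis .
qed

locale two_group_model = alpha_mixing M "\<lambda>i \<omega>. (x i \<omega>, p i \<omega>)"
  for M :: "'a measure" and x :: "nat \<Rightarrow> 'a \<Rightarrow> real^'q::finite" and p :: "nat \<Rightarrow> 'a \<Rightarrow> real" +
  fixes \<rho> s Bd :: real and \<Theta> \<B> :: "(real \<times> (real^'q)) set"
  assumes p_range: "\<And>i \<omega>. i \<ge> 1 \<Longrightarrow> \<omega> \<in> space M \<Longrightarrow> 0 < p i \<omega> \<and> p i \<omega> \<le> 1"
    and x_bound: "\<And>i \<omega>. i \<ge> 1 \<Longrightarrow> \<omega> \<in> space M \<Longrightarrow> norm (x i \<omega>) \<le> \<rho>"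
    and compact_params: "compact \<Theta>" "compact \<B>"
    and s: "s > 1"
    and moment_integrable: "\<And>i. i \<ge> 1 \<Longrightarrow> integrable M (\<lambda>\<omega>. \<bar>ln (p i \<omega>)\<bar> powr s)"
    and moment_le: "\<And>i. i \<ge> 1 \<Longrightarrow> (\<integral>\<omega>. \<bar>ln (p i \<omega>)\<bar> powr s \<partial>M) \<le> Bd"
begin

lemma p_measurable: "i \<ge> 1 \<Longrightarrow> p i \<in> borel_measurable M"
  using measurable_compose[OF X_measurable snd_borel_measurable] by simp

lemma x_measurable: "i \<ge> 1 \<Longrightarrow> x i \<in> borel_measurable M"
  using measurable_compose[OF X_measurable fst_borel_measurable] by simp

lemma ln_p_integrable:
  assumes i: "i \<ge> 1" shows "integrable M (\<lambda>\<omega>. \<bar>ln (p i \<omega>)\<bar>)"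
proof (rule Bochner_Integration.integrable_bound)
  show "integrable M (\<lambda>\<omega>. 1 + \<bar>ln (p i \<omega>)\<bar> powr s)" using moment_integrable[OF i] by simp
  show "(\<lambda>\<omega>. \<bar>ln (p i \<omega>)\<bar>) \<in> borel_measurable M" using p_measurable[OF i] by measurable
  have "\<bar>u\<bar> \<le> 1 + \<bar>u\<bar> powr s" for u :: real
  proof (cases "\<bar>u\<bar> \<le> 1")
    case False
    then have "\<bar>u\<bar> powr 1 \<le> \<bar>u\<bar> powr s" using s by (intro powr_mono) auto
    then show ?thesis using False by simp
  qed (simp add: add_increasing2)
  then show "AE \<omega> in M. norm \<bar>ln (p i \<omega>)\<bar> \<le> norm (1 + \<bar>ln (p i \<omega>)\<bar> powr s)" by simp
qed

lemma tail_integrable: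
  assumes i: "i \<ge> 1"
  shows "integrable M (\<lambda>\<omega>. if p i \<omega> \<le> \<tau> then a + \<bar>ln (p i \<omega>)\<bar> else 0)"
proof (rule Bochner_Integration.integrable_bound)
  show "integrable M (\<lambda>\<omega>. \<bar>a\<bar> + \<bar>ln (p i \<omega>)\<bar>)" using ln_p_integrable[OF i] by simp
  show "(\<lambda>\<omega>. if p i \<omega> \<le> \<tau> then a + \<bar>ln (p i \<omega>)\<bar> else 0) \<in> borel_measurable M"
    using p_measurable[OF i] by measurable
qed auto

lemma uniform_tail:
  assumes g: "g > 0"
  obtains \<tau>0 where "0 < \<tau>0" "\<tau>0 < 1"
    "\<And>i \<tau>. i \<ge> 1 \<Longrightarrow> \<tau> \<le> \<tau>0 \<Longrightarrow> (\<integral>\<omega>. (if p i \<omega> \<le> \<tau> then a + \<bar>ln (p i \<omega>)\<bar> else 0) \<partial>M) \<le> g"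
proof -
  have "((\<lambda>T. 2 * Bd * T powr (1 - s)) \<longlongrightarrow> 2 * Bd * 0) at_top"
    using s by (intro tendsto_intros tendsto_neg_powr filterlim_ident) auto
  then have "\<forall>\<^sub>F T in at_top. 2 * Bd * T powr (1 - s) < g"
    using g by (intro order_tendstoD) auto
  moreover have "\<forall>\<^sub>F T in at_top. T \<ge> max 1 a" by (rule eventually_ge_at_top)
  ultimately have "\<forall>\<^sub>F T in at_top. 2 * Bd * T powr (1 - s) < g \<and> T \<ge> max 1 a" by (rule eventually_conj)
  then obtain T where T: "2 * Bd * T powr (1 - s) < g" "T \<ge> 1" "T \<ge> a"
    by (auto dest!: eventually_happens'[OF trivial_limit_at_top_linorder])
  show ?thesis
  proof (rule that[of "exp (- T)"])
    show "exp (- T) < 1" using T by simp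
    fix i :: nat and \<tau> :: real assume i: "i \<ge> 1" and \<tau>: "\<tau> \<le> exp (- T)"
    have "(\<integral>\<omega>. (if p i \<omega> \<le> \<tau> then a + \<bar>ln (p i \<omega>)\<bar> else 0) \<partial>M)
        \<le> (\<integral>\<omega>. 2 * T powr (1 - s) * \<bar>ln (p i \<omega>)\<bar> powr s \<partial>M)"
    proof (rule integral_mono[OF tail_integrable[OF i]])
      show "integrable M (\<lambda>\<omega>. 2 * T powr (1 - s) * \<bar>ln (p i \<omega>)\<bar> powr s)" 
        using moment_integrable[OF i] by simp
      fix \<omega> assume \<omega>: "\<omega> \<in> space M"
      show "(if p i \<omega> \<le> \<tau> then a + \<bar>ln (p i \<omega>)\<bar> else 0) \<le> 2 * T powr (1 - s) * \<bar>ln (p i \<omega>)\<bar> powr s"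
      proof (cases "p i \<omega> \<le> \<tau>")
        case True
        define u where "u = \<bar>ln (p i \<omega>)\<bar>"
        have "ln (p i \<omega>) \<le> ln (exp (- T))" using True \<tau> p_range[OF i \<omega>] by (intro ln_mono) auto
        then have u: "u \<ge> T" by (simp add: u_def)
        have "u = u powr (1 - s) * u powr s" using u T by (simp add: powr_add[symmetric])
        also have "\<dots> \<le> T powr (1 - s) * u powr s"
          using u T s by (intro mult_right_mono powr_mono2') auto
        finally show ?thesis using True u T by (simp add: u_def[symmetric])
      qed simp
    qed
    also have "\<dots> = 2 * T powr (1 - s) * (\<integral>\<omega>. \<bar>ln (p i \<omega>)\<bar> powr s \<partial>M)" by simp
    also have "\<dots> \<le> 2 * T powr (1 - s) * Bd" by (intro mult_left_mono moment_le i) auto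
    also have "\<dots> \<le> g" using T by (simp add: mult_ac)
    finally show "(\<integral>\<omega>. (if p i \<omega> \<le> \<tau> then a + \<bar>ln (p i \<omega>)\<bar> else 0) \<partial>M) \<le> g" .
  qed simp
qed

lemma prob_p_le_small:
  assumes g: "g > 0"
  obtains \<tau>0 where "0 < \<tau>0" "\<tau>0 < 1"
    "\<And>i \<tau>. i \<ge> 1 \<Longrightarrow> \<tau> \<le> \<tau>0 \<Longrightarrow> prob {\<omega>\<in>space M. p i \<omega> \<le> \<tau>} \<le> g"
proof (rule uniform_tail[OF g, of 1], rule that)
  fix \<tau>0 \<tau> :: real and i :: nat
  assume tail: "\<And>i \<tau>. i \<ge> 1 \<Longrightarrow> \<tau> \<le> \<tau>0 \<Longrightarrow> (\<integral>\<omega>. (if p i \<omega> \<le> \<tau> then 1 + \<bar>ln (p i \<omega>)\<bar> else 0) \<partial>M) \<le> g"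
    and i: "i \<ge> 1" and \<tau>: "\<tau> \<le> \<tau>0"
  let ?E = "{\<omega>\<in>space M. p i \<omega> \<le> \<tau>}"
  have E: "?E \<in> sets M" using p_measurable[OF i] by measurable
  then have "prob ?E = (\<integral>\<omega>. indicator ?E \<omega> \<partial>M)" by (simp add: sets.Int_space_eq2)
  also have "\<dots> \<le> (\<integral>\<omega>. (if p i \<omega> \<le> \<tau> then 1 + \<bar>ln (p i \<omega>)\<bar> else 0) \<partial>M)"
    using E by (intro integral_mono tail_integrable[OF i] integrable_real_indicator)
      (auto simp: less_top[symmetric] indicator_def)
  also have "\<dots> \<le> g" by (rule tail[OF i \<tau>])
  finally show "prob ?E \<le> g" .
qed

lemma logistic_bounds_params:
  obtains \<kappa> where "0 < \<kappa>" "\<kappa> < 1"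
    "\<And>\<theta> u. \<theta> \<in> \<Theta> \<Longrightarrow> norm u \<le> \<rho> \<Longrightarrow> \<kappa> \<le> logistic \<theta> u \<and> logistic \<theta> u \<le> 1 - \<kappa>"
    "\<And>\<beta> u. \<beta> \<in> \<B> \<Longrightarrow> norm u \<le> \<rho> \<Longrightarrow> \<kappa> \<le> logistic \<beta> u \<and> logistic \<beta> u \<le> 1 - \<kappa>"
proof -
  have "bounded (\<Theta> \<union> \<B>)" using compact_params by (auto intro: compact_imp_bounded)
  then show ?thesis by (rule logistic_bounds_compact[where \<rho>=\<rho>]) (rule that, auto)
qed

lemma lik_bound:
  obtains A where "A > 0" "\<And>tb u v. tb \<in> \<Theta> \<times> \<B> \<Longrightarrow> norm u \<le> \<rho> \<Longrightarrow> 0 < v \<Longrightarrow> v \<le> 1 \<Longrightarrow> \<bar>lik tb (u, v)\<bar> \<le> A + \<bar>ln v\<bar>"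
proof (rule logistic_bounds_params, rule that)
  fix \<kappa> v :: real and tb and u :: "real^'q"
  assume \<kappa>: "0 < \<kappa>" "\<kappa> < 1"
    and th: "\<And>\<theta> u. \<theta> \<in> \<Theta> \<Longrightarrow> norm u \<le> \<rho> \<Longrightarrow> \<kappa> \<le> logistic \<theta> u \<and> logistic \<theta> u \<le> 1 - \<kappa>"
  show "- ln \<kappa> > 0" using \<kappa> by simp
  assume "tb \<in> \<Theta> \<times> \<B>" "norm u \<le> \<rho>" "0 < v" "v \<le> (1::real)"
  then show "\<bar>lik tb (u, v)\<bar> \<le> - ln \<kappa> + \<bar>ln v\<bar>"
    unfolding lik_def fst_conv snd_conv using \<kappa> th[of "fst tb" u]
    by (intro abs_lik_term_le) (auto simp: logistic_pos logistic_less_1)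
qed

lemma lik_integrable:
  assumes tb: "tb \<in> \<Theta> \<times> \<B>" and i: "i \<ge> 1"
  shows "integrable M (\<lambda>\<omega>. lik tb (x i \<omega>, p i \<omega>))"
proof -
  obtain A where A: "A > 0" "\<And>tb u v. tb \<in> \<Theta> \<times> \<B> \<Longrightarrow> norm u \<le> \<rho> \<Longrightarrow> 0 < v \<Longrightarrow> v \<le> 1 \<Longrightarrow> \<bar>lik tb (u, v)\<bar> \<le> A + \<bar>ln v\<bar>"
    by (rule lik_bound) blast
  show ?thesis
  proof (rule Bochner_Integration.integrable_bound)
    show "integrable M (\<lambda>\<omega>. A + \<bar>ln (p i \<omega>)\<bar>)" using ln_p_integrable[OF i] by simp
    show "(\<lambda>\<omega>. lik tb (x i \<omega>, p i \<omega>)) \<in> borel_measurable M"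
      by (rule measurable_compose[OF X_measurable[OF i] borel_measurable_lik])
    show "AE \<omega> in M. norm (lik tb (x i \<omega>, p i \<omega>)) \<le> norm (A + \<bar>ln (p i \<omega>)\<bar>)"
    proof (rule AE_I2)
      fix \<omega> assume "\<omega> \<in> space M"
      with A(2)[OF tb x_bound[OF i]] p_range[OF i] have "\<bar>lik tb (x i \<omega>, p i \<omega>)\<bar> \<le> A + \<bar>ln (p i \<omega>)\<bar>" by blast
      then show "norm (lik tb (x i \<omega>, p i \<omega>)) \<le> norm (A + \<bar>ln (p i \<omega>)\<bar>)" using A(1) by simp
    qed
  qed
qed

text \<open>Flooring the p-values at \<open>\<tau>\<close> makes the likelihood bounded and uniformly continuous in the
  parameters, at the price of an error controlled uniformly in the parameters by a tail term.\<close>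

lemma lik_truncation:
  assumes g: "g > 0"
  obtains \<tau> A \<eta> where "0 < \<tau>" "\<tau> < 1" "A > 0" "\<eta> > 0"
    "\<And>i. i \<ge> 1 \<Longrightarrow> (\<integral>\<omega>. (if p i \<omega> \<le> \<tau> then A + \<bar>ln (p i \<omega>)\<bar> else 0) \<partial>M) \<le> g"
    "\<And>tb i \<omega>. tb \<in> \<Theta> \<times> \<B> \<Longrightarrow> i \<ge> 1 \<Longrightarrow> \<omega> \<in> space M \<Longrightarrow>
       \<bar>lik tb (x i \<omega>, p i \<omega>) - lik tb (x i \<omega>, max (p i \<omega>) \<tau>)\<bar> \<le> 2 * (if p i \<omega> \<le> \<tau> then A + \<bar>ln (p i \<omega>)\<bar> else 0)"
    "\<And>tb tb' i \<omega>. tb \<in> \<Theta> \<times> \<B> \<Longrightarrow> tb' \<in> \<Theta> \<times> \<B> \<Longrightarrow> dist tb tb' < \<eta> \<Longrightarrow> i \<ge> 1 \<Longrightarrow> \<omega> \<in> space M \<Longrightarrow>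
       \<bar>lik tb (x i \<omega>, max (p i \<omega>) \<tau>) - lik tb' (x i \<omega>, max (p i \<omega>) \<tau>)\<bar> \<le> g"
    "\<And>tb i \<omega>. tb \<in> \<Theta> \<times> \<B> \<Longrightarrow> i \<ge> 1 \<Longrightarrow> \<omega> \<in> space M \<Longrightarrow>
       \<bar>lik tb (x i \<omega>, max (p i \<omega>) \<tau>)\<bar> \<le> A + \<bar>ln \<tau>\<bar>"
proof -
  obtain A where A: "A > 0" "\<And>tb u v. tb \<in> \<Theta> \<times> \<B> \<Longrightarrow> norm u \<le> \<rho> \<Longrightarrow> 0 < v \<Longrightarrow> v \<le> 1 \<Longrightarrow> \<bar>lik tb (u, v)\<bar> \<le> A + \<bar>ln v\<bar>"
    by (rule lik_bound) blast
  obtain \<tau> where \<tau>: "0 < \<tau>" "\<tau> < 1"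
    "\<And>i \<tau>'. i \<ge> 1 \<Longrightarrow> \<tau>' \<le> \<tau> \<Longrightarrow> (\<integral>\<omega>. (if p i \<omega> \<le> \<tau>' then A + \<bar>ln (p i \<omega>)\<bar> else 0) \<partial>M) \<le> g"
    by (rule uniform_tail[OF g, of A]) blast
  let ?K = "(\<Theta> \<times> \<B>) \<times> (cball 0 \<rho> \<times> {\<tau>..1})"
  have "uniformly_continuous_on ?K (\<lambda>w. lik (fst w) (snd w))"
    using \<tau> by (intro compact_uniformly_continuous continuous_on_lik continuous_intros compact_Times compact_params) auto
  then obtain \<eta> where \<eta>: "\<eta> > 0" "\<And>w w'. w \<in> ?K \<Longrightarrow> w' \<in> ?K \<Longrightarrow> dist w w' < \<eta> \<Longrightarrow>
      dist (lik (fst w) (snd w)) (lik (fst w') (snd w')) < g"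
    using g unfolding uniformly_continuous_on_def by (metis dist_commute)
  have floor: "0 < max (p i \<omega>) \<tau>" "max (p i \<omega>) \<tau> \<le> 1" if "i \<ge> 1" "\<omega> \<in> space M" for i \<omega>
    using p_range[OF that] \<tau> by auto
  show ?thesis
  proof (rule that[OF \<tau>(1,2) A(1) \<eta>(1)])
    show "(\<integral>\<omega>. (if p i \<omega> \<le> \<tau> then A + \<bar>ln (p i \<omega>)\<bar> else 0) \<partial>M) \<le> g" if "i \<ge> 1" for i
      using \<tau>(3)[OF that] by simp
    fix tb i \<omega> assume tb: "tb \<in> \<Theta> \<times> \<B>" and i: "(i::nat) \<ge> 1" and \<omega>: "\<omega> \<in> space M"
    note xb = x_bound[OF i \<omega>] and pr = p_range[OF i \<omega>]
    have l1: "\<bar>lik tb (x i \<omega>, p i \<omega>)\<bar> \<le> A + \<bar>ln (p i \<omega>)\<bar>" using A(2)[OF tb xb] pr by simp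
    have l2: "\<bar>lik tb (x i \<omega>, max (p i \<omega>) \<tau>)\<bar> \<le> A + \<bar>ln (max (p i \<omega>) \<tau>)\<bar>"
      using A(2)[OF tb xb] floor[OF i \<omega>] by simp
    have l3: "ln (p i \<omega>) \<le> ln (max (p i \<omega>) \<tau>)" "ln \<tau> \<le> ln (max (p i \<omega>) \<tau>)" "ln (max (p i \<omega>) \<tau>) \<le> 0"
      using pr floor[OF i \<omega>] \<tau> by (auto intro!: ln_mono)
    show "\<bar>lik tb (x i \<omega>, p i \<omega>) - lik tb (x i \<omega>, max (p i \<omega>) \<tau>)\<bar> \<le> 2 * (if p i \<omega> \<le> \<tau> then A + \<bar>ln (p i \<omega>)\<bar> else 0)"
    proof (cases "p i \<omega> \<le> \<tau>")
      case True then show ?thesis using l1 l2 l3 by (auto simp: max_def)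
    next
      case False then show ?thesis by (simp add: max_def)
    qed
    show "\<bar>lik tb (x i \<omega>, max (p i \<omega>) \<tau>)\<bar> \<le> A + \<bar>ln \<tau>\<bar>" using l2 l3 by linarith
    fix tb' assume tb': "tb' \<in> \<Theta> \<times> \<B>" "dist tb tb' < \<eta>"
    have "dist (tb, (x i \<omega>, max (p i \<omega>) \<tau>)) (tb', (x i \<omega>, max (p i \<omega>) \<tau>)) < \<eta>"
      using tb'(2) by (simp add: dist_prod_def[of "(tb, _)"])
    from \<eta>(2)[OF _ _ this] tb tb' xb floor[OF i \<omega>] 
    show "\<bar>lik tb (x i \<omega>, max (p i \<omega>) \<tau>) - lik tb' (x i \<omega>, max (p i \<omega>) \<tau>)\<bar> \<le> g"
      by (auto simp: dist_real_def)
  qed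
qed

lemma floored_lik_integrable:
  assumes "i \<ge> 1" "\<And>\<omega>. \<omega> \<in> space M \<Longrightarrow> \<bar>lik tb (x i \<omega>, max (p i \<omega>) \<tau>)\<bar> \<le> Q"
  shows "integrable M (\<lambda>\<omega>. lik tb (x i \<omega>, max (p i \<omega>) \<tau>))"
proof (rule integrable_const_bound[where B=Q])
  have "(\<lambda>\<omega>. (x i \<omega>, max (p i \<omega>) \<tau>)) \<in> borel_measurable M"
    using x_measurable[OF assms(1)] p_measurable[OF assms(1)] by (intro borel_measurable_Pair borel_measurable_max) auto
  then show "(\<lambda>\<omega>. lik tb (x i \<omega>, max (p i \<omega>) \<tau>)) \<in> borel_measurable M"
    by (rule measurable_compose) (rule borel_measurable_lik)
qed (use assms in auto)

lemma expected_lik_equicontinuous: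
  assumes g: "g > 0"
  obtains \<eta> where "\<eta> > 0" "\<And>tb tb' i. tb \<in> \<Theta> \<times> \<B> \<Longrightarrow> tb' \<in> \<Theta> \<times> \<B> \<Longrightarrow> dist tb tb' < \<eta> \<Longrightarrow> i \<ge> 1 \<Longrightarrow>
    \<bar>(\<integral>\<omega>. lik tb (x i \<omega>, p i \<omega>) \<partial>M) - (\<integral>\<omega>. lik tb' (x i \<omega>, p i \<omega>) \<partial>M)\<bar> \<le> g"
proof -
  have "g / 5 > 0" using g by simp
  then obtain \<tau> A \<eta> where T: "0 < \<tau>" "\<tau> < 1" "A > 0" "\<eta> > 0"
    "\<And>i. i \<ge> 1 \<Longrightarrow> (\<integral>\<omega>. (if p i \<omega> \<le> \<tau> then A + \<bar>ln (p i \<omega>)\<bar> else 0) \<partial>M) \<le> g / 5"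
    "\<And>tb i \<omega>. tb \<in> \<Theta> \<times> \<B> \<Longrightarrow> i \<ge> 1 \<Longrightarrow> \<omega> \<in> space M \<Longrightarrow>
       \<bar>lik tb (x i \<omega>, p i \<omega>) - lik tb (x i \<omega>, max (p i \<omega>) \<tau>)\<bar> \<le> 2 * (if p i \<omega> \<le> \<tau> then A + \<bar>ln (p i \<omega>)\<bar> else 0)"
    "\<And>tb tb' i \<omega>. tb \<in> \<Theta> \<times> \<B> \<Longrightarrow> tb' \<in> \<Theta> \<times> \<B> \<Longrightarrow> dist tb tb' < \<eta> \<Longrightarrow> i \<ge> 1 \<Longrightarrow> \<omega> \<in> space M \<Longrightarrow>
       \<bar>lik tb (x i \<omega>, max (p i \<omega>) \<tau>) - lik tb' (x i \<omega>, max (p i \<omega>) \<tau>)\<bar> \<le> g / 5"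
    "\<And>tb i \<omega>. tb \<in> \<Theta> \<times> \<B> \<Longrightarrow> i \<ge> 1 \<Longrightarrow> \<omega> \<in> space M \<Longrightarrow>
       \<bar>lik tb (x i \<omega>, max (p i \<omega>) \<tau>)\<bar> \<le> A + \<bar>ln \<tau>\<bar>"
    by (rule lik_truncation) blast
  show ?thesis
  proof (rule that[OF T(4)])
    fix tb tb' and i :: nat
    assume tb: "tb \<in> \<Theta> \<times> \<B>" "tb' \<in> \<Theta> \<times> \<B>" "dist tb tb' < \<eta>" and i: "i \<ge> 1"
    have tail: "integrable M (\<lambda>\<omega>. 2 * (if p i \<omega> \<le> \<tau> then A + \<bar>ln (p i \<omega>)\<bar> else 0))"
      by (intro integrable_mult_right tail_integrable i)
    note fl = floored_lik_integrable[OF i T(8)[OF _ i]]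
    have a: "\<bar>(\<integral>\<omega>. lik tb (x i \<omega>, p i \<omega>) \<partial>M) - (\<integral>\<omega>. lik tb (x i \<omega>, max (p i \<omega>) \<tau>) \<partial>M)\<bar> \<le> 2 * (g / 5)"
      if tb: "tb \<in> \<Theta> \<times> \<B>" for tb
    proof (rule order_trans[OF integral_diff_le[OF lik_integrable[OF tb i] fl[OF tb] tail T(6)[OF tb i]]])
      show "(\<integral>\<omega>. 2 * (if p i \<omega> \<le> \<tau> then A + \<bar>ln (p i \<omega>)\<bar> else 0) \<partial>M) \<le> 2 * (g / 5)"
        using T(5)[OF i] by simp
    qed
    have "\<bar>(\<integral>\<omega>. lik tb (x i \<omega>, max (p i \<omega>) \<tau>) \<partial>M) - (\<integral>\<omega>. lik tb' (x i \<omega>, max (p i \<omega>) \<tau>) \<partial>M)\<bar> \<le> (\<integral>\<omega>. g / 5 \<partial>M)"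
      by (rule integral_diff_le[OF fl[OF tb(1)] fl[OF tb(2)] integrable_const T(7)[OF tb i]])
    then show "\<bar>(\<integral>\<omega>. lik tb (x i \<omega>, p i \<omega>) \<partial>M) - (\<integral>\<omega>. lik tb' (x i \<omega>, p i \<omega>) \<partial>M)\<bar> \<le> g"
      using a[OF tb(1)] a[OF tb(2)] unfolding lebesgue_integral_const prob_space abs_le_iff
      by simp
  qed
qed

lemma uniform_weak_law_lik:
  assumes g: "g > 0"
  shows "\<forall>\<^sub>F (m, \<omega>) in whp M. \<forall>tb\<in>\<Theta> \<times> \<B>.
    \<bar>(\<Sum>i\<in>{1..m}. lik tb (x i \<omega>, p i \<omega>)) / real m
      - (\<Sum>i\<in>{1..m}. \<integral>\<omega>. lik tb (x i \<omega>, p i \<omega>) \<partial>M) / real m\<bar> \<le> g"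
proof (rule eventually_whpI)
  fix e :: real assume e: "e > 0"
  define d where "d = min (g / 16) (g * e / 16)"
  have d: "d > 0" "d \<le> g / 16" "8 * d / g \<le> e / 2" using g e by (auto simp: d_def min_def field_simps)
  obtain \<tau> A \<eta> where T: "0 < \<tau>" "\<tau> < 1" "A > 0" "\<eta> > 0"
    "\<And>i. i \<ge> 1 \<Longrightarrow> (\<integral>\<omega>. (if p i \<omega> \<le> \<tau> then A + \<bar>ln (p i \<omega>)\<bar> else 0) \<partial>M) \<le> d"
    "\<And>tb i \<omega>. tb \<in> \<Theta> \<times> \<B> \<Longrightarrow> i \<ge> 1 \<Longrightarrow> \<omega> \<in> space M \<Longrightarrow>
       \<bar>lik tb (x i \<omega>, p i \<omega>) - lik tb (x i \<omega>, max (p i \<omega>) \<tau>)\<bar> \<le> 2 * (if p i \<omega> \<le> \<tau> then A + \<bar>ln (p i \<omega>)\<bar> else 0)"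
    "\<And>tb tb' i \<omega>. tb \<in> \<Theta> \<times> \<B> \<Longrightarrow> tb' \<in> \<Theta> \<times> \<B> \<Longrightarrow> dist tb tb' < \<eta> \<Longrightarrow> i \<ge> 1 \<Longrightarrow> \<omega> \<in> space M \<Longrightarrow>
       \<bar>lik tb (x i \<omega>, max (p i \<omega>) \<tau>) - lik tb' (x i \<omega>, max (p i \<omega>) \<tau>)\<bar> \<le> d"
    "\<And>tb i \<omega>. tb \<in> \<Theta> \<times> \<B> \<Longrightarrow> i \<ge> 1 \<Longrightarrow> \<omega> \<in> space M \<Longrightarrow>
       \<bar>lik tb (x i \<omega>, max (p i \<omega>) \<tau>)\<bar> \<le> A + \<bar>ln \<tau>\<bar>"
    by (rule lik_truncation[OF d(1)]) blast
  define h where "h = (\<lambda>i \<omega>. 2 * (if p i \<omega> \<le> \<tau> then A + \<bar>ln (p i \<omega>)\<bar> else 0))"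
  define lt where "lt = (\<lambda>tb i \<omega>. lik tb (x i \<omega>, max (p i \<omega>) \<tau>))"
  have h_int: "integrable M (h i)" if "i \<ge> 1" for i
    unfolding h_def by (intro integrable_mult_right tail_integrable that)
  have h_le: "(\<integral>\<omega>. h i \<omega> \<partial>M) \<le> 2 * d" if "i \<ge> 1" for i
    unfolding h_def using T(5)[OF that] by simp
  have h_nonneg: "0 \<le> h i \<omega>" for i \<omega> using T(3) by (simp add: h_def)
  have lt_int: "integrable M (lt tb i)" if "tb \<in> \<Theta> \<times> \<B>" "i \<ge> 1" for tb i
    unfolding lt_def by (rule floored_lik_integrable[OF that(2) T(8)[OF that]])
  have "\<Theta> \<times> \<B> \<subseteq> (\<Union>y\<in>\<Theta> \<times> \<B>. ball y \<eta>)" using T(4) by force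
  from compactE_image[OF compact_Times[OF compact_params] _ this]
  obtain k where k: "k \<subseteq> \<Theta> \<times> \<B>" "finite k" "\<Theta> \<times> \<B> \<subseteq> (\<Union>y\<in>k. ball y \<eta>)" by (metis open_ball)
  have law: "((\<lambda>(m, \<omega>). (\<Sum>i\<in>{1..m}. lt tb i \<omega> - (\<integral>\<omega>. lt tb i \<omega> \<partial>M)) / real m) \<longlongrightarrow> 0) (whp M)"
    if tb: "tb \<in> \<Theta> \<times> \<B>" for tb
  proof -
    have "(\<lambda>z. lik tb (fst z, max (snd z) \<tau>)) \<in> borel_measurable borel"
      by (rule measurable_compose[OF borel_measurable_Pair borel_measurable_lik])
        (auto intro!: borel_measurable_max)
    from weak_law_bounded[of "\<lambda>i z. lik tb (fst z, max (snd z) \<tau>)" "A + \<bar>ln \<tau>\<bar>", OF this]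
    show ?thesis using T(8)[OF tb] T(3) by (simp add: lt_def add_pos_nonneg)
  qed
  have "\<forall>\<^sub>F z in whp M. \<forall>tb\<in>k. \<bar>case z of (m, \<omega>) \<Rightarrow> (\<Sum>i\<in>{1..m}. lt tb i \<omega> - (\<integral>\<omega>. lt tb i \<omega> \<partial>M)) / real m\<bar> < g / 8"
    using k(2)
  proof (rule eventually_ball_finite, intro ballI)
    fix tb assume "tb \<in> k"
    then have tb: "tb \<in> \<Theta> \<times> \<B>" using k(1) by blast
    show "\<forall>\<^sub>F z in whp M. \<bar>case z of (m, \<omega>) \<Rightarrow> (\<Sum>i\<in>{1..m}. lt tb i \<omega> - (\<integral>\<omega>. lt tb i \<omega> \<partial>M)) / real m\<bar> < g / 8"
      using tendstoD[OF law[OF tb], of "g / 8"] g by (simp only: dist_real_def diff_zero)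
  qed
  then have "\<forall>\<^sub>F m in sequentially. \<exists>B\<in>sets M. 1 - e / 2 \<le> prob B \<and> (\<forall>\<omega>\<in>B. \<forall>tb\<in>k.
      \<bar>(\<Sum>i\<in>{1..m}. lt tb i \<omega> - (\<integral>\<omega>. lt tb i \<omega> \<partial>M)) / real m\<bar> < g / 8)"
    using e unfolding eventually_whp by (auto dest!: spec[of _ "e / 2"])
  moreover have "\<forall>\<^sub>F m in sequentially. m \<ge> (1::nat)" by (rule eventually_ge_at_top)
  ultimately show "\<forall>\<^sub>F m in sequentially. \<exists>A\<in>sets M. 1 - e \<le> prob A \<and> (\<forall>\<omega>\<in>A. case (m, \<omega>) of (m, \<omega>) \<Rightarrow>
    \<forall>tb\<in>\<Theta> \<times> \<B>. \<bar>(\<Sum>i\<in>{1..m}. lik tb (x i \<omega>, p i \<omega>)) / real m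
      - (\<Sum>i\<in>{1..m}. \<integral>\<omega>. lik tb (x i \<omega>, p i \<omega>) \<partial>M) / real m\<bar> \<le> g)"
  proof eventually_elim
    case (elim m)
    then obtain B where B: "B \<in> sets M" "1 - e / 2 \<le> prob B" "\<And>\<omega> tb. \<omega> \<in> B \<Longrightarrow> tb \<in> k \<Longrightarrow>
      \<bar>(\<Sum>i\<in>{1..m}. lt tb i \<omega> - (\<integral>\<omega>. lt tb i \<omega> \<partial>M)) / real m\<bar> < g / 8" by blast
    define Z where "Z = (\<lambda>\<omega>. (\<Sum>i\<in>{1..m}. h i \<omega>) / real m)"
    have Z_int: "integrable M Z" unfolding Z_def using h_int by (intro integrable_divide Bochner_Integration.integrable_sum) auto
    have EZ: "(\<integral>\<omega>. Z \<omega> \<partial>M) \<le> 2 * d"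
    proof -
      have "(\<integral>\<omega>. Z \<omega> \<partial>M) = (\<Sum>i\<in>{1..m}. \<integral>\<omega>. h i \<omega> \<partial>M) / real m"
        unfolding Z_def using h_int by simp
      also have "\<dots> \<le> (\<Sum>i\<in>{1..m}. 2 * d) / real m"
        using h_le by (intro divide_right_mono sum_mono) auto
      also have "\<dots> \<le> 2 * d" using d by (intro average_const_le) simp
      finally show ?thesis .
    qed
    let ?C = "{\<omega>\<in>space M. Z \<omega> \<ge> g / 4}"
    have C: "?C \<in> sets M" using Z_int by measurable
    have "prob ?C \<le> (\<integral>\<omega>. Z \<omega> \<partial>M) / (g / 4)"
      using g h_nonneg by (intro integral_Markov_inequality_measure[where A="space M", OF Z_int])
        (auto simp: Z_def intro!: sum_nonneg divide_nonneg_nonneg)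
    also have "\<dots> \<le> 2 * d / (g / 4)" using EZ g by (intro divide_right_mono) auto
    also have "\<dots> \<le> e / 2" using d(3) by simp
    finally have "prob ?C \<le> e / 2" .
    moreover have "prob (B - ?C) \<ge> prob B - prob ?C"
      using finite_measure_Diff'[OF B(1) C] finite_measure_mono[OF _ C, of "B \<inter> ?C"] by auto
    ultimately have "1 - e \<le> prob (B - ?C)" using B(2) by linarith
    moreover have "B - ?C \<in> sets M" using B(1) C by auto
    moreover have "\<bar>(\<Sum>i\<in>{1..m}. lik tb (x i \<omega>, p i \<omega>)) / real m
      - (\<Sum>i\<in>{1..m}. \<integral>\<omega>. lik tb (x i \<omega>, p i \<omega>) \<partial>M) / real m\<bar> \<le> g"
      if \<omega>: "\<omega> \<in> B - ?C" and tb: "tb \<in> \<Theta> \<times> \<B>" for \<omega> tb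
    proof -
      have \<omega>': "\<omega> \<in> space M" using \<omega> B(1) sets.sets_into_space by blast
      obtain tb' where tb': "tb' \<in> k" "dist tb tb' < \<eta>" using k(3) tb by (force simp: dist_commute)
      then have tb'2: "tb' \<in> \<Theta> \<times> \<B>" using k(1) by blast
      have 1: "\<bar>(\<Sum>i\<in>{1..m}. lik tb (x i \<omega>, p i \<omega>)) / real m - (\<Sum>i\<in>{1..m}. lt tb i \<omega>) / real m\<bar> \<le> g / 4"
      proof -
        have "\<bar>(\<Sum>i\<in>{1..m}. lik tb (x i \<omega>, p i \<omega>)) / real m - (\<Sum>i\<in>{1..m}. lt tb i \<omega>) / real m\<bar> \<le> Z \<omega>"
          unfolding Z_def lt_def h_def using T(6)[OF tb _ \<omega>'] by (intro averaged_diff_le) auto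
        also have "Z \<omega> \<le> g / 4" using \<omega> \<omega>' by auto
        finally show ?thesis .
      qed
      have 2: "\<bar>(\<Sum>i\<in>{1..m}. lt tb i \<omega>) / real m - (\<Sum>i\<in>{1..m}. lt tb' i \<omega>) / real m\<bar> \<le> d"
        using averaged_diff_le[of m "\<lambda>i. lt tb i \<omega>" "\<lambda>i. lt tb' i \<omega>" "\<lambda>i. d"]
          T(7)[OF tb tb'2 tb'(2) _ \<omega>'] average_const_le[of d m] d by (fastforce simp: lt_def)
      have 3: "\<bar>(\<Sum>i\<in>{1..m}. lt tb' i \<omega>) / real m - (\<Sum>i\<in>{1..m}. \<integral>\<omega>. lt tb' i \<omega> \<partial>M) / real m\<bar> \<le> g / 8"
        using B(3)[of \<omega> tb'] \<omega> tb' by (simp add: sum_subtractf diff_divide_distrib)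
      have 4: "\<bar>(\<Sum>i\<in>{1..m}. \<integral>\<omega>. lt tb' i \<omega> \<partial>M) / real m - (\<Sum>i\<in>{1..m}. \<integral>\<omega>. lt tb i \<omega> \<partial>M) / real m\<bar> \<le> d"
      proof (rule order_trans[OF averaged_diff_le[where c="\<lambda>i. d"] average_const_le])
        fix i assume i: "i \<in> {1..m}"
        have "\<bar>(\<integral>\<omega>. lt tb i \<omega> \<partial>M) - (\<integral>\<omega>. lt tb' i \<omega> \<partial>M)\<bar> \<le> (\<integral>\<omega>. d \<partial>M)"
          using i tb tb'2 T(7)[OF tb tb'2 tb'(2), of i]
          by (intro integral_diff_le lt_int) (auto simp: lt_def)
        then show "\<bar>(\<integral>\<omega>. lt tb' i \<omega> \<partial>M) - (\<integral>\<omega>. lt tb i \<omega> \<partial>M)\<bar> \<le> d"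
          by (simp add: prob_space abs_minus_commute)
      qed (use d in simp)
      have 5: "\<bar>(\<Sum>i\<in>{1..m}. \<integral>\<omega>. lik tb (x i \<omega>, p i \<omega>) \<partial>M) / real m - (\<Sum>i\<in>{1..m}. \<integral>\<omega>. lt tb i \<omega> \<partial>M) / real m\<bar> \<le> 2 * d"
      proof (rule order_trans[OF averaged_diff_le[where c="\<lambda>i. 2 * d"] average_const_le])
        fix i assume i: "i \<in> {1..m}"
        have "\<bar>(\<integral>\<omega>. lik tb (x i \<omega>, p i \<omega>) \<partial>M) - (\<integral>\<omega>. lt tb i \<omega> \<partial>M)\<bar> \<le> (\<integral>\<omega>. h i \<omega> \<partial>M)"
          using i tb T(6)[OF tb, of i]
          by (intro integral_diff_le lt_int lik_integrable h_int) (auto simp: lt_def h_def)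
        then show "\<bar>(\<integral>\<omega>. lik tb (x i \<omega>, p i \<omega>) \<partial>M) - (\<integral>\<omega>. lt tb i \<omega> \<partial>M)\<bar> \<le> 2 * d"
          using h_le[of i] i by auto
      qed (use d in simp)
      show ?thesis using 1 2 3 4 5 d(2) g by linarith
    qed
    ultimately show ?case by (intro bexI[of _ "B - ?C"]) auto
  qed
qed

lemma limit_lik_continuous:
  assumes lim: "uniform_limit (\<Theta> \<times> \<B>)
      (\<lambda>m tb. (\<Sum>i\<in>{1..m}. \<integral>\<omega>. lik tb (x i \<omega>, p i \<omega>) \<partial>M) / real m) R sequentially"
  shows "continuous_on (\<Theta> \<times> \<B>) R"
proof (rule uniform_limit_theorem[OF _ lim])
  show "\<forall>\<^sub>F m in sequentially. continuous_on (\<Theta> \<times> \<B>) (\<lambda>tb. (\<Sum>i\<in>{1..m}. \<integral>\<omega>. lik tb (x i \<omega>, p i \<omega>) \<partial>M) / real m)"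
  proof (rule eventually_sequentiallyI[of 1])
    fix m :: nat assume m: "m \<ge> 1"
    have "continuous_on (\<Theta> \<times> \<B>) (\<lambda>tb. \<integral>\<omega>. lik tb (x i \<omega>, p i \<omega>) \<partial>M)" if i: "i \<in> {1..m}" for i
      unfolding continuous_on_iff
    proof (intro ballI allI impI)
      fix tb and e :: real assume tb: "tb \<in> \<Theta> \<times> \<B>" and e: "e > 0"
      then have "e / 2 > 0" by simp
      then obtain \<eta> where "\<eta> > 0" and
        \<eta>: "\<And>tb tb' i. tb \<in> \<Theta> \<times> \<B> \<Longrightarrow> tb' \<in> \<Theta> \<times> \<B> \<Longrightarrow> dist tb tb' < \<eta> \<Longrightarrow> i \<ge> 1 \<Longrightarrow>
        \<bar>(\<integral>\<omega>. lik tb (x i \<omega>, p i \<omega>) \<partial>M) - (\<integral>\<omega>. lik tb' (x i \<omega>, p i \<omega>) \<partial>M)\<bar> \<le> e / 2" by (rule expected_lik_equicontinuous) blast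
      moreover have "dist (\<integral>\<omega>. lik tb' (x i \<omega>, p i \<omega>) \<partial>M) (\<integral>\<omega>. lik tb (x i \<omega>, p i \<omega>) \<partial>M) < e"
        if "tb' \<in> \<Theta> \<times> \<B>" "dist tb' tb < \<eta>" for tb'
        using \<eta>[OF that(1) tb that(2), of i] i e by (simp add: dist_real_def)
      ultimately show "\<exists>d>0. \<forall>tb'\<in>\<Theta> \<times> \<B>. dist tb' tb < d \<longrightarrow>
        dist (\<integral>\<omega>. lik tb' (x i \<omega>, p i \<omega>) \<partial>M) (\<integral>\<omega>. lik tb (x i \<omega>, p i \<omega>) \<partial>M) < e" by blast
    qed
    then show "continuous_on (\<Theta> \<times> \<B>) (\<lambda>tb. (\<Sum>i\<in>{1..m}. \<integral>\<omega>. lik tb (x i \<omega>, p i \<omega>) \<partial>M) / real m)"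
      using m by (intro continuous_intros) auto
  qed
qed simp

lemma mle_consistent:
  fixes est :: "nat \<Rightarrow> 'a \<Rightarrow> (real \<times> (real^'q)) \<times> (real \<times> (real^'q))"
  assumes lim: "uniform_limit (\<Theta> \<times> \<B>)
      (\<lambda>m tb. (\<Sum>i\<in>{1..m}. \<integral>\<omega>. lik tb (x i \<omega>, p i \<omega>) \<partial>M) / real m) R sequentially"
    and tbs: "tbs \<in> \<Theta> \<times> \<B>" "\<And>tb. tb \<in> \<Theta> \<times> \<B> \<Longrightarrow> tb \<noteq> tbs \<Longrightarrow> R tb < R tbs"
    and est: "\<And>m \<omega>. \<omega> \<in> space M \<Longrightarrow> est m \<omega> \<in> \<Theta> \<times> \<B>"
    and est_max: "\<And>m \<omega> tb. \<omega> \<in> space M \<Longrightarrow> tb \<in> \<Theta> \<times> \<B> \<Longrightarrow>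
      (\<Sum>i\<in>{1..m}. lik tb (x i \<omega>, p i \<omega>)) \<le> (\<Sum>i\<in>{1..m}. lik (est m \<omega>) (x i \<omega>, p i \<omega>))"
    and \<eta>: "\<eta> > 0"
  shows "\<forall>\<^sub>F (m, \<omega>) in whp M. dist (est m \<omega>) tbs < \<eta>"
proof (cases "\<Theta> \<times> \<B> \<subseteq> ball tbs \<eta>")
  case True
  have "dist (est m \<omega>) tbs < \<eta>" if "\<omega> \<in> space M" for m \<omega>
    using subsetD[OF True est[OF that]] by (simp add: dist_commute)
  with eventually_whp_sequentially[of "\<lambda>_. True", OF eventually_True] show ?thesis
    by (auto elim!: eventually_mono)
next
  case False
  let ?K = "\<Theta> \<times> \<B> - ball tbs \<eta>"
  have "compact ?K" using compact_Times[OF compact_params] by (intro compact_diff) auto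
  moreover have "continuous_on ?K R" using limit_lik_continuous[OF lim] by (rule continuous_on_subset) blast
  ultimately obtain tb0 where tb0: "tb0 \<in> ?K" "\<And>tb. tb \<in> ?K \<Longrightarrow> R tb \<le> R tb0"
    using continuous_attains_sup[of ?K R] False by blast
  define d where "d = R tbs - R tb0"
  have "tb0 \<noteq> tbs" using tb0(1) \<eta> by (metis DiffD2 centre_in_ball)
  then have d: "d > 0" unfolding d_def using tb0(1) tbs(2)[of tb0] by simp
  have "\<forall>\<^sub>F m in sequentially. \<forall>tb\<in>\<Theta> \<times> \<B>. dist ((\<Sum>i\<in>{1..m}. \<integral>\<omega>. lik tb (x i \<omega>, p i \<omega>) \<partial>M) / real m) (R tb) < d / 8"
    using lim d unfolding uniform_limit_iff by (auto dest!: spec[of _ "d / 8"])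
  from eventually_whp_sequentially[OF this] uniform_weak_law_lik[of "d / 8"] d
  have "\<forall>\<^sub>F (m, \<omega>) in whp M. (\<forall>tb\<in>\<Theta> \<times> \<B>. dist ((\<Sum>i\<in>{1..m}. \<integral>\<omega>. lik tb (x i \<omega>, p i \<omega>) \<partial>M) / real m) (R tb) < d / 8) \<and> \<omega> \<in> space M"
    "\<forall>\<^sub>F (m, \<omega>) in whp M. \<forall>tb\<in>\<Theta> \<times> \<B>. \<bar>(\<Sum>i\<in>{1..m}. lik tb (x i \<omega>, p i \<omega>)) / real m
      - (\<Sum>i\<in>{1..m}. \<integral>\<omega>. lik tb (x i \<omega>, p i \<omega>) \<partial>M) / real m\<bar> \<le> d / 8" by simp_all
  then show ?thesis
  proof eventually_elim
    case (elim z)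
    obtain m \<omega> where z: "z = (m, \<omega>)" by (cases z)
    have \<omega>: "\<omega> \<in> space M" using elim(1) z by simp
    note e = est[OF \<omega>, of m]
    have "(\<Sum>i\<in>{1..m}. lik tbs (x i \<omega>, p i \<omega>)) / real m \<le> (\<Sum>i\<in>{1..m}. lik (est m \<omega>) (x i \<omega>, p i \<omega>)) / real m"
      using est_max[OF \<omega> tbs(1)] by (intro divide_right_mono) auto
    moreover have "\<bar>(\<Sum>i\<in>{1..m}. \<integral>\<omega>. lik tb (x i \<omega>, p i \<omega>) \<partial>M) / real m - R tb\<bar> < d / 8"
      "\<bar>(\<Sum>i\<in>{1..m}. lik tb (x i \<omega>, p i \<omega>)) / real m
      - (\<Sum>i\<in>{1..m}. \<integral>\<omega>. lik tb (x i \<omega>, p i \<omega>) \<partial>M) / real m\<bar> \<le> d / 8" if "tb \<in> \<Theta> \<times> \<B>" for tb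
      using elim z that by (auto simp: dist_real_def)
    from this[OF e] this[OF tbs(1)] calculation have "R (est m \<omega>) > R tbs - d"
      using d unfolding abs_le_iff abs_less_iff by linarith
    then have "\<not> R (est m \<omega>) \<le> R tb0" by (simp add: d_def)
    then have "est m \<omega> \<notin> ?K" by (rule contrapos_nn) (rule tb0(2))
    then have "est m \<omega> \<in> ball tbs \<eta>" by (rule contrapos_np) (rule DiffI[OF e])
    then show ?case using z by (simp add: dist_commute)
  qed
qed

end

section \<open>Rejection thresholds\<close>

lemma thr_base_pos:
  fixes t \<pi> k :: real
  assumes "0 < t" "t < 1" "0 < \<pi>" "\<pi> < 1" "k < 1"
  shows "0 < t * (1 - k) * (1 - \<pi>) / ((1 - t) * \<pi>)"
  using assms by (intro divide_pos_pos mult_pos_pos) auto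

lemma thr_le_1: "thr t \<pi> k \<le> 1"
  by (simp add: thr_def)

lemma thr_nonneg: "0 \<le> thr t \<pi> k"
  by (simp add: thr_def)

lemma thr_mono:
  assumes "0 < t" "t \<le> t'" "t' < 1" "0 < \<pi>" "\<pi> < 1" "0 < k" "k < 1"
  shows "thr t \<pi> k \<le> thr t' \<pi> k"
proof -
  have "t * (1 - k) * (1 - \<pi>) / ((1 - t) * \<pi>) \<le> t' * (1 - k) * (1 - \<pi>) / ((1 - t') * \<pi>)"
    using assms by (intro frac_le mult_right_mono mult_pos_pos mult_nonneg_nonneg) auto
  then have "(t * (1 - k) * (1 - \<pi>) / ((1 - t) * \<pi>)) powr (1 / k) \<le> (t' * (1 - k) * (1 - \<pi>) / ((1 - t') * \<pi>)) powr (1 / k)"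
    using assms thr_base_pos[of t \<pi> k] by (intro powr_mono2) auto
  then show ?thesis using assms by (auto simp: thr_def)
qed

lemma powr_le_iff_le_powr_inverse:
  fixes q b k :: real
  assumes "0 < q" "0 < b" "0 < k"
  shows "q powr k \<le> b \<longleftrightarrow> q \<le> b powr (1 / k)"
proof -
  have b: "b = (b powr (1 / k)) powr k" using assms by (simp add: powr_powr)
  show ?thesis
  proof
    assume "q \<le> b powr (1 / k)"
    then have "q powr k \<le> (b powr (1 / k)) powr k" using assms by (intro powr_mono2) auto
    then show "q powr k \<le> b" using b by simp
  next
    assume *: "q powr k \<le> b"
    show "q \<le> b powr (1 / k)"
    proof (rule ccontr)
      assume "\<not> q \<le> b powr (1 / k)"
      then have "(b powr (1 / k)) powr k < q powr k" using assms by (intro powr_less_mono2) auto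
      then show False using * b by simp
    qed
  qed
qed

lemma wt_eq:
  assumes "0 < t" "t < 1" "0 < \<pi>" "\<pi> < 1" "k < 1"
  shows "wt t \<pi> = (1 - k) / (t * (1 - k) * (1 - \<pi>) / ((1 - t) * \<pi>))"
proof -
  have "u * \<pi> / (t * v) = a / (t * a * v / (u * \<pi>))" if "a \<noteq> 0" "u \<noteq> 0" "v \<noteq> 0" for a u v
    using that assms by (simp add: field_simps)
  from this[of "1 - k" "1 - t" "1 - \<pi>"] show ?thesis using assms by (simp add: wt_def)
qed

lemma wt_le_iff:
  fixes q :: real
  assumes "0 < t" "t < 1" "0 < \<pi>" "\<pi> < 1" "0 < k" "k < 1" "0 < q"
  shows "wt t \<pi> \<le> (1 - k) * q powr (- k) \<longleftrightarrow>
    q \<le> (t * (1 - k) * (1 - \<pi>) / ((1 - t) * \<pi>)) powr (1 / k)"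
proof -
  let ?b = "t * (1 - k) * (1 - \<pi>) / ((1 - t) * \<pi>)"
  have b: "0 < ?b" using assms by (intro thr_base_pos) auto
  have w: "wt t \<pi> = (1 - k) / ?b" using assms by (intro wt_eq) auto
  have "wt t \<pi> \<le> (1 - k) * q powr (- k) \<longleftrightarrow> (1 - k) * (1 / ?b) \<le> (1 - k) * (1 / q powr k)"
    unfolding w using assms by (simp add: powr_minus_divide)
  also have "\<dots> \<longleftrightarrow> 1 / ?b \<le> 1 / q powr k" using assms by (subst mult_le_cancel_left_pos) auto
  also have "\<dots> \<longleftrightarrow> q powr k \<le> ?b" 
  proof -
    have "1 / b \<le> 1 / r \<longleftrightarrow> r \<le> b" if "0 < b" "0 < r" for b r :: real
      using that by (simp add: field_simps)
    from this[OF b] show ?thesis using assms by simp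
  qed
  also have "\<dots> \<longleftrightarrow> q \<le> ?b powr (1 / k)" using b assms by (intro powr_le_iff_le_powr_inverse) auto
  finally show ?thesis .
qed

lemma wt_le_iff_le_thr:
  assumes "0 < t" "t < 1" "0 < \<pi>" "\<pi> < 1" "0 < k" "k < 1" "0 < p" "p \<le> 1"
  shows "wt t \<pi> \<le> (1 - k) * p powr (- k) \<longleftrightarrow> p \<le> thr t \<pi> k"
  using wt_le_iff[of t \<pi> k p] assms by (simp add: thr_def)

lemma wt_less_iff_less_thr:
  assumes "0 < t" "t < 1" "0 < \<pi>" "\<pi> < 1" "0 < k" "k < 1" "0 < p" "p \<le> 1"
  shows "(p = 1 \<or> wt t \<pi> < (1 - k) * (1 - p) powr (- k)) \<longleftrightarrow> 1 - p < thr t \<pi> k"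
proof (cases "p = 1")
  case True
  then show ?thesis using assms thr_base_pos[of t \<pi> k] by (simp add: thr_def)
next
  case False
  let ?b = "t * (1 - k) * (1 - \<pi>) / ((1 - t) * \<pi>)"
  have b: "0 < ?b" using assms by (intro thr_base_pos) auto
  have q: "0 < 1 - p" using False assms by simp
  have w: "wt t \<pi> = (1 - k) / ?b" using assms by (intro wt_eq) auto
  have "wt t \<pi> < (1 - k) * (1 - p) powr (- k) \<longleftrightarrow> (1 - k) * (1 / ?b) < (1 - k) * (1 / (1 - p) powr k)"
    unfolding w using assms by (simp add: powr_minus_divide)
  also have "\<dots> \<longleftrightarrow> 1 / ?b < 1 / (1 - p) powr k" using assms by (subst mult_less_cancel_left_pos) auto
  also have "\<dots> \<longleftrightarrow> (1 - p) powr k < ?b" 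
  proof -
    have "1 / b < 1 / r \<longleftrightarrow> r < b" if "0 < b" "0 < r" for b r :: real
      using that by (simp add: field_simps)
    from this[OF b] show ?thesis using q by simp
  qed
  also have "\<dots> \<longleftrightarrow> 1 - p < ?b powr (1 / k)"
  proof -
    have "?b powr (1 / k) \<le> 1 - p \<longleftrightarrow> ?b \<le> (1 - p) powr k"
      using powr_le_iff_le_powr_inverse[OF b q, of "1 / k"] assms by simp
    then show ?thesis by (simp only: not_le[symmetric])
  qed
  finally show ?thesis using False assms by (simp add: thr_def)
qed

lemma continuous_on_thr:
  fixes f g h :: "'c::topological_space \<Rightarrow> real"
  assumes "continuous_on S f" "continuous_on S g" "continuous_on S h"
    and r: "\<And>z. z \<in> S \<Longrightarrow> 0 < f z \<and> f z < 1 \<and> 0 < g z \<and> g z < 1 \<and> 0 < h z \<and> h z < 1"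
  shows "continuous_on S (\<lambda>z. thr (f z) (g z) (h z))"
proof -
  have "continuous_on S (\<lambda>z. min 1 ((f z * (1 - h z) * (1 - g z) / ((1 - f z) * g z)) powr (1 / h z)))"
    using assms(1-3) by (intro continuous_intros) (use r in \<open>force dest: less_imp_neq\<close>)+
  then show ?thesis
    by (rule continuous_on_eq) (use r in \<open>force simp: thr_def\<close>)
qed

lemma isCont_thr:
  assumes "0 < t" "t < 1" "0 < \<pi>" "\<pi> < 1" "0 < k" "k < 1"
  shows "isCont (\<lambda>t. thr t \<pi> k) t"
proof -
  have "continuous_on {0<..<1} (\<lambda>t. thr t \<pi> k)"
    using assms by (intro continuous_on_thr continuous_intros) auto
  then show ?thesis using assms by (simp add: continuous_on_eq_continuous_at)
qed

lemma winsor_bounds: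
  assumes "e1 < 1 - e2"
  shows "e1 \<le> winsor e1 e2 u" "winsor e1 e2 u \<le> 1 - e2"
  using assms by (auto simp: winsor_def)

lemma continuous_on_winsor [continuous_intros]:
  "continuous_on S f \<Longrightarrow> continuous_on S (\<lambda>z. winsor e1 e2 (f z))"
  unfolding winsor_def by (intro continuous_intros)

text \<open>For \<open>t \<ge> t1\<close> and for \<open>t = 0\<close> (where \<^term>\<open>wt\<close> takes the junk value 0) every hypothesis is
  counted in the numerator, so such \<open>t\<close> are infeasible.
  The count \<open>N\<close> is left-continuous in \<open>t\<close>, hence the supremum is itself feasible.\<close>

lemma that_feasible:
  fixes P PiV K :: "nat \<Rightarrow> real" and m :: nat
  defines "N \<equiv> \<lambda>t. card {i\<in>{1..m}. 1 - P i < thr t (PiV i) (K i)}"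
    and "D \<equiv> \<lambda>t. card {i\<in>{1..m}. P i \<le> thr t (PiV i) (K i)}"
  assumes P: "\<And>i. i \<in> {1..m} \<Longrightarrow> 0 < P i \<and> P i \<le> 1"
    and Pi: "\<And>i. i \<in> {1..m} \<Longrightarrow> 0 < PiV i \<and> PiV i \<le> 1 - e2"
    and K: "\<And>i. i \<in> {1..m} \<Longrightarrow> 0 < K i \<and> K i \<le> 1 - \<kappa>"
    and e2: "0 < e2" and \<kappa>: "0 < \<kappa>" and \<alpha>: "0 < \<alpha>" "\<alpha> < 1"
    and t1: "0 < t1" "t1 < 1" "(1 - t1) / t1 \<le> \<kappa> * e2"
    and t': "0 < t'" "t' < 1" "1 + real (N t') \<le> \<alpha> * real (D t')"
  shows "t' \<le> that \<alpha> m P PiV K" "that \<alpha> m P PiV K \<le> t1"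
    "1 + real (N (that \<alpha> m P PiV K)) \<le> \<alpha> * real (D (that \<alpha> m P PiV K))"
proof -
  let ?num = "\<lambda>t. {i \<in> {1..m}. P i = 1 \<or> wt t (PiV i) < (1 - K i) * (1 - P i) powr (- K i)}"
  let ?den = "\<lambda>t. {i \<in> {1..m}. wt t (PiV i) \<le> (1 - K i) * P i powr (- K i)}"
  define S where "S = {t \<in> {0..1}. real (1 + card (?num t)) / real (max 1 (card (?den t))) \<le> \<alpha>}"
  have pk: "0 < PiV i" "PiV i < 1" "0 < K i" "K i < 1" "0 < P i" "P i \<le> 1" if "i \<in> {1..m}" for i
    using P[OF that] Pi[OF that] K[OF that] e2 \<kappa> by auto
  have num: "?num t = {i\<in>{1..m}. 1 - P i < thr t (PiV i) (K i)}" if "0 < t" "t < 1" for t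
    using wt_less_iff_less_thr[OF that] pk by blast
  have den: "?den t = {i\<in>{1..m}. P i \<le> thr t (PiV i) (K i)}" if "0 < t" "t < 1" for t
    using wt_le_iff_le_thr[OF that] pk by blast
  have S_iff: "t \<in> S \<longleftrightarrow> 1 + real (N t) \<le> \<alpha> * real (max 1 (D t))" if "0 < t" "t < 1" for t
    unfolding S_def N_def D_def using that num[OF that] den[OF that] by (auto simp: divide_le_eq)
  have full: "t \<notin> S" if "?num t = {1..m}" for t
  proof
    assume "t \<in> S"
    then have "real (1 + m) / real (max 1 (card (?den t))) \<le> \<alpha>" using that by (simp add: S_def)
    moreover have "card (?den t) \<le> card {1..m}" by (intro card_mono) auto
    then have "real (max 1 (card (?den t))) \<le> real (1 + m)" by simp
    then have "1 \<le> real (1 + m) / real (max 1 (card (?den t)))" by (subst le_divide_eq) auto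
    ultimately show False using \<alpha> by linarith
  qed
  have S_range: "0 < t \<and> t < t1" if "t \<in> S" for t
  proof (rule ccontr)
    assume *: "\<not> (0 < t \<and> t < t1)"
    have t: "0 \<le> t" "t \<le> 1" using that by (auto simp: S_def)
    have "wt t (PiV i) < (1 - K i) * (1 - P i) powr (- K i)" if i: "i \<in> {1..m}" "P i \<noteq> 1" for i
    proof -
      note q = pk[OF i(1)]
      have gt: "1 < (1 - P i) powr (- K i)"
        using q i(2) powr_less_mono2[of "K i" "1 - P i" 1]
        by (simp add: powr_minus one_less_inverse_iff)
      have "wt t (PiV i) \<le> 1 - K i"
      proof (cases "t = 0")
        case True then show ?thesis using q by (simp add: wt_def)
      next
        case False
        then have tt: "t1 \<le> t" "0 < t" using * t by auto
        have "(1 - t) / t \<le> (1 - t1) / t1" using tt t t1 by (intro frac_le) auto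
        also have "\<dots> \<le> \<kappa> * e2" by (rule t1)
        finally have a: "(1 - t) / t \<le> \<kappa> * e2" .
        have "PiV i / (1 - PiV i) \<le> 1 / e2" using Pi[OF i(1)] e2 by (intro frac_le) auto
        then have "(1 - t) / t * (PiV i / (1 - PiV i)) \<le> \<kappa> * e2 * (1 / e2)"
          using a q \<kappa> e2 t by (intro mult_mono) auto
        then show ?thesis using K[OF i(1)] e2 by (simp add: wt_def)
      qed
      also have "\<dots> < (1 - K i) * (1 - P i) powr (- K i)" using gt q by simp
      finally show ?thesis .
    qed
    then have "?num t = {1..m}" by blast
    with full that show False by blast
  qed
  have D0: "1 \<le> D t'"
  proof (rule ccontr)
    assume "\<not> 1 \<le> D t'"
    then have "D t' = 0" by simp
    then show False using t'(3) by simp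
  qed
  have t'S: "t' \<in> S" using S_iff[OF t'(1,2)] t'(3) D0 by (simp add: max_def)
  define T where "T = Sup S"
  have T: "that \<alpha> m P PiV K = T" unfolding that_def Let_def S_def[symmetric] T_def using t'S by auto
  have bdd: "bdd_above S" using S_range by (intro bdd_aboveI[of _ t1]) (auto intro: less_imp_le)
  show le: "t' \<le> that \<alpha> m P PiV K" unfolding T T_def using t'S bdd by (rule cSup_upper)
  show "that \<alpha> m P PiV K \<le> t1" unfolding T T_def using t'S S_range by (intro cSup_least) (auto intro: less_imp_le)
  then have T01: "0 < T" "T < 1" using le T t' t1 by auto
  have D_mono: "D t \<le> D T" if "0 < t" "t \<le> T" for t
    unfolding D_def
  proof (intro card_mono subsetI)
    fix i assume i: "i \<in> {i\<in>{1..m}. P i \<le> thr t (PiV i) (K i)}"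
    then have "thr t (PiV i) (K i) \<le> thr T (PiV i) (K i)" using pk[of i] that T01 by (intro thr_mono) auto
    then show "i \<in> {i\<in>{1..m}. P i \<le> thr T (PiV i) (K i)}" using i by auto
  qed auto
  have "\<forall>\<^sub>F t in nhds T. \<forall>i\<in>{i\<in>{1..m}. 1 - P i < thr T (PiV i) (K i)}. 1 - P i < thr t (PiV i) (K i)"
  proof (intro eventually_ball_finite ballI)
    fix i assume i: "i \<in> {i\<in>{1..m}. 1 - P i < thr T (PiV i) (K i)}"
    then have "((\<lambda>t. thr t (PiV i) (K i)) \<longlongrightarrow> thr T (PiV i) (K i)) (nhds T)"
      using isCont_thr[OF T01, of "PiV i" "K i"] pk[of i]
        tendsto_at_iff_tendsto_nhds[of "\<lambda>t. thr t (PiV i) (K i)" T] by (simp add: isCont_def)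
    then show "\<forall>\<^sub>F t in nhds T. 1 - P i < thr t (PiV i) (K i)"
      using i by (intro order_tendstoD) auto
  qed auto
  then obtain d where d: "d > 0" "\<And>t i. dist t T < d \<Longrightarrow> i \<in> {1..m} \<Longrightarrow> 1 - P i < thr T (PiV i) (K i) \<Longrightarrow> 1 - P i < thr t (PiV i) (K i)"
    unfolding eventually_nhds_metric by blast
  have "T - d < Sup S" using d by (simp add: T_def)
  then obtain t where t: "t \<in> S" "T - d < t" using less_cSup_iff[of S] t'S bdd by blast
  have tT: "t \<le> T" unfolding T_def using t(1) bdd by (rule cSup_upper)
  have t01: "0 < t" "t < 1" using S_range[OF t(1)] t1 by auto
  have "N T \<le> N t" unfolding N_def using d(2)[of t] t(2) tT
    by (intro card_mono) (auto simp: dist_real_def)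
  then have "1 + real (N T) \<le> 1 + real (N t)" by simp
  also have "\<dots> \<le> \<alpha> * real (max 1 (D t))" using S_iff[OF t01] t(1) by simp
  also have "\<dots> \<le> \<alpha> * real (D T)"
    using D_mono[OF t01(1) tT] D_mono[OF t'(1)] D0 le T \<alpha> by (intro mult_left_mono) auto
  finally show "1 + real (N (that \<alpha> m P PiV K)) \<le> \<alpha> * real (D (that \<alpha> m P PiV K))" unfolding T .
qed

section \<open>Conditional distributions\<close>

context prob_space
begin

lemma condP_integral:
  fixes Y :: "'a \<Rightarrow> 'b::topological_space"
  assumes Y: "Y \<in> borel_measurable M" and A: "A \<in> events" and D: "D \<in> sets borel"
  shows "integrable M (\<lambda>\<omega>. indicator D (Y \<omega>) * condP M Y A \<omega>)"
    "(\<integral>\<omega>. indicator D (Y \<omega>) * condP M Y A \<omega> \<partial>M) = prob (Y -` D \<inter> A)"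
proof -
  let ?F = "vimage_algebra (space M) Y borel"
  have sub: "subalgebra M ?F"
    unfolding subalgebra_def using Y
    by (auto simp: sets_vimage_algebra2 intro: measurable_sets)
  interpret F: finite_measure_subalgebra M ?F by standard (rule sub)
  have D': "(\<lambda>\<omega>. indicator D (Y \<omega>) :: real) \<in> borel_measurable ?F"
    by (rule measurable_compose[OF measurable_vimage_algebra1]) (use D in auto)
  have YD: "Y -` D \<inter> A \<in> events"
    using measurable_sets[OF Y D] A sets.Int[of "Y -` D \<inter> space M" M A] sets.sets_into_space[OF A]
    by (metis inf.absorb_iff2 inf_assoc)
  have eq: "(\<lambda>\<omega>. indicator D (Y \<omega>) * indicator A \<omega> :: real) = indicator (Y -` D \<inter> A)"
    by (auto simp: indicator_def)
  have "integrable M (\<lambda>\<omega>. indicator D (Y \<omega>) * indicator A \<omega> :: real)"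
    unfolding eq using YD by (intro integrable_real_indicator) (auto simp: less_top[symmetric])
  note * = F.real_cond_exp_intg[OF this D' borel_measurable_indicator[OF A]]
  show "integrable M (\<lambda>\<omega>. indicator D (Y \<omega>) * condP M Y A \<omega>)" unfolding condP_def by (rule *(1))
  show "(\<integral>\<omega>. indicator D (Y \<omega>) * condP M Y A \<omega> \<partial>M) = prob (Y -` D \<inter> A)"
    unfolding condP_def *(2) eq using YD by (simp add: sets.Int_space_eq2)
qed

text \<open>The threshold sequences in the Lipschitz hypothesis are deterministic. Covariate-dependent
  endpoints are reduced to finitely many deterministic sequences by rounding to a grid.\<close>

lemma covariate_interval_mass:
  fixes x :: "nat \<Rightarrow> 'a \<Rightarrow> 'b::topological_space" and p :: "nat \<Rightarrow> 'a \<Rightarrow> real"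
  assumes x_meas: "\<And>i. i \<ge> 1 \<Longrightarrow> x i \<in> borel_measurable M"
    and p_meas: "\<And>i. i \<ge> 1 \<Longrightarrow> p i \<in> borel_measurable M"
    and p_le_1: "\<And>i \<omega>. i \<ge> 1 \<Longrightarrow> \<omega> \<in> space M \<Longrightarrow> p i \<omega> \<le> 1"
    and \<epsilon>: "0 < \<epsilon>" "\<epsilon> \<le> 1" and small: "\<And>i. i \<ge> 1 \<Longrightarrow> prob {\<omega>\<in>space M. p i \<omega> \<le> \<epsilon>} \<le> g"
    and lip: "\<And>a b :: nat \<Rightarrow> real. (\<forall>i\<in>{1..m}. a i \<in> {\<epsilon>..1} \<and> b i \<in> {\<epsilon>..1}) \<Longrightarrow>
         (AE \<omega> in M. \<bar>(\<Sum>i\<in>{1..m}. condP M (x i) {\<omega>'\<in>space M. p i \<omega>' \<le> a i} \<omega>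
                                   - condP M (x i) {\<omega>'\<in>space M. p i \<omega>' \<le> b i} \<omega>) / real m\<bar>
                      \<le> c0 * (MAX i\<in>{1..m}. \<bar>a i - b i\<bar>))"
    and c0: "c0 \<le> c" "0 \<le> c" and \<delta>: "\<delta> > 0" and m: "m \<ge> 1"
    and b: "\<And>i. i \<in> {1..m} \<Longrightarrow> b i \<in> borel_measurable borel"
  shows "(\<Sum>i\<in>{1..m}. prob {\<omega>\<in>space M. b i (x i \<omega>) < p i \<omega> \<and> p i \<omega> \<le> b i (x i \<omega>) + \<delta>}) / real m \<le> g + c * (2 * \<delta>)"
proof -
  obtain n :: nat where n: "real n \<ge> 1 / \<delta>" using real_arch_simple by blast
  then have n1: "1 \<le> \<epsilon> + real n * \<delta>" using \<delta> \<epsilon> by (simp add: field_simps)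
  define a where "a = (\<lambda>j::nat. min 1 (\<epsilon> + real j * \<delta>))"
  have a: "a j \<in> {\<epsilon>..1}" for j using \<epsilon> \<delta> by (auto simp: a_def)
  have a_diff: "\<bar>a (j + 2) - a j\<bar> \<le> 2 * \<delta>" for j using \<delta> by (auto simp: a_def min_def algebra_simps)
  define J where "J = (\<lambda>i u. min n (nat \<lfloor>(b i u - \<epsilon>) / \<delta>\<rfloor>))"
  have J_meas: "{u. J i u = j} \<in> sets borel" if "i \<in> {1..m}" for i j
    unfolding J_def using b[OF that] by measurable
  define E where "E = (\<lambda>i j. {\<omega>\<in>space M. a j < p i \<omega> \<and> p i \<omega> \<le> a (j + 2)})"
  define q where "q = (\<lambda>i j \<omega>. condP M (x i) {\<omega>'\<in>space M. p i \<omega>' \<le> a (j + 2)} \<omega> - condP M (x i) {\<omega>'\<in>space M. p i \<omega>' \<le> a j} \<omega>)"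
  have ev: "{\<omega>\<in>space M. p i \<omega> \<le> y} \<in> events" if "i \<ge> 1" for i y
    using p_meas[OF that] by measurable
  have q_int: "integrable M (\<lambda>\<omega>. indicator {u. J i u = j} (x i \<omega>) * q i j \<omega>)"
    and q_eq: "(\<integral>\<omega>. indicator {u. J i u = j} (x i \<omega>) * q i j \<omega> \<partial>M) = prob (x i -` {u. J i u = j} \<inter> E i j)"
    if i: "i \<in> {1..m}" for i j
  proof -
    have i1: "i \<ge> 1" using i by simp
    note c1 = condP_integral[OF x_meas[OF i1] ev[OF i1] J_meas[OF i]]
    have q': "indicator {u. J i u = j} (x i \<omega>) * q i j \<omega> =
      indicator {u. J i u = j} (x i \<omega>) * condP M (x i) {\<omega>'\<in>space M. p i \<omega>' \<le> a (j + 2)} \<omega>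
      - indicator {u. J i u = j} (x i \<omega>) * condP M (x i) {\<omega>'\<in>space M. p i \<omega>' \<le> a j} \<omega>" for \<omega>
      by (simp add: q_def algebra_simps)
    show "integrable M (\<lambda>\<omega>. indicator {u. J i u = j} (x i \<omega>) * q i j \<omega>)"
      unfolding q' by (intro Bochner_Integration.integrable_diff c1)
    have X: "x i -` {u. J i u = j} \<inter> {\<omega>\<in>space M. p i \<omega> \<le> y} \<in> events" for y
      using sets.Int[OF measurable_sets[OF x_meas[OF i1] J_meas[OF i]] ev[OF i1, of y]]
      by (rule back_subst[where P="\<lambda>A. A \<in> events"]) auto
    have "a j \<le> a (j + 2)" unfolding a_def using \<delta> by (intro min.mono) (auto simp: algebra_simps)
    then have "(x i -` {u. J i u = j} \<inter> {\<omega>\<in>space M. p i \<omega> \<le> a (j + 2)}) - (x i -` {u. J i u = j} \<inter> {\<omega>\<in>space M. p i \<omega> \<le> a j}) = x i -` {u. J i u = j} \<inter> E i j"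
      and "(x i -` {u. J i u = j} \<inter> {\<omega>\<in>space M. p i \<omega> \<le> a j}) \<subseteq> x i -` {u. J i u = j} \<inter> {\<omega>\<in>space M. p i \<omega> \<le> a (j + 2)}"
      by (auto simp: E_def)
    then show "(\<integral>\<omega>. indicator {u. J i u = j} (x i \<omega>) * q i j \<omega> \<partial>M) = prob (x i -` {u. J i u = j} \<inter> E i j)"
      unfolding q' using finite_measure_Diff[OF X X, of "a j" "a (j + 2)"]
      by (subst Bochner_Integration.integral_diff[OF c1(1) c1(1)]) (simp add: c1(2))
  qed
  have cover: "prob {\<omega>\<in>space M. b i (x i \<omega>) < p i \<omega> \<and> p i \<omega> \<le> b i (x i \<omega>) + \<delta>}
      \<le> g + (\<Sum>j\<le>n. prob (x i -` {u. J i u = j} \<inter> E i j))" if i: "i \<in> {1..m}" for i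
  proof -
    have i1: "i \<ge> 1" using i by simp
    have XE: "x i -` {u. J i u = j} \<inter> E i j \<in> events" for j
    proof -
      have "E i j \<in> events" unfolding E_def using p_meas[OF i1] by measurable
      from sets.Int[OF measurable_sets[OF x_meas[OF i1] J_meas[OF i]] this]
      show ?thesis by (rule back_subst[where P="\<lambda>A. A \<in> events"]) (auto simp: E_def)
    qed
    have "{\<omega>\<in>space M. b i (x i \<omega>) < p i \<omega> \<and> p i \<omega> \<le> b i (x i \<omega>) + \<delta>}
      \<subseteq> {\<omega>\<in>space M. p i \<omega> \<le> \<epsilon>} \<union> (\<Union>j\<in>{..n}. x i -` {u. J i u = j} \<inter> E i j)"
    proof
      fix \<omega> assume "\<omega> \<in> {\<omega>\<in>space M. b i (x i \<omega>) < p i \<omega> \<and> p i \<omega> \<le> b i (x i \<omega>) + \<delta>}"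
      then have \<omega>: "\<omega> \<in> space M" "b i (x i \<omega>) < p i \<omega>" "p i \<omega> \<le> b i (x i \<omega>) + \<delta>" by auto
      note p1 = p_le_1[OF i1 \<omega>(1)]
      show "\<omega> \<in> {\<omega>\<in>space M. p i \<omega> \<le> \<epsilon>} \<union> (\<Union>j\<in>{..n}. x i -` {u. J i u = j} \<inter> E i j)"
      proof (cases "p i \<omega> \<le> \<epsilon>")
        case False
        define y where "y = (b i (x i \<omega>) - \<epsilon>) / \<delta>"
        define j where "j = nat \<lfloor>y\<rfloor>"
        have by_eq: "b i (x i \<omega>) = \<epsilon> + y * \<delta>" using \<delta> by (simp add: y_def)
        have "y < real n"
        proof -
          have "\<epsilon> + y * \<delta> < \<epsilon> + real n * \<delta>" using by_eq \<omega>(2) p1 n1 by linarith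
          then show ?thesis using \<delta> by simp
        qed
        then have jn: "j \<le> n" unfolding j_def by linarith
        then have J: "J i (x i \<omega>) = j" by (simp add: J_def j_def y_def)
        have up: "p i \<omega> \<le> a (j + 2)"
        proof -
          have "y + 1 \<le> real (j + 2)" unfolding j_def by linarith
          then have "(y + 1) * \<delta> \<le> real (j + 2) * \<delta>" using \<delta> by (intro mult_right_mono) auto
          then have "b i (x i \<omega>) + \<delta> \<le> \<epsilon> + real (j + 2) * \<delta>" by (simp add: by_eq algebra_simps)
          then show ?thesis using \<omega>(3) p1 by (simp add: a_def)
        qed
        have lo: "a j < p i \<omega>"
        proof (cases "y \<ge> 0")
          case True
          then have "real j \<le> y" unfolding j_def by linarith
          then have "real j * \<delta> \<le> y * \<delta>" using \<delta> by (intro mult_right_mono) auto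
          then show ?thesis using \<omega>(2) by (auto simp: a_def by_eq min_def)
        next
          case neg: False
          then have "j = 0" unfolding j_def by linarith
          then show ?thesis using False by (auto simp: a_def min_def)
        qed
        show ?thesis using J jn up lo \<omega>(1) by (auto simp: E_def)
      qed (use \<omega> in auto)
    qed
    then have "prob {\<omega>\<in>space M. b i (x i \<omega>) < p i \<omega> \<and> p i \<omega> \<le> b i (x i \<omega>) + \<delta>}
      \<le> prob ({\<omega>\<in>space M. p i \<omega> \<le> \<epsilon>} \<union> (\<Union>j\<in>{..n}. x i -` {u. J i u = j} \<inter> E i j))"
      using XE ev[OF i1, of \<epsilon>] by (intro finite_measure_mono) auto
    also have "\<dots> \<le> prob {\<omega>\<in>space M. p i \<omega> \<le> \<epsilon>} + prob (\<Union>j\<in>{..n}. x i -` {u. J i u = j} \<inter> E i j)"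
      using XE ev[OF i1, of \<epsilon>] by (intro measure_Un_le) auto
    also have "\<dots> \<le> g + (\<Sum>j\<le>n. prob (x i -` {u. J i u = j} \<inter> E i j))"
      using XE by (intro add_mono small[OF i1] finite_measure_subadditive_finite) auto
    finally show ?thesis .
  qed
  have AEs: "AE \<omega> in M. \<forall>\<sigma>\<in>PiE {1..m} (\<lambda>_. {..n}). (\<Sum>i\<in>{1..m}. q i (\<sigma> i) \<omega>) / real m \<le> c * (2 * \<delta>)"
  proof (rule AE_finite_allI)
    show "finite (PiE {1..m} (\<lambda>_. {..n}))" by (intro finite_PiE) auto
    fix \<sigma> :: "nat \<Rightarrow> nat"
    have mx: "0 \<le> (MAX i\<in>{1..m}. \<bar>a (\<sigma> i + 2) - a (\<sigma> i)\<bar>)" "(MAX i\<in>{1..m}. \<bar>a (\<sigma> i + 2) - a (\<sigma> i)\<bar>) \<le> 2 * \<delta>"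
      using m a_diff by (auto simp: Max_ge_iff)
    have "c0 * (MAX i\<in>{1..m}. \<bar>a (\<sigma> i + 2) - a (\<sigma> i)\<bar>) \<le> c * (2 * \<delta>)"
      using mx c0 by (intro order_trans[OF mult_right_mono mult_left_mono]) auto
    note le = this
    have "\<forall>i\<in>{1..m}. a (\<sigma> i + 2) \<in> {\<epsilon>..1} \<and> a (\<sigma> i) \<in> {\<epsilon>..1}" using a by blast
    from lip[OF this] show "AE \<omega> in M. (\<Sum>i\<in>{1..m}. q i (\<sigma> i) \<omega>) / real m \<le> c * (2 * \<delta>)"
      unfolding q_def by eventually_elim (use le in linarith)
  qed
  have "(\<Sum>i\<in>{1..m}. \<Sum>j\<le>n. prob (x i -` {u. J i u = j} \<inter> E i j)) / real m
    = (\<integral>\<omega>. (\<Sum>i\<in>{1..m}. \<Sum>j\<le>n. indicator {u. J i u = j} (x i \<omega>) * q i j \<omega>) / real m \<partial>M)"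
  proof -
    define f where "f = (\<lambda>i j \<omega>. indicator {u. J i u = j} (x i \<omega>) * q i j \<omega>)"
    have f: "integrable M (f i j)" "(\<integral>\<omega>. f i j \<omega> \<partial>M) = prob (x i -` {u. J i u = j} \<inter> E i j)"
      if "i \<in> {1..m}" for i j unfolding f_def by (fact q_int[OF that] q_eq[OF that])+
    have "(\<Sum>i\<in>{1..m}. \<Sum>j\<le>n. prob (x i -` {u. J i u = j} \<inter> E i j)) = (\<Sum>i\<in>{1..m}. \<integral>\<omega>. (\<Sum>j\<le>n. f i j \<omega>) \<partial>M)"
      using f by (intro sum.cong refl) (simp del: vimage_Collect_eq)
    also have "\<dots> = (\<integral>\<omega>. (\<Sum>i\<in>{1..m}. \<Sum>j\<le>n. f i j \<omega>) \<partial>M)"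
      using f(1) by (intro Bochner_Integration.integral_sum[symmetric] Bochner_Integration.integrable_sum) auto
    finally show ?thesis unfolding f_def by simp
  qed
  also have "\<dots> \<le> (\<integral>\<omega>. c * (2 * \<delta>) \<partial>M)"
  proof (rule integral_mono_AE)
    show "integrable M (\<lambda>\<omega>. (\<Sum>i\<in>{1..m}. \<Sum>j\<le>n. indicator {u. J i u = j} (x i \<omega>) * q i j \<omega>) / real m)"
      by (intro integrable_divide Bochner_Integration.integrable_sum q_int)
    show "AE \<omega> in M. (\<Sum>i\<in>{1..m}. \<Sum>j\<le>n. indicator {u. J i u = j} (x i \<omega>) * q i j \<omega>) / real m \<le> c * (2 * \<delta>)"
      using AEs
    proof eventually_elim
      case (elim \<omega>)
      let ?\<sigma> = "restrict (\<lambda>i. J i (x i \<omega>)) {1..m}"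
      have "(\<Sum>j\<le>n. indicator {u. J i u = j} (x i \<omega>) * q i j \<omega>) = q i (?\<sigma> i) \<omega>" if "i \<in> {1..m}" for i
      proof -
        have "J i (x i \<omega>) \<le> n" by (simp add: J_def)
        then have "(\<Sum>j\<le>n. indicator {u. J i u = j} (x i \<omega>) * q i j \<omega>) = (\<Sum>j\<le>n. if j = J i (x i \<omega>) then q i j \<omega> else 0)"
          by (intro sum.cong) auto
        then show ?thesis using that \<open>J i (x i \<omega>) \<le> n\<close> by simp
      qed
      then have "(\<Sum>i\<in>{1..m}. \<Sum>j\<le>n. indicator {u. J i u = j} (x i \<omega>) * q i j \<omega>) = (\<Sum>i\<in>{1..m}. q i (?\<sigma> i) \<omega>)"
        by (intro sum.cong) auto
      moreover have "?\<sigma> \<in> PiE {1..m} (\<lambda>_. {..n})" by (auto simp: J_def)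
      ultimately show ?case using elim by metis
    qed
  qed simp
  also have "\<dots> = c * (2 * \<delta>)" by (simp add: prob_space)
  finally have main: "(\<Sum>i\<in>{1..m}. \<Sum>j\<le>n. prob (x i -` {u. J i u = j} \<inter> E i j)) / real m \<le> c * (2 * \<delta>)" .
  have "(\<Sum>i\<in>{1..m}. prob {\<omega>\<in>space M. b i (x i \<omega>) < p i \<omega> \<and> p i \<omega> \<le> b i (x i \<omega>) + \<delta>}) / real m
    \<le> (\<Sum>i\<in>{1..m}. g + (\<Sum>j\<le>n. prob (x i -` {u. J i u = j} \<inter> E i j))) / real m"
    using cover by (intro divide_right_mono sum_mono) auto
  also have "\<dots> = g + (\<Sum>i\<in>{1..m}. \<Sum>j\<le>n. prob (x i -` {u. J i u = j} \<inter> E i j)) / real m"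
    using m by (simp add: sum.distrib add_divide_distrib)
  finally show ?thesis using main by linarith
qed

lemma null_threshold_symmetry:
  fixes Y :: "'a \<Rightarrow> real^'q::finite" and Q :: "'a \<Rightarrow> real" and c :: "real^'q \<Rightarrow> real"
  assumes Y: "Y \<in> borel_measurable M" and Q: "Q \<in> borel_measurable M"
    and c: "c \<in> borel_measurable borel" "\<And>u. 0 \<le> c u" "\<And>u. c u \<le> 1"
    and dens: "\<And>A. A \<in> sets borel \<Longrightarrow> AE \<omega> in M. condP M Y {\<omega>'\<in>space M. Q \<omega>' \<in> A} \<omega>
        = set_lebesgue_integral lborel (A \<inter> {0..1}) f0"
    and sym: "\<And>a. 0 \<le> a \<Longrightarrow> a \<le> 1 \<Longrightarrow>
         set_lebesgue_integral lborel {0..a} f0 \<le> set_lebesgue_integral lborel {1-a..1} f0"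
  shows "prob {\<omega>\<in>space M. Q \<omega> \<le> c (Y \<omega>)} \<le> prob {\<omega>\<in>space M. 1 - Q \<omega> < c (Y \<omega>)}"
proof -
  let ?\<mu> = "\<lambda>A. set_lebesgue_integral lborel (A \<inter> {0..1}) f0"
  have joint: "prob (Y -` D \<inter> {\<omega>\<in>space M. Q \<omega> \<in> A}) = prob (Y -` D \<inter> space M) * ?\<mu> A"
    if A: "A \<in> sets borel" and D: "D \<in> sets borel" for A D
  proof -
    have QA: "{\<omega>\<in>space M. Q \<omega> \<in> A} \<in> events" using Q A by measurable
    have YD: "Y -` D \<inter> space M \<in> events" using Y D by (rule measurable_sets)
    have "prob (Y -` D \<inter> {\<omega>\<in>space M. Q \<omega> \<in> A}) = (\<integral>\<omega>. indicator D (Y \<omega>) * condP M Y {\<omega>\<in>space M. Q \<omega> \<in> A} \<omega> \<partial>M)"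
      by (rule condP_integral(2)[OF Y QA D, symmetric])
    also have "\<dots> = (\<integral>\<omega>. indicator (Y -` D \<inter> space M) \<omega> * ?\<mu> A \<partial>M)"
    proof (rule integral_cong_AE)
      show "(\<lambda>\<omega>. indicator D (Y \<omega>) * condP M Y {\<omega>\<in>space M. Q \<omega> \<in> A} \<omega>) \<in> borel_measurable M"
        using condP_integral(1)[OF Y QA D] by measurable
      show "(\<lambda>\<omega>. indicator (Y -` D \<inter> space M) \<omega> * ?\<mu> A) \<in> borel_measurable M"
        using YD by (intro borel_measurable_times borel_measurable_indicator) auto
      show "AE \<omega> in M. indicator D (Y \<omega>) * condP M Y {\<omega>\<in>space M. Q \<omega> \<in> A} \<omega> = indicator (Y -` D \<inter> space M) \<omega> * ?\<mu> A"
        using dens[OF A] by (rule AE_mp) (auto intro!: AE_I2 simp: indicator_def)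
    qed
    also have "\<dots> = prob (Y -` D \<inter> space M) * ?\<mu> A" using YD by (simp add: sets.Int_space_eq2)
    finally show ?thesis .
  qed
  have \<mu>: "prob (Q -` A \<inter> space M) = ?\<mu> A" if A: "A \<in> sets borel" for A
    using joint[OF A, of UNIV] by (simp add: prob_space Int_def vimage_def conj_commute)
  interpret DQ: prob_space "distr M borel Q" using Q by (rule prob_space_distr)
  interpret DY: prob_space "distr M borel Y" using Y by (rule prob_space_distr)
  have YQ: "(\<lambda>\<omega>. (Y \<omega>, Q \<omega>)) \<in> measurable M (borel \<Otimes>\<^sub>M borel)" using Y Q by measurable
  have prod: "distr M borel Y \<Otimes>\<^sub>M distr M borel Q = distr M (borel \<Otimes>\<^sub>M borel) (\<lambda>\<omega>. (Y \<omega>, Q \<omega>))"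
  proof (rule pair_measure_eqI)
    fix D A assume "D \<in> sets (distr M borel Y)" "A \<in> sets (distr M borel Q)"
    then have D: "D \<in> sets borel" and A: "A \<in> sets borel" by auto
    have "(\<lambda>\<omega>. (Y \<omega>, Q \<omega>)) -` (D \<times> A) \<inter> space M = Y -` D \<inter> {\<omega>\<in>space M. Q \<omega> \<in> A}" by auto
    then have "emeasure (distr M (borel \<Otimes>\<^sub>M borel) (\<lambda>\<omega>. (Y \<omega>, Q \<omega>))) (D \<times> A) = ennreal (prob (Y -` D \<inter> {\<omega>\<in>space M. Q \<omega> \<in> A}))"
      using D A YQ by (subst emeasure_distr) (auto simp: emeasure_eq_measure)
    also have "\<dots> = ennreal (prob (Y -` D \<inter> space M) * prob (Q -` A \<inter> space M))"
      using joint[OF A D] \<mu>[OF A] by simp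
    also have "\<dots> = emeasure (distr M borel Y) D * emeasure (distr M borel Q) A"
      using D A Y Q by (simp add: emeasure_distr emeasure_eq_measure ennreal_mult)
    finally show "emeasure (distr M borel Y) D * emeasure (distr M borel Q) A = emeasure (distr M (borel \<Otimes>\<^sub>M borel) (\<lambda>\<omega>. (Y \<omega>, Q \<omega>))) (D \<times> A)" by simp
  qed (simp_all add: DY.sigma_finite_measure_axioms DQ.sigma_finite_measure_axioms)
  have fub: "emeasure M {\<omega>\<in>space M. (Y \<omega>, Q \<omega>) \<in> E} = (\<integral>\<^sup>+u. emeasure (distr M borel Q) (Pair u -` E) \<partial>distr M borel Y)"
    if E: "E \<in> sets (borel \<Otimes>\<^sub>M borel)" for E
  proof -
    have "emeasure M {\<omega>\<in>space M. (Y \<omega>, Q \<omega>) \<in> E} = emeasure (distr M (borel \<Otimes>\<^sub>M borel) (\<lambda>\<omega>. (Y \<omega>, Q \<omega>))) E"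
      using E YQ by (subst emeasure_distr) (auto intro!: arg_cong[where f="emeasure M"])
    also have "\<dots> = (\<integral>\<^sup>+u. emeasure (distr M borel Q) (Pair u -` E) \<partial>distr M borel Y)"
      unfolding prod[symmetric] using E by (intro DQ.emeasure_pair_measure_alt) simp
    finally show ?thesis .
  qed
  have le: "emeasure (distr M borel Q) {v. v \<le> y} \<le> emeasure (distr M borel Q) {v. 1 - v < y}"
    if y: "0 \<le> y" "y \<le> 1" for y :: real
  proof -
    have s1: "{v. v \<le> y} \<inter> {0..1} = {0..y}" using y by auto
    have s2: "{v. 1 - v < y} \<inter> {0..1} = {1 - y<..1}" using y by auto
    have "?\<mu> {v. v \<le> y} = set_lebesgue_integral lborel {0..y} f0" by (simp only: s1)
    also have "\<dots> \<le> set_lebesgue_integral lborel {1 - y..1} f0" by (rule sym[OF y])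
    also have "\<dots> = set_lebesgue_integral lborel {1 - y<..1} f0"
      by (rule set_integral_discrete_difference[where X="{1 - y}"]) auto
    also have "\<dots> = ?\<mu> {v. 1 - v < y}" by (simp only: s2)
    finally have "prob (Q -` {v. v \<le> y} \<inter> space M) \<le> prob (Q -` {v. 1 - v < y} \<inter> space M)"
      by (subst (1 2) \<mu>) auto
    then show ?thesis using Q
      by (subst (1 2) emeasure_distr) (auto simp: emeasure_eq_measure)
  qed
  have E1: "{z. snd z \<le> c (fst z)} \<in> sets (borel \<Otimes>\<^sub>M borel :: ((real^'q) \<times> real) measure)"
    and E2: "{z. 1 - snd z < c (fst z)} \<in> sets (borel \<Otimes>\<^sub>M borel :: ((real^'q) \<times> real) measure)"
  proof -
    have [measurable]: "c \<in> borel_measurable borel" by (rule c)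
    have "{z \<in> space (borel \<Otimes>\<^sub>M borel). snd z \<le> c (fst z)} \<in> sets (borel \<Otimes>\<^sub>M borel :: ((real^'q) \<times> real) measure)"
      "{z \<in> space (borel \<Otimes>\<^sub>M borel). 1 - snd z < c (fst z)} \<in> sets (borel \<Otimes>\<^sub>M borel :: ((real^'q) \<times> real) measure)"
      by measurable
    then show "{z. snd z \<le> c (fst z)} \<in> sets (borel \<Otimes>\<^sub>M borel :: ((real^'q) \<times> real) measure)"
      "{z. 1 - snd z < c (fst z)} \<in> sets (borel \<Otimes>\<^sub>M borel :: ((real^'q) \<times> real) measure)"
      by (simp_all add: space_pair_measure)
  qed
  have "emeasure M {\<omega>\<in>space M. Q \<omega> \<le> c (Y \<omega>)} \<le> emeasure M {\<omega>\<in>space M. 1 - Q \<omega> < c (Y \<omega>)}"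
    using fub[OF E1] fub[OF E2] le c(2,3) by (auto simp: vimage_def intro!: nn_integral_mono)
  then show ?thesis by (simp add: emeasure_eq_measure)
qed

end

section \<open>Control of the false discovery proportion\<close>

definition cutoff :: "real \<Rightarrow> real \<Rightarrow> real \<Rightarrow> (real \<times> (real^'q::finite)) \<times> (real \<times> (real^'q)) \<Rightarrow> real^'q \<Rightarrow> real" where
  "cutoff e1 e2 t tb u = thr t (winsor e1 e2 (logistic (fst tb) u)) (logistic (snd tb) u)"

lemma cutoff_bounds: "0 \<le> cutoff e1 e2 t tb u" "cutoff e1 e2 t tb u \<le> 1"
  by (simp_all add: cutoff_def thr_nonneg thr_le_1)

lemma continuous_on_cutoff:
  assumes e: "0 < e1" "0 < e2" "e1 < 1 - e2"
    and "continuous_on S f" "continuous_on S g" "continuous_on S h" "\<And>z. z \<in> S \<Longrightarrow> 0 < f z \<and> f z < 1"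
  shows "continuous_on S (\<lambda>z. cutoff e1 e2 (f z) (g z) (h z))"
  unfolding cutoff_def
proof (intro continuous_on_thr continuous_intros assms)
  fix z assume "z \<in> S"
  then show "0 < f z \<and> f z < 1 \<and> 0 < winsor e1 e2 (logistic (fst (g z)) (h z)) \<and>
      winsor e1 e2 (logistic (fst (g z)) (h z)) < 1 \<and> 0 < logistic (snd (g z)) (h z) \<and> logistic (snd (g z)) (h z) < 1"
    using assms(7)[of z] winsor_bounds[OF e(3), of "logistic (fst (g z)) (h z)"] e
    by (auto simp: logistic_pos logistic_less_1)
qed

lemma borel_measurable_cutoff:
  assumes "0 < e1" "0 < e2" "e1 < 1 - e2" "0 < t" "t < 1"
  shows "cutoff e1 e2 t tb \<in> borel_measurable borel"
  using continuous_on_cutoff[of e1 e2 UNIV "\<lambda>_. t" "\<lambda>_. tb" "\<lambda>u. u"] assms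
  by (intro borel_measurable_continuous_onI) simp

lemma fdp_eq:
  "fdp m H P t PiV K = real (card {i\<in>{1..m}. H i = 0 \<and> P i \<le> thr t (PiV i) (K i)})
     / real (card {i\<in>{1..m}. P i \<le> thr t (PiV i) (K i)})"
proof -
  have "(\<Sum>i\<in>{1..m}. real (1 - H i) * (if P i \<le> thr t (PiV i) (K i) then 1 else 0))
    = (\<Sum>i\<in>{1..m}. if H i = 0 \<and> P i \<le> thr t (PiV i) (K i) then 1 else 0)"
    by (intro sum.cong) auto
  then show ?thesis unfolding fdp_def by (simp only: sum.inter_filter[symmetric] finite_atLeastAtMost) simp
qed

lemma fdp_le_1: "fdp m H P t PiV K \<le> 1"
proof -
  have le: "real a / real b \<le> 1" if "a \<le> b" for a b using that by (cases "b = 0") auto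
  show ?thesis unfolding fdp_eq by (rule le, rule card_mono) auto
qed

lemma sets_borel_less_le:
  fixes f g :: "'c::topological_space \<Rightarrow> real"
  assumes "f \<in> borel_measurable borel" "g \<in> borel_measurable borel"
  shows "{z. f z \<le> g z} \<in> sets borel" "{z. f z < g z} \<in> sets borel"
  using borel_measurable_le[OF assms] borel_measurable_less[OF assms] by simp_all

context alpha_mixing
begin

lemma weak_law_count:
  assumes Q: "\<And>i. {z. Q i z} \<in> sets borel" and g: "g > 0"
  shows "\<forall>\<^sub>F (m, \<omega>) in whp M. \<bar>real (card {i\<in>{1..m}. Q i (X i \<omega>)}) / real m
     - (\<Sum>i\<in>{1..m}. prob {\<omega>\<in>space M. Q i (X i \<omega>)}) / real m\<bar> < g"
proof -
  have eq: "X i -` {z. Q i z} \<inter> space M = {\<omega>\<in>space M. Q i (X i \<omega>)}" for i by auto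
  from tendstoD[OF weak_law_indicator[of "\<lambda>i. {z. Q i z}", OF Q, unfolded eq] g]
    eventually_whp_sequentially[of "\<lambda>_. True", OF eventually_True]
  show ?thesis
  proof eventually_elim
    case (elim z)
    obtain m \<omega> where z: "z = (m, \<omega>)" by (cases z)
    have "(\<Sum>i\<in>{1..m}. indicator {\<omega>\<in>space M. Q i (X i \<omega>)} \<omega>) = (\<Sum>i\<in>{1..m}. if Q i (X i \<omega>) then 1 else 0 :: real)"
      using elim(2) z by (intro sum.cong) auto
    also have "\<dots> = real (card {i\<in>{1..m}. Q i (X i \<omega>)})"
      by (simp only: sum.inter_filter[symmetric] finite_atLeastAtMost) simp
    finally show ?case using elim(1) z by (simp add: sum_subtractf diff_divide_distrib)
  qed
qed

end

context two_group_model
begin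

lemma cutoff_uniformly_continuous:
  assumes e: "0 < e1" "0 < e2" "e1 < 1 - e2" and t: "0 < ta" "te < 1" and d: "\<delta> > 0"
  obtains \<eta> where "\<eta> > 0"
    "\<And>t t' tb tb' u. t \<in> {ta..te} \<Longrightarrow> t' \<in> {ta..te} \<Longrightarrow> tb \<in> \<Theta> \<times> \<B> \<Longrightarrow> tb' \<in> \<Theta> \<times> \<B> \<Longrightarrow> norm u \<le> \<rho> \<Longrightarrow>
       \<bar>t - t'\<bar> < \<eta> \<Longrightarrow> dist tb tb' < \<eta> \<Longrightarrow> \<bar>cutoff e1 e2 t tb u - cutoff e1 e2 t' tb' u\<bar> < \<delta>"
proof -
  let ?K = "{ta..te} \<times> (\<Theta> \<times> \<B>) \<times> cball 0 \<rho>"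
  have "uniformly_continuous_on ?K (\<lambda>w. cutoff e1 e2 (fst w) (fst (snd w)) (snd (snd w)))"
    using t by (intro compact_uniformly_continuous continuous_on_cutoff[OF e] continuous_intros compact_Times compact_params) auto
  then obtain \<eta> where \<eta>: "\<eta> > 0" "\<And>w w'. w \<in> ?K \<Longrightarrow> w' \<in> ?K \<Longrightarrow> dist w w' < \<eta> \<Longrightarrow>
     dist (cutoff e1 e2 (fst w) (fst (snd w)) (snd (snd w))) (cutoff e1 e2 (fst w') (fst (snd w')) (snd (snd w'))) < \<delta>"
    using d unfolding uniformly_continuous_on_def by (metis dist_commute)
  show ?thesis
  proof (rule that[of "\<eta> / 2"])
    fix t t' tb tb' and u :: "real^'q"
    assume a: "t \<in> {ta..te}" "t' \<in> {ta..te}" "tb \<in> \<Theta> \<times> \<B>" "tb' \<in> \<Theta> \<times> \<B>" "norm u \<le> \<rho>"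
       "\<bar>t - t'\<bar> < \<eta> / 2" "dist tb tb' < \<eta> / 2"
    have "dist (t, tb, u) (t', tb', u) = sqrt ((dist t t')\<^sup>2 + (dist tb tb')\<^sup>2)"
      by (simp add: dist_prod_def[of "(t, tb, u)"] dist_prod_def[of "(tb, u)"])
    also have "\<dots> \<le> dist t t' + dist tb tb'" by (rule sqrt_sum_squares_le_sum) auto
    also have "\<dots> < \<eta>" using a by (simp add: dist_real_def)
    finally have "dist (t, tb, u) (t', tb', u) < \<eta>" .
    from \<eta>(2)[OF _ _ this] a show "\<bar>cutoff e1 e2 t tb u - cutoff e1 e2 t' tb' u\<bar> < \<delta>"
      by (simp add: dist_real_def)
  qed (use \<eta> in simp)
qed

lemma fdp_le_whp:
  fixes est :: "nat \<Rightarrow> 'a \<Rightarrow> (real \<times> (real^'q)) \<times> (real \<times> (real^'q))" and H :: "nat \<Rightarrow> nat"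
  assumes e: "0 < e1" "0 < e2" "e1 < 1 - e2" and \<alpha>: "0 < \<alpha>" "\<alpha> < 1"
    and tbs: "tbs \<in> \<Theta> \<times> \<B>"
    and est: "\<And>m \<omega>. \<omega> \<in> space M \<Longrightarrow> est m \<omega> \<in> \<Theta> \<times> \<B>"
    and consistent: "\<And>\<eta>. \<eta> > 0 \<Longrightarrow> \<forall>\<^sub>F (m, \<omega>) in whp M. dist (est m \<omega>) tbs < \<eta>"
    and interval: "\<And>g. g > 0 \<Longrightarrow> \<exists>\<delta>>0. \<exists>m0. \<forall>m\<ge>m0. \<forall>b :: real^'q \<Rightarrow> real. b \<in> borel_measurable borel \<longrightarrow>
        (\<Sum>i\<in>{1..m}. prob {\<omega>\<in>space M. b (x i \<omega>) < p i \<omega> \<and> p i \<omega> \<le> b (x i \<omega>) + \<delta>}) / real m \<le> g"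
    and null: "\<And>i c. i \<ge> 1 \<Longrightarrow> H i = 0 \<Longrightarrow> c \<in> borel_measurable borel \<Longrightarrow> (\<And>u. 0 \<le> c u) \<Longrightarrow> (\<And>u. c u \<le> 1) \<Longrightarrow>
        prob {\<omega>\<in>space M. p i \<omega> \<le> c (x i \<omega>)} \<le> prob {\<omega>\<in>space M. 1 - p i \<omega> < c (x i \<omega>)}"
    and t': "0 < t'" "t' < 1"
    and lim0: "(\<lambda>m. (\<Sum>i\<in>{1..m}. prob {\<omega>\<in>space M. p i \<omega> \<le> cutoff e1 e2 t' tbs (x i \<omega>)}) / real m) \<longlonglongrightarrow> g0"
    and lim1: "(\<lambda>m. (\<Sum>i\<in>{1..m}. prob {\<omega>\<in>space M. 1 - p i \<omega> < cutoff e1 e2 t' tbs (x i \<omega>)}) / real m) \<longlonglongrightarrow> g1"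
    and g0: "0 < g0" "g1 < \<alpha> * g0" and \<gamma>: "\<gamma> > 0"
  defines "PiV \<equiv> \<lambda>m \<omega> i. winsor e1 e2 (logistic (fst (est m \<omega>)) (x i \<omega>))"
    and "K \<equiv> \<lambda>m \<omega> i. logistic (snd (est m \<omega>)) (x i \<omega>)"
  shows "\<forall>\<^sub>F (m, \<omega>) in whp M. fdp m H (\<lambda>i. p i \<omega>) (that \<alpha> m (\<lambda>i. p i \<omega>) (PiV m \<omega>) (K m \<omega>)) (PiV m \<omega>) (K m \<omega>) \<le> \<alpha> + \<gamma>"
proof -
  obtain \<kappa> where \<kappa>: "0 < \<kappa>" "\<kappa> < 1"
    "\<And>\<beta> u. \<beta> \<in> \<B> \<Longrightarrow> norm u \<le> \<rho> \<Longrightarrow> \<kappa> \<le> logistic \<beta> u \<and> logistic \<beta> u \<le> 1 - \<kappa>"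
    by (rule logistic_bounds_params) blast
  define t1 where "t1 = max t' (1 / (1 + \<kappa> * e2))"
  have ke: "0 < \<kappa> * e2" using \<kappa> e by simp
  have t1: "0 < t1" "t1 < 1" "t' \<le> t1" using t' ke by (auto simp: t1_def less_max_iff_disj)
  have t1_ratio: "(1 - t1) / t1 \<le> \<kappa> * e2"
  proof -
    have "(1 + \<kappa> * e2) * (1 / (1 + \<kappa> * e2)) \<le> (1 + \<kappa> * e2) * t1"
      using ke by (intro mult_left_mono) (auto simp: t1_def)
    then have "1 \<le> (1 + \<kappa> * e2) * t1" using ke by simp
    then show ?thesis using t1(1) by (simp add: divide_le_eq algebra_simps)
  qed
  define g where "g = min (min (\<gamma> * g0 / 8) ((\<alpha> * g0 - g1) / 10)) (g0 / 10)"
  have "g \<le> min (\<gamma> * g0 / 8) ((\<alpha> * g0 - g1) / 10)" "g \<le> g0 / 10" "g > 0"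
    using g0 \<gamma> by (simp_all only: g_def min.cobounded1 min.cobounded2, simp)
  then have g: "g > 0" "g \<le> \<gamma> * g0 / 8" "10 * g \<le> \<alpha> * g0 - g1" "10 * g \<le> g0" by simp_all
  obtain \<delta> m0 where \<delta>: "\<delta> > 0" and mass: "\<And>m b. m \<ge> m0 \<Longrightarrow> b \<in> borel_measurable borel \<Longrightarrow>
        (\<Sum>i\<in>{1..m}. prob {\<omega>\<in>space M. b (x i \<omega>) < p i \<omega> \<and> p i \<omega> \<le> b (x i \<omega>) + \<delta>}) / real m \<le> g"
    using interval[OF g(1)] by blast
  obtain \<eta> where \<eta>: "\<eta> > 0"
    "\<And>t s tb tb' u. t \<in> {t'..t1} \<Longrightarrow> s \<in> {t'..t1} \<Longrightarrow> tb \<in> \<Theta> \<times> \<B> \<Longrightarrow> tb' \<in> \<Theta> \<times> \<B> \<Longrightarrow> norm u \<le> \<rho> \<Longrightarrow>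
       \<bar>t - s\<bar> < \<eta> \<Longrightarrow> dist tb tb' < \<eta> \<Longrightarrow> \<bar>cutoff e1 e2 t tb u - cutoff e1 e2 s tb' u\<bar> < \<delta>"
    using cutoff_uniformly_continuous[OF e t'(1) t1(2) \<delta>] by metis
  have "{t'..t1} \<subseteq> (\<Union>s\<in>{t'..t1}. ball s \<eta>)" using \<eta>(1) by force
  from compactE_image[OF compact_Icc _ this]
  obtain T where T: "T \<subseteq> {t'..t1}" "finite T" "{t'..t1} \<subseteq> (\<Union>s\<in>T. ball s \<eta>)" by (metis open_ball)
  define c where "c = (\<lambda>s. cutoff e1 e2 s tbs)"
  have c_meas: "c s \<in> borel_measurable borel" if "s \<in> {t'..t1}" for s
    unfolding c_def using e that t' t1 by (intro borel_measurable_cutoff) auto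
  have cf: "(\<lambda>z. c s (fst z)) \<in> borel_measurable (borel :: ((real^'q) \<times> real) measure)" if "s \<in> {t'..t1}" for s
    by (rule measurable_compose[OF fst_borel_measurable c_meas[OF that]])
  define VQ where "VQ = (\<lambda>s i (z :: (real^'q) \<times> real). H i = 0 \<and> snd z \<le> c s (fst z) + \<delta>)"
  define NQ where "NQ = (\<lambda>s (i::nat) (z :: (real^'q) \<times> real). 1 - snd z < c s (fst z) - \<delta>)"
  define DQ where "DQ = (\<lambda>(i::nat) (z :: (real^'q) \<times> real). snd z \<le> c t' (fst z) - \<delta>)"
  define NU where "NU = (\<lambda>(i::nat) (z :: (real^'q) \<times> real). 1 - snd z < c t' (fst z) + \<delta>)"
  have tt: "t' \<in> {t'..t1}" using t1 by simp
  have VQ_meas: "{z. VQ s i z} \<in> sets borel" if "s \<in> {t'..t1}" for s i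
    unfolding VQ_def using cf[OF that] by (cases "H i = 0") (auto intro!: sets_borel_less_le)
  have NQ_meas: "{z. NQ s i z} \<in> sets borel" if "s \<in> {t'..t1}" for s i
    unfolding NQ_def using cf[OF that] by (intro sets_borel_less_le) auto
  have DQ_meas: "{z. DQ i z} \<in> sets borel" for i
    unfolding DQ_def using cf[OF tt] by (intro sets_borel_less_le) auto
  have NU_meas: "{z. NU i z} \<in> sets borel" for i
    unfolding NU_def using cf[OF tt] by (intro sets_borel_less_le) auto
  define av where "av = (\<lambda>Q m. (\<Sum>i\<in>{1..m}. prob {\<omega>\<in>space M. Q i (x i \<omega>, p i \<omega>)}) / real m)"
  define ct where "ct = (\<lambda>(Q :: nat \<Rightarrow> (real^'q) \<times> real \<Rightarrow> bool) m \<omega>. real (card {i\<in>{1..m}. Q i (x i \<omega>, p i \<omega>)}))"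
  have law: "\<forall>\<^sub>F (m, \<omega>) in whp M. \<bar>ct Q m \<omega> / real m - av Q m\<bar> < g" if "\<And>i. {z. Q i z} \<in> sets borel" for Q
    unfolding ct_def av_def using weak_law_count[of Q, OF that g(1)] .
  have ev: "{\<omega>\<in>space M. p i \<omega> \<le> f (x i \<omega>) + d} \<in> events" "{\<omega>\<in>space M. 1 - p i \<omega> < f (x i \<omega>) + d} \<in> events"
    "{\<omega>\<in>space M. f (x i \<omega>) < p i \<omega> \<and> p i \<omega> \<le> f (x i \<omega>) + d} \<in> events"
    if "i \<ge> 1" and f: "f \<in> borel_measurable borel" for f :: "real^'q \<Rightarrow> real" and d i
  proof -
    have [measurable]: "p i \<in> borel_measurable M" "(\<lambda>\<omega>. f (x i \<omega>)) \<in> borel_measurable M"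
      using p_measurable[OF that(1)] measurable_compose[OF x_measurable[OF that(1)] f] by auto
    show "{\<omega>\<in>space M. p i \<omega> \<le> f (x i \<omega>) + d} \<in> events" "{\<omega>\<in>space M. 1 - p i \<omega> < f (x i \<omega>) + d} \<in> events"
    "{\<omega>\<in>space M. f (x i \<omega>) < p i \<omega> \<and> p i \<omega> \<le> f (x i \<omega>) + d} \<in> events"
      by measurable
  qed
  have split: "prob A \<le> prob B + prob C" if "A \<subseteq> B \<union> C" "B \<in> events" "C \<in> events" for A B C
    using that finite_measure_mono[of A "B \<union> C"] measure_Un_le[of B M C] by auto
  have split_av: "(\<Sum>i\<in>{1..m}. prob (A i)) / real m \<le> (\<Sum>i\<in>{1..m}. prob (B i)) / real m + (\<Sum>i\<in>{1..m}. prob (C i)) / real m"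
    if "\<And>i. i \<ge> 1 \<Longrightarrow> A i \<subseteq> B i \<union> C i" "\<And>i. i \<ge> 1 \<Longrightarrow> B i \<in> events" "\<And>i. i \<ge> 1 \<Longrightarrow> C i \<in> events" for A B C m
    unfolding add_divide_distrib[symmetric] sum.distrib[symmetric]
    using that by (intro divide_right_mono sum_mono split) auto
  have avV: "av (VQ s) m \<le> av (NQ s) m + 2 * g" if m: "m \<ge> m0" and s: "s \<in> {t'..t1}" for m s
  proof -
    note cm = c_meas[OF s]
    have cm': "(\<lambda>u. 1 - c s u) \<in> borel_measurable borel" using cm by measurable
    have "av (VQ s) m \<le> (\<Sum>i\<in>{1..m}. prob {\<omega>\<in>space M. H i = 0 \<and> p i \<omega> \<le> c s (x i \<omega>)}) / real m
      + (\<Sum>i\<in>{1..m}. prob {\<omega>\<in>space M. c s (x i \<omega>) < p i \<omega> \<and> p i \<omega> \<le> c s (x i \<omega>) + \<delta>}) / real m"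
      unfolding av_def
    proof (rule split_av)
      fix i :: nat assume i: "i \<ge> 1"
      show "{\<omega>\<in>space M. H i = 0 \<and> p i \<omega> \<le> c s (x i \<omega>)} \<in> events"
        using ev(1)[OF i cm, of 0] by (cases "H i = 0") auto
    qed (use ev(3)[OF _ cm] in \<open>auto simp: VQ_def\<close>)
    also have "(\<Sum>i\<in>{1..m}. prob {\<omega>\<in>space M. H i = 0 \<and> p i \<omega> \<le> c s (x i \<omega>)}) / real m
      \<le> (\<Sum>i\<in>{1..m}. prob {\<omega>\<in>space M. 1 - p i \<omega> < c s (x i \<omega>)}) / real m"
    proof (intro divide_right_mono sum_mono)
      fix i assume "i \<in> {1..m}"
      then show "prob {\<omega>\<in>space M. H i = 0 \<and> p i \<omega> \<le> c s (x i \<omega>)} \<le> prob {\<omega>\<in>space M. 1 - p i \<omega> < c s (x i \<omega>)}"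
        using null[OF _ _ cm, of i] by (cases "H i = 0") (auto simp: c_def cutoff_bounds)
    qed simp
    also have "(\<Sum>i\<in>{1..m}. prob {\<omega>\<in>space M. 1 - p i \<omega> < c s (x i \<omega>)}) / real m
      \<le> av (NQ s) m + (\<Sum>i\<in>{1..m}. prob {\<omega>\<in>space M. 1 - c s (x i \<omega>) < p i \<omega> \<and> p i \<omega> \<le> 1 - c s (x i \<omega>) + \<delta>}) / real m"
      unfolding av_def
    proof (rule split_av)
      fix i :: nat assume i: "i \<ge> 1"
      show "{\<omega>\<in>space M. NQ s i (x i \<omega>, p i \<omega>)} \<in> events" using ev(2)[OF i cm, of "- \<delta>"] by (simp add: NQ_def)
    qed (use ev(3)[OF _ cm'] in \<open>auto simp: NQ_def\<close>)
    finally show ?thesis using mass[OF m cm] mass[OF m cm'] by linarith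
  qed
  have avD: "(\<Sum>i\<in>{1..m}. prob {\<omega>\<in>space M. p i \<omega> \<le> c t' (x i \<omega>)}) / real m \<le> av DQ m + g" if m: "m \<ge> m0" for m
  proof -
    note cm = c_meas[OF tt]
    have cm': "(\<lambda>u. c t' u - \<delta>) \<in> borel_measurable borel" using cm by measurable
    have "(\<Sum>i\<in>{1..m}. prob {\<omega>\<in>space M. p i \<omega> \<le> c t' (x i \<omega>)}) / real m \<le> av DQ m
      + (\<Sum>i\<in>{1..m}. prob {\<omega>\<in>space M. c t' (x i \<omega>) - \<delta> < p i \<omega> \<and> p i \<omega> \<le> c t' (x i \<omega>) - \<delta> + \<delta>}) / real m"
      unfolding av_def
    proof (rule split_av)
      fix i :: nat assume i: "i \<ge> 1"
      show "{\<omega>\<in>space M. DQ i (x i \<omega>, p i \<omega>)} \<in> events" using ev(1)[OF i cm, of "- \<delta>"] by (simp add: DQ_def)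
    qed (use ev(3)[OF _ cm', of _ \<delta>] in \<open>auto simp: DQ_def\<close>)
    then show ?thesis using mass[OF m cm'] by linarith
  qed
  have avN: "av NU m \<le> (\<Sum>i\<in>{1..m}. prob {\<omega>\<in>space M. 1 - p i \<omega> < c t' (x i \<omega>)}) / real m + g" if m: "m \<ge> m0" for m
  proof -
    note cm = c_meas[OF tt]
    have cm': "(\<lambda>u. 1 - c t' u - \<delta>) \<in> borel_measurable borel" using cm by measurable
    have "av NU m \<le> (\<Sum>i\<in>{1..m}. prob {\<omega>\<in>space M. 1 - p i \<omega> < c t' (x i \<omega>)}) / real m
      + (\<Sum>i\<in>{1..m}. prob {\<omega>\<in>space M. 1 - c t' (x i \<omega>) - \<delta> < p i \<omega> \<and> p i \<omega> \<le> 1 - c t' (x i \<omega>) - \<delta> + \<delta>}) / real m"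
      unfolding av_def
    proof (rule split_av)
      fix i :: nat assume i: "i \<ge> 1"
      show "{\<omega>\<in>space M. 1 - p i \<omega> < c t' (x i \<omega>)} \<in> events" using ev(2)[OF i cm, of 0] by simp
    qed (use ev(3)[OF _ cm', of _ \<delta>] in \<open>auto simp: NU_def\<close>)
    then show ?thesis using mass[OF m cm'] by linarith
  qed
  have "\<forall>\<^sub>F z in whp M. \<forall>s\<in>T. case z of (m, \<omega>) \<Rightarrow> \<bar>ct (VQ s) m \<omega> / real m - av (VQ s) m\<bar> < g"
    using T(1) by (intro eventually_ball_finite[OF T(2)] ballI law VQ_meas) auto
  moreover have "\<forall>\<^sub>F z in whp M. \<forall>s\<in>T. case z of (m, \<omega>) \<Rightarrow> \<bar>ct (NQ s) m \<omega> / real m - av (NQ s) m\<bar> < g"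
    using T(1) by (intro eventually_ball_finite[OF T(2)] ballI law NQ_meas) auto
  moreover have "\<forall>\<^sub>F (m, \<omega>) in whp M. \<bar>ct DQ m \<omega> / real m - av DQ m\<bar> < g" by (rule law[OF DQ_meas])
  moreover have "\<forall>\<^sub>F (m, \<omega>) in whp M. \<bar>ct NU m \<omega> / real m - av NU m\<bar> < g" by (rule law[OF NU_meas])
  moreover note consistent[OF \<eta>(1)]
  moreover have "\<forall>\<^sub>F (m, \<omega>) in whp M. (m \<ge> m0 \<and> m \<ge> 1 \<and> 1 / real m < g
      \<and> (\<Sum>i\<in>{1..m}. prob {\<omega>\<in>space M. p i \<omega> \<le> c t' (x i \<omega>)}) / real m > g0 - g
      \<and> (\<Sum>i\<in>{1..m}. prob {\<omega>\<in>space M. 1 - p i \<omega> < c t' (x i \<omega>)}) / real m < g1 + g) \<and> \<omega> \<in> space M"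
    unfolding c_def using g(1)
    by (intro eventually_whp_sequentially eventually_conj eventually_ge_at_top order_tendstoD[OF lim0] order_tendstoD[OF lim1]
      order_tendstoD(2)[OF lim_1_over_n]) auto
  ultimately show ?thesis
  proof eventually_elim
    case (elim z)
    obtain m \<omega> where z: "z = (m, \<omega>)" by (cases z)
    have \<omega>: "\<omega> \<in> space M" and m: "m \<ge> m0" "m \<ge> 1" "1 / real m < g"
      and l0: "(\<Sum>i\<in>{1..m}. prob {\<omega>\<in>space M. p i \<omega> \<le> c t' (x i \<omega>)}) / real m > g0 - g"
      and l1: "(\<Sum>i\<in>{1..m}. prob {\<omega>\<in>space M. 1 - p i \<omega> < c t' (x i \<omega>)}) / real m < g1 + g"
      using elim(6) z by auto
    have dist: "dist (est m \<omega>) tbs < \<eta>" using elim(5) z by simp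
    define ch where "ch = (\<lambda>t i. thr t (PiV m \<omega> i) (K m \<omega> i))"
    have ch: "ch t i = cutoff e1 e2 t (est m \<omega>) (x i \<omega>)" for t i
      by (simp add: ch_def PiV_def K_def cutoff_def)
    have close: "\<bar>ch t i - c s (x i \<omega>)\<bar> < \<delta>" if "t \<in> {t'..t1}" "s \<in> {t'..t1}" "\<bar>t - s\<bar> < \<eta>" "i \<in> {1..m}" for t s i
      unfolding ch c_def using that x_bound[of i \<omega>] \<omega> est[OF \<omega>, of m] tbs dist by (intro \<eta>(2)) auto
    define N where "N = (\<lambda>t. card {i\<in>{1..m}. 1 - p i \<omega> < ch t i})"
    define D where "D = (\<lambda>t. card {i\<in>{1..m}. p i \<omega> \<le> ch t i})"
    define V where "V = (\<lambda>t. card {i\<in>{1..m}. H i = 0 \<and> p i \<omega> \<le> ch t i})"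
    have Dt': "ct DQ m \<omega> \<le> real (D t')"
      unfolding ct_def D_def using close[OF tt tt] \<eta>(1)
      by (intro of_nat_mono card_mono subsetI) (fastforce simp: DQ_def)+
    have Nt': "real (N t') \<le> ct NU m \<omega>"
      unfolding ct_def N_def using close[OF tt tt] \<eta>(1)
      by (intro of_nat_mono card_mono subsetI) (fastforce simp: NU_def)+
    have "\<bar>ct DQ m \<omega> / real m - av DQ m\<bar> < g" using elim(3) z by simp
    then have "ct DQ m \<omega> / real m \<ge> g0 - 3 * g" using avD[OF m(1)] l0 by linarith
    then have Dlow: "real (D t') / real m \<ge> g0 - 3 * g"
      using Dt' divide_right_mono[of "ct DQ m \<omega>" "real (D t')" "real m"] by linarith
    have "\<bar>ct NU m \<omega> / real m - av NU m\<bar> < g" using elim(4) z by simp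
    then have "ct NU m \<omega> / real m \<le> g1 + 3 * g" using avN[OF m(1)] l1 by linarith
    then have "(1 + real (N t')) / real m \<le> g1 + 4 * g"
      using Nt' divide_right_mono[of "real (N t')" "ct NU m \<omega>" "real m"] m by (simp add: add_divide_distrib)
    also have "\<dots> \<le> \<alpha> * (g0 - 3 * g)"
    proof -
      have "\<alpha> * g \<le> g" using g(1) \<alpha> by (intro mult_left_le_one_le) auto
      moreover have "\<alpha> * (g0 - 3 * g) = \<alpha> * g0 - 3 * (\<alpha> * g)" by (simp add: algebra_simps)
      ultimately show ?thesis using g(1,3) by linarith
    qed
    also have "\<dots> \<le> \<alpha> * (real (D t') / real m)" using Dlow \<alpha> by (intro mult_left_mono) auto
    finally have feas: "1 + real (N t') \<le> \<alpha> * real (D t')" using m(2) by (simp add: divide_le_cancel)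
    define th where "th = that \<alpha> m (\<lambda>i. p i \<omega>) (PiV m \<omega>) (K m \<omega>)"
    have est': "fst (est m \<omega>) \<in> \<Theta>" "snd (est m \<omega>) \<in> \<B>" using est[OF \<omega>, of m] by auto
    have PiV: "0 < PiV m \<omega> i \<and> PiV m \<omega> i \<le> 1 - e2" for i
      unfolding PiV_def using winsor_bounds[OF e(3)] e(1) by (meson less_le_trans)
    have K: "0 < K m \<omega> i \<and> K m \<omega> i \<le> 1 - \<kappa>" if "i \<in> {1..m}" for i
      unfolding K_def using \<kappa>(3)[OF est'(2) x_bound[OF _ \<omega>]] that \<kappa>(1) by (auto simp: logistic_pos)
    have p01: "0 < p i \<omega> \<and> p i \<omega> \<le> 1" if "i \<in> {1..m}" for i using p_range[OF _ \<omega>] that by auto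
    note F = that_feasible[OF p01 PiV K e(2) \<kappa>(1) \<alpha> t1(1,2) t1_ratio t' feas[unfolded N_def D_def ch_def]]
    have feasible: "t' \<le> th" "th \<le> t1" "1 + real (N th) \<le> \<alpha> * real (D th)"
      unfolding th_def N_def D_def ch_def by (rule F, assumption+)+
    have th: "th \<in> {t'..t1}" using feasible by simp
    then obtain s where s: "s \<in> T" "\<bar>th - s\<bar> < \<eta>" using T(3) by (force simp: dist_real_def abs_minus_commute)
    have s': "s \<in> {t'..t1}" using s T(1) by blast
    have Vth: "real (V th) \<le> ct (VQ s) m \<omega>"
      unfolding ct_def V_def using close[OF th s' s(2)]
      by (intro of_nat_mono card_mono subsetI) (fastforce simp: VQ_def)+
    have Nth: "ct (NQ s) m \<omega> \<le> real (N th)"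
      unfolding ct_def N_def using close[OF th s' s(2)]
      by (intro of_nat_mono card_mono subsetI) (fastforce simp: NQ_def)+
    have "\<bar>ct (VQ s) m \<omega> / real m - av (VQ s) m\<bar> < g" "\<bar>ct (NQ s) m \<omega> / real m - av (NQ s) m\<bar> < g"
      using elim(1,2) z s(1) by auto
    then have "ct (VQ s) m \<omega> / real m \<le> ct (NQ s) m \<omega> / real m + 4 * g" using avV[OF m(1) s'] by linarith
    then have "ct (VQ s) m \<omega> \<le> ct (NQ s) m \<omega> + 4 * g * real m" using m(2) by (simp add: field_simps)
    then have Vle: "real (V th) \<le> \<alpha> * real (D th) + 4 * g * real m" using Vth Nth feasible(3) by linarith
    have "D t' \<le> D th"
      unfolding D_def
    proof (intro card_mono subsetI)
      fix i assume i: "i \<in> {i\<in>{1..m}. p i \<omega> \<le> ch t' i}"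
      have "ch t' i \<le> ch th i" unfolding ch_def using th t' t1 PiV[of i] K[of i] e(2) \<kappa>(1) i by (intro thr_mono) auto
      then show "i \<in> {i\<in>{1..m}. p i \<omega> \<le> ch th i}" using i by auto
    qed auto
    then have "real (D th) / real m \<ge> g0 - 3 * g"
      using Dlow divide_right_mono[of "real (D t')" "real (D th)" "real m"] by simp
    then have "real (D th) / real m \<ge> g0 / 2" using g(4) g0(1) by linarith
    then have Dth: "real (D th) \<ge> g0 / 2 * real m" using m(2) by (simp add: field_simps)
    have Dpos: "0 < real (D th)" using Dth g0(1) m(2) by (intro less_le_trans[OF _ Dth] mult_pos_pos) auto
    have "4 * g * real m \<le> \<gamma> * g0 / 2 * real m" using g(2) by (intro mult_right_mono) auto
    also have "\<dots> = \<gamma> * (g0 / 2 * real m)" by simp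
    also have "\<dots> \<le> \<gamma> * real (D th)" using Dth \<gamma> by (intro mult_left_mono) auto
    finally have "real (V th) \<le> (\<alpha> + \<gamma>) * real (D th)" using Vle by (simp add: algebra_simps)
    then have "real (V th) / real (D th) \<le> \<alpha> + \<gamma>" using Dpos by (simp add: divide_le_eq)
    then show ?case unfolding z by (simp add: fdp_eq V_def D_def ch_def th_def)
  qed
qed

end

theorem theorem2:
  fixes M :: "'a measure"
    and x :: "nat \<Rightarrow> 'a \<Rightarrow> real^'q::finite"
    and p :: "nat \<Rightarrow> 'a \<Rightarrow> real"
    and H :: "nat \<Rightarrow> nat"
    and \<alpha> \<epsilon>1 \<epsilon>2 :: real
    and \<Theta> \<B> :: "(real \<times> (real^'q)) set"
    and thetahat betahat :: "nat \<Rightarrow> 'a \<Rightarrow> real \<times> (real^'q)"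
    and R :: "(real \<times> (real^'q)) \<times> (real \<times> (real^'q)) \<Rightarrow> real"
    and \<theta>s \<beta>s :: "real \<times> (real^'q)"
    and t0 :: real
    and G0 G1 G1t :: "real \<Rightarrow> real"
    and f0 :: "real \<Rightarrow> real"
  assumes prob: "prob_space M"
    and x_meas: "\<And>i. i \<ge> 1 \<Longrightarrow> x i \<in> borel_measurable M"
    and p_meas: "\<And>i. i \<ge> 1 \<Longrightarrow> p i \<in> borel_measurable M"
    and p_range: "\<And>i \<omega>. i \<ge> 1 \<Longrightarrow> \<omega> \<in> space M \<Longrightarrow> 0 < p i \<omega> \<and> p i \<omega> \<le> 1"
    and H_range: "\<And>i. H i \<in> {0, 1}"
    and alpha: "0 < \<alpha>" "\<alpha> < 1"
    and eps: "0 < \<epsilon>1" "0 < \<epsilon>2" "\<epsilon>1 < 1 - \<epsilon>2"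
    \<comment> \<open>the estimator: a measurable maximizer of the likelihood over Theta x B\<close>
    and est_meas: "\<And>m. thetahat m \<in> borel_measurable M" "\<And>m. betahat m \<in> borel_measurable M"
    and est_in: "\<And>m \<omega>. \<omega> \<in> space M \<Longrightarrow> thetahat m \<omega> \<in> \<Theta> \<and> betahat m \<omega> \<in> \<B>"
    and est_max: "\<And>m \<omega> \<theta> \<beta>. \<omega> \<in> space M \<Longrightarrow> \<theta> \<in> \<Theta> \<Longrightarrow> \<beta> \<in> \<B> \<Longrightarrow>
         loglik m (\<lambda>i. x i \<omega>) (\<lambda>i. p i \<omega>) \<theta> \<beta>
           \<le> loglik m (\<lambda>i. x i \<omega>) (\<lambda>i. p i \<omega>) (thetahat m \<omega>) (betahat m \<omega>)"
    \<comment> \<open>A1\<close>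
    and A1: "compact \<Theta>" "compact \<B>"
    \<comment> \<open>A2\<close>
    and A2_unif: "uniform_limit (\<Theta> \<times> \<B>)
         (\<lambda>m tb. (\<Sum>i\<in>{1..m}. \<integral>\<omega>. lik_term (logistic (fst tb) (x i \<omega>))
                                          (logistic (snd tb) (x i \<omega>)) (p i \<omega>) \<partial>M) / real m)
         R sequentially"
    and A2_max: "(\<theta>s, \<beta>s) \<in> \<Theta> \<times> \<B>"
         "\<And>tb. tb \<in> \<Theta> \<times> \<B> \<Longrightarrow> tb \<noteq> (\<theta>s, \<beta>s) \<Longrightarrow> R tb < R (\<theta>s, \<beta>s)"
    \<comment> \<open>A3\<close>
    and A3: "\<exists>r \<xi> \<delta>.
         ((1 < r \<and> r / (r - 1) < \<xi> \<and>
             alpha_mix M (\<lambda>i \<omega>. (x i \<omega>, p i \<omega>)) \<in> O(\<lambda>v. real v powr (- \<xi>)))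
          \<or> (1 \<le> r \<and> r / (2 * r - 1) < \<xi> \<and>
             phi_mix M (\<lambda>i \<omega>. (x i \<omega>, p i \<omega>)) \<in> O(\<lambda>v. real v powr (- \<xi>))))
         \<and> 0 < \<delta>
         \<and> (\<exists>Bd. \<forall>i\<ge>1. integrable M (\<lambda>\<omega>. \<bar>ln (p i \<omega>)\<bar> powr (r + \<delta>))
                        \<and> (\<integral>\<omega>. \<bar>ln (p i \<omega>)\<bar> powr (r + \<delta>) \<partial>M) \<le> Bd)"
    and A3_x: "\<exists>C. \<forall>i\<ge>1. \<forall>\<omega>\<in>space M. \<forall>j. \<bar>x i \<omega> $ j\<bar> < C"
    \<comment> \<open>A4\<close>
    and A4: "\<exists>\<epsilon>0>0. \<forall>\<epsilon>. 0 < \<epsilon> \<and> \<epsilon> < \<epsilon>0 \<longrightarrow> (\<exists>c0. \<exists>m0. \<forall>m\<ge>m0. \<forall>a b :: nat \<Rightarrow> real.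
         (\<forall>i\<in>{1..m}. a i \<in> {\<epsilon>..1} \<and> b i \<in> {\<epsilon>..1}) \<longrightarrow>
         (AE \<omega> in M. \<bar>(\<Sum>i\<in>{1..m}. condP M (x i) {\<omega>'\<in>space M. p i \<omega>' \<le> a i} \<omega>
                                   - condP M (x i) {\<omega>'\<in>space M. p i \<omega>' \<le> b i} \<omega>) / real m\<bar>
                      \<le> c0 * (MAX i\<in>{1..m}. \<bar>a i - b i\<bar>)))"
    \<comment> \<open>A5\<close>
    and t0: "0 < t0" "t0 < 1"
    and A5_G0: "\<And>t. t0 \<le> t \<Longrightarrow> t < 1 \<Longrightarrow>
         (\<lambda>m. (\<Sum>i\<in>{1..m}. measure M {\<omega>\<in>space M. p i \<omega> \<le>
               thr t (winsor \<epsilon>1 \<epsilon>2 (logistic \<theta>s (x i \<omega>))) (logistic \<beta>s (x i \<omega>))}) / real m)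
         \<longlonglongrightarrow> G0 t"
    and A5_G1: "\<And>t. t0 \<le> t \<Longrightarrow> t < 1 \<Longrightarrow>
         (\<lambda>m. (\<Sum>i\<in>{1..m}. measure M {\<omega>\<in>space M. 1 - p i \<omega> <
               thr t (winsor \<epsilon>1 \<epsilon>2 (logistic \<theta>s (x i \<omega>))) (logistic \<beta>s (x i \<omega>))}) / real m)
         \<longlonglongrightarrow> G1 t"
    and A5_G1t: "\<And>t. t0 \<le> t \<Longrightarrow> t < 1 \<Longrightarrow>
         (\<lambda>m. (\<Sum>i\<in>{i\<in>{1..m}. H i = 0}. measure M {\<omega>\<in>space M. p i \<omega> \<le>
               thr t (winsor \<epsilon>1 \<epsilon>2 (logistic \<theta>s (x i \<omega>))) (logistic \<beta>s (x i \<omega>))}) / real m)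
         \<longlonglongrightarrow> G1t t"
    and A5_cont: "continuous_on {t0..<1} G0" "continuous_on {t0..<1} G1" "continuous_on {t0..<1} G1t"
    \<comment> \<open>A6\<close>
    and A6: "\<exists>t'. t0 < t' \<and> t' < 1 \<and> 0 < G0 t' \<and> G1 t' / G0 t' < \<alpha>"
    \<comment> \<open>null p-values have conditional density f0 on [0,1], with the stated tail-symmetry\<close>
    and f0_nonneg: "\<And>u. 0 \<le> f0 u"
    and f0_int: "set_integrable lborel {0..1} f0"
    and null_density: "\<And>i A. i \<ge> 1 \<Longrightarrow> H i = 0 \<Longrightarrow> A \<in> sets borel \<Longrightarrow>
         AE \<omega> in M. condP M (x i) {\<omega>'\<in>space M. p i \<omega>' \<in> A} \<omega>
                      = set_lebesgue_integral lborel (A \<inter> {0..1}) f0"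
    and f0_sym: "\<And>a. 0 \<le> a \<Longrightarrow> a \<le> 1 \<Longrightarrow>
         set_lebesgue_integral lborel {0..a} f0 \<le> set_lebesgue_integral lborel {1-a..1} f0"
  shows "limsup (\<lambda>m. ereal (FDR M m H p
            (\<lambda>\<omega>. that \<alpha> m (\<lambda>i. p i \<omega>)
                     (\<lambda>i. winsor \<epsilon>1 \<epsilon>2 (logistic (thetahat m \<omega>) (x i \<omega>)))
                     (\<lambda>i. logistic (betahat m \<omega>) (x i \<omega>)))
            (\<lambda>\<omega> i. winsor \<epsilon>1 \<epsilon>2 (logistic (thetahat m \<omega>) (x i \<omega>)))
            (\<lambda>\<omega> i. logistic (betahat m \<omega>) (x i \<omega>))))
         \<le> ereal \<alpha>"
proof -
  interpret prob_space M by (rule prob)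
  let ?X = "\<lambda>i \<omega>. (x i \<omega>, p i \<omega>)"
  have X: "?X i \<in> borel_measurable M" if "i \<ge> 1" for i
    using x_meas[OF that] p_meas[OF that] by (rule borel_measurable_Pair)
  obtain r \<xi> \<delta> Bd where rate:
      "(1 < r \<and> r / (r - 1) < \<xi> \<and> alpha_mix M ?X \<in> O(\<lambda>v. real v powr (- \<xi>)))
        \<or> (1 \<le> r \<and> r / (2 * r - 1) < \<xi> \<and> phi_mix M ?X \<in> O(\<lambda>v. real v powr (- \<xi>)))"
    and \<delta>: "0 < \<delta>"
    and mom: "\<And>i. i \<ge> 1 \<Longrightarrow> integrable M (\<lambda>\<omega>. \<bar>ln (p i \<omega>)\<bar> powr (r + \<delta>))"
      "\<And>i. i \<ge> 1 \<Longrightarrow> (\<integral>\<omega>. \<bar>ln (p i \<omega>)\<bar> powr (r + \<delta>) \<partial>M) \<le> Bd"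
    using A3 by blast
  have r: "r + \<delta> > 1" using rate \<delta> by auto
  have mix: "alpha_mix M ?X \<longlonglongrightarrow> 0"
    using rate
  proof (elim disjE conjE)
    assume "1 < r" "r / (r - 1) < \<xi>" and O: "alpha_mix M ?X \<in> O(\<lambda>v. real v powr (- \<xi>))"
    then have "0 < \<xi>" by (smt (verit) divide_pos_pos)
    from bigo_powr_tendsto_0[OF O this] show ?thesis .
  next
    assume "1 \<le> r" "r / (2 * r - 1) < \<xi>" and O: "phi_mix M ?X \<in> O(\<lambda>v. real v powr (- \<xi>))"
    then have "0 < \<xi>" by (smt (verit) divide_pos_pos)
    from bigo_powr_tendsto_0[OF O this] show ?thesis by (rule phi_mixing_imp_alpha_mixing[rotated]) (rule X)
  qed
  obtain C where C: "\<And>i \<omega> j. i \<ge> 1 \<Longrightarrow> \<omega> \<in> space M \<Longrightarrow> \<bar>x i \<omega> $ j\<bar> < C" using A3_x by blast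
  have xb: "norm (x i \<omega>) \<le> real CARD('q) * C" if "i \<ge> 1" "\<omega> \<in> space M" for i \<omega>
  proof -
    have "norm (x i \<omega>) \<le> (\<Sum>j\<in>UNIV. \<bar>x i \<omega> $ j\<bar>)" by (rule norm_le_l1_cart)
    also have "\<dots> \<le> (\<Sum>j\<in>(UNIV :: 'q set). C)" using C[OF that] by (intro sum_mono) (auto intro: less_imp_le)
    finally show ?thesis by simp
  qed
  interpret two_group_model M x p "real CARD('q) * C" "r + \<delta>" Bd \<Theta> \<B>
    using X mix p_range xb A1 r mom by unfold_locales auto
  define est where "est = (\<lambda>m \<omega>. (thetahat m \<omega>, betahat m \<omega>))"
  have est: "est m \<omega> \<in> \<Theta> \<times> \<B>" if "\<omega> \<in> space M" for m \<omega> using est_in[OF that] by (simp add: est_def)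
  have lim: "uniform_limit (\<Theta> \<times> \<B>)
      (\<lambda>m tb. (\<Sum>i\<in>{1..m}. \<integral>\<omega>. lik tb (x i \<omega>, p i \<omega>) \<partial>M) / real m) R sequentially"
    using A2_unif by (simp add: lik_def)
  have consistent: "\<forall>\<^sub>F (m, \<omega>) in whp M. dist (est m \<omega>) (\<theta>s, \<beta>s) < \<eta>" if "\<eta> > 0" for \<eta>
  proof (rule mle_consistent[OF lim A2_max est _ that])
    show "(\<Sum>i\<in>{1..m}. lik tb (x i \<omega>, p i \<omega>)) \<le> (\<Sum>i\<in>{1..m}. lik (est m \<omega>) (x i \<omega>, p i \<omega>))"
      if "\<omega> \<in> space M" "tb \<in> \<Theta> \<times> \<B>" for m \<omega> tb
      using est_max[OF that(1), of "fst tb" "snd tb" m] that(2) by (auto simp: loglik_def lik_def est_def)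
  qed
  obtain \<epsilon>0 where \<epsilon>0: "\<epsilon>0 > 0" and A4': "\<And>\<epsilon>. 0 < \<epsilon> \<Longrightarrow> \<epsilon> < \<epsilon>0 \<Longrightarrow> \<exists>c0. \<exists>m0. \<forall>m\<ge>m0. \<forall>a b :: nat \<Rightarrow> real.
         (\<forall>i\<in>{1..m}. a i \<in> {\<epsilon>..1} \<and> b i \<in> {\<epsilon>..1}) \<longrightarrow>
         (AE \<omega> in M. \<bar>(\<Sum>i\<in>{1..m}. condP M (x i) {\<omega>'\<in>space M. p i \<omega>' \<le> a i} \<omega>
                                   - condP M (x i) {\<omega>'\<in>space M. p i \<omega>' \<le> b i} \<omega>) / real m\<bar>
                      \<le> c0 * (MAX i\<in>{1..m}. \<bar>a i - b i\<bar>))"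
    using A4 by blast
  have interval: "\<exists>\<delta>>0. \<exists>m0. \<forall>m\<ge>m0. \<forall>b :: real^'q \<Rightarrow> real. b \<in> borel_measurable borel \<longrightarrow>
        (\<Sum>i\<in>{1..m}. prob {\<omega>\<in>space M. b (x i \<omega>) < p i \<omega> \<and> p i \<omega> \<le> b (x i \<omega>) + \<delta>}) / real m \<le> g" if g: "g > 0" for g
  proof -
    have "g / 2 > 0" using g by simp
    then obtain \<tau> where \<tau>: "0 < \<tau>" "\<tau> < 1" "\<And>i \<tau>'. i \<ge> 1 \<Longrightarrow> \<tau>' \<le> \<tau> \<Longrightarrow> prob {\<omega>\<in>space M. p i \<omega> \<le> \<tau>'} \<le> g / 2"
      by (rule prob_p_le_small) blast
    define \<epsilon> where "\<epsilon> = min \<tau> (\<epsilon>0 / 2)"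
    have \<epsilon>: "0 < \<epsilon>" "\<epsilon> < \<epsilon>0" "\<epsilon> \<le> 1" "\<epsilon> \<le> \<tau>" using \<tau> \<epsilon>0 by (auto simp: \<epsilon>_def)
    obtain c0 m0 where lip: "\<And>m a b. m \<ge> m0 \<Longrightarrow> (\<forall>i\<in>{1..m}. a i \<in> {\<epsilon>..1} \<and> b i \<in> {\<epsilon>..1}) \<Longrightarrow>
         (AE \<omega> in M. \<bar>(\<Sum>i\<in>{1..m}. condP M (x i) {\<omega>'\<in>space M. p i \<omega>' \<le> a i} \<omega>
                                   - condP M (x i) {\<omega>'\<in>space M. p i \<omega>' \<le> b i} \<omega>) / real m\<bar>
                      \<le> c0 * (MAX i\<in>{1..m}. \<bar>a i - b i\<bar>))"
      using A4'[OF \<epsilon>(1,2)] by blast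
    define c where "c = max c0 0"
    define d where "d = g / (4 * (c + 1))"
    have c: "c0 \<le> c" "0 \<le> c" by (auto simp: c_def)
    have d: "d > 0" using g c by (simp add: d_def)
    have cd: "c * (2 * d) \<le> g / 2"
    proof -
      have "c * (2 * d) \<le> (c + 1) * (2 * d)" using d by (intro mult_right_mono) auto
      also have "\<dots> = g / 2" using c by (simp add: d_def field_simps)
      finally show ?thesis .
    qed
    have "(\<Sum>i\<in>{1..m}. prob {\<omega>\<in>space M. b (x i \<omega>) < p i \<omega> \<and> p i \<omega> \<le> b (x i \<omega>) + d}) / real m \<le> g"
      if m: "m \<ge> max m0 1" and b: "b \<in> borel_measurable borel" for m and b :: "real^'q \<Rightarrow> real"
    proof -
      have "(\<Sum>i\<in>{1..m}. prob {\<omega>\<in>space M. b (x i \<omega>) < p i \<omega> \<and> p i \<omega> \<le> b (x i \<omega>) + d}) / real m \<le> g / 2 + c * (2 * d)"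
        using m b p_range \<tau>(3)[OF _ \<epsilon>(4)]
        by (intro covariate_interval_mass[OF x_meas p_meas _ \<epsilon>(1,3) _ lip c d]) auto
      then show ?thesis using cd by linarith
    qed
    then show ?thesis using d by blast
  qed
  have null: "prob {\<omega>\<in>space M. p i \<omega> \<le> c (x i \<omega>)} \<le> prob {\<omega>\<in>space M. 1 - p i \<omega> < c (x i \<omega>)}"
    if "i \<ge> 1" "H i = 0" "c \<in> borel_measurable borel" "\<And>u. 0 \<le> c u" "\<And>u. c u \<le> 1" for i c
    by (rule null_threshold_symmetry[OF x_meas p_meas that(3-5) null_density f0_sym]) (use that in auto)
  obtain t' where t': "t0 < t'" "t' < 1" "0 < G0 t'" "G1 t' / G0 t' < \<alpha>" using A6 by blast
  have t'0: "0 < t'" and G: "G1 t' < \<alpha> * G0 t'" using t' t0 by (auto simp: divide_less_eq)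
  have l0: "(\<lambda>m. (\<Sum>i\<in>{1..m}. prob {\<omega>\<in>space M. p i \<omega> \<le> cutoff \<epsilon>1 \<epsilon>2 t' (\<theta>s, \<beta>s) (x i \<omega>)}) / real m) \<longlonglongrightarrow> G0 t'"
    using A5_G0[of t'] t' by (simp add: cutoff_def)
  have l1: "(\<lambda>m. (\<Sum>i\<in>{1..m}. prob {\<omega>\<in>space M. 1 - p i \<omega> < cutoff \<epsilon>1 \<epsilon>2 t' (\<theta>s, \<beta>s) (x i \<omega>)}) / real m) \<longlonglongrightarrow> G1 t'"
    using A5_G1[of t'] t' by (simp add: cutoff_def)
  show ?thesis unfolding FDR_def
  proof (rule limsup_integral_le)
    fix g :: real assume g: "g > 0"
    show "\<forall>\<^sub>F (m, \<omega>) in whp M. fdp m H (\<lambda>i. p i \<omega>)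
            (that \<alpha> m (\<lambda>i. p i \<omega>)
                     (\<lambda>i. winsor \<epsilon>1 \<epsilon>2 (logistic (thetahat m \<omega>) (x i \<omega>)))
                     (\<lambda>i. logistic (betahat m \<omega>) (x i \<omega>)))
            (\<lambda>i. winsor \<epsilon>1 \<epsilon>2 (logistic (thetahat m \<omega>) (x i \<omega>)))
            (\<lambda>i. logistic (betahat m \<omega>) (x i \<omega>)) \<le> \<alpha> + g"
      using fdp_le_whp[OF eps alpha A2_max(1) est consistent interval null t'0 t'(2) l0 l1 t'(3) G g]
      unfolding est_def fst_conv snd_conv .
  qed (use alpha fdp_le_1 in auto)
qed

end
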